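(* Let $V$ be a vertex operator algebra of class $\mathcal{A}$, i.e. such that $L(0)$ acts semisimply on every weak $V$-module. Then there are only finitely many inequivalent irreducible $\mathbb{N}$-gradable weak $V$-modules, and for any three irreducible $V$-modules $W_1,W_2,W_3$ the fusion rule $\dim I\binom{W_3}{W_1\,W_2}$ is finite. In particular, these assertions hold if $V$ is regular.
   Context: All vector spaces are over $\mathbb{C}$ and $\mathbb{N}=\{0,1,2,\dots\}$. A vertex operator algebra $V=\coprod_{n\in\mathbb{Z}}V_{(n)}$ is meant in the standard sense of Frenkel–Huang–Lepowsky: vertex operators $Y(v,x)=\sum_{n\in\mathbb{Z}}v_nx^{-n-1}$, vacuum $\mathbf{1}$, Virasoro vector $\omega$ with $Y(\omega,x)=\sum_n L(n)x^{-n-2}$, $V_{(n)}$ is the $L(0)$-eigenspace of eigenvalue $n$ (elements have weight $\mathrm{wt}\,v=n$), $\dim V_{(n)}<\infty$, and $V_{(n)}=0$ for $n$ sufficiently negative. A weak $V$-module is a vector space $W$ with a linear map $Y_W:V\to(\mathrm{End}\,W)[[x,x^{-1}]]$, $Y_W(v,x)=\sum_n v_nx^{-n-1}$, satisfying $Y_W(v,x)w\in W((x))$, $Y_W(\mathbf{1},x)=\mathrm{id}_W$ and the Jacobi identity. A (ordinary) $V$-module is a weak $V$-module $W=\coprod_{h\in\mathbb{C}}W_{(h)}$ graded by $L(0)$-eigenspaces with $\dim W_{(h)}<\infty$ and, for each $h\in\mathbb{C}$, $W_{(h+n)}=0$ for all sufficiently negative integers $n$. An $\mathbb{N}$-gradable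 weak $V$-module is a weak $V$-module $W$ admitting a grading $W=\coprod_{n\in\mathbb{N}}W(n)$ with $v_mW(n)\subseteq W(\mathrm{wt}\,v+n-m-1)$ for homogeneous $v\in V$, $m\in\mathbb{Z}$, $n\in\mathbb{N}$ (where $W(n)=0$ for $n<0$). $V$ is regular if every weak $V$-module is a direct sum of irreducible (ordinary) $V$-modules. For $V$-modules $W_1,W_2,W_3$, $I\binom{W_3}{W_1\,W_2}$ is the space of intertwining operators of the indicated type in the sense of Frenkel–Huang–Lepowsky: linear maps $\mathcal{Y}(\cdot,x):W_1\to \mathrm{Hom}(W_2,W_3)\{x\}$ (formal series with complex powers of $x$), $\mathcal{Y}(w,x)=\sum_{n\in\mathbb{C}}w_nx^{-n-1}$, satisfying the lower truncation condition ($w^1_{n}w^2=0$ for $n$ with sufficiently large real part), the $L(-1)$-derivative property $\mathcal{Y}(L(-1)w,x)=\frac{d}{dx}\mathcal{Y}(w,x)$, and the Jacobi identity with the vertex operators of $V$ on $W_1,W_2,W_3$. *)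

theory Defs
  imports Complex_Main "HOL-Library.Groups_Big_Fun" "HOL-Library.Function_Algebras"
begin

section \<open>Linear algebra\<close>

definition finite_dimensional :: "(complex \<Rightarrow> 'a::ab_group_add \<Rightarrow> 'a) \<Rightarrow> 'a set \<Rightarrow> bool" where
  "finite_dimensional s S \<longleftrightarrow> (\<exists>B. finite B \<and> module.span s B = S)"

definition is_direct_sum ::
  "(complex \<Rightarrow> 'a::ab_group_add \<Rightarrow> 'a) \<Rightarrow> 'a set \<Rightarrow> 'i set \<Rightarrow> ('i \<Rightarrow> 'a set) \<Rightarrow> bool" where
  "is_direct_sum s M I A \<longleftrightarrow>
     (\<forall>i\<in>I. module.subspace s (A i)) \<and>
     M = module.span s (\<Union>i\<in>I. A i) \<and>
     (\<forall>F x. finite F \<and> F \<subseteq> I \<and> (\<forall>i\<in>F. x i \<in> A i) \<and> (\<Sum>i\<in>F. x i) = 0 \<longrightarrow> (\<forall>i\<in>F. x i = 0))"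

definition linear_on ::
  "(complex \<Rightarrow> 'a::ab_group_add \<Rightarrow> 'a) \<Rightarrow> (complex \<Rightarrow> 'b::ab_group_add \<Rightarrow> 'b) \<Rightarrow> 'a set
    \<Rightarrow> ('a \<Rightarrow> 'b) \<Rightarrow> bool" where
  "linear_on s t M f \<longleftrightarrow>
     (\<forall>x\<in>M. \<forall>y\<in>M. f (x + y) = f x + f y) \<and> (\<forall>c. \<forall>x\<in>M. f (s c x) = t c (f x))"


section \<open>The Jacobi identity\<close>

text \<open>
  A series \<open>Y(w,x) = \<Sum>\<^sub>n w\<^sub>n x\<^sup>-\<^sup>n\<^sup>-\<^sup>1\<close> is represented by its modes, \<open>Y w n = w\<^sub>n\<close>, with \<open>n\<close> an integer
  for vertex operators and a complex number for intertwining operators.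

  The predicate below is the equality of the coefficients of \<open>x\<^sub>0\<^sup>-\<^sup>l\<^sup>-\<^sup>1 x\<^sub>1\<^sup>-\<^sup>m\<^sup>-\<^sup>1 x\<^sub>2\<^sup>-\<^sup>n\<^sup>-\<^sup>1\<close>, for all
  \<open>l\<close>, \<open>m\<close>, \<open>n\<close>, of the two sides of the Jacobi identity
  \<open>x\<^sub>0\<^sup>-\<^sup>1 \<delta>((x\<^sub>1 - x\<^sub>2)/x\<^sub>0) Y3(v,x\<^sub>1) J(a,x\<^sub>2) b - x\<^sub>0\<^sup>-\<^sup>1 \<delta>((x\<^sub>2 - x\<^sub>1)/(-x\<^sub>0)) J(a,x\<^sub>2) Y2(v,x\<^sub>1) b
     = x\<^sub>2\<^sup>-\<^sup>1 \<delta>((x\<^sub>1 - x\<^sub>0)/x\<^sub>2) J(Y1(v,x\<^sub>0) a, x\<^sub>2) b\<close>,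
  where binomials are expanded in nonnegative powers of their second variable; on the right,
  \<open>(-1)\<^sup>i binom(i-m-1, i) = binom(m, i)\<close>.
  \<open>Sum_any\<close> is the sum over the support; the supports are finite by the truncation conditions
  that accompany every use of this predicate.
\<close>

definition jacobi_identity ::
  "(complex \<Rightarrow> 'c::ab_group_add \<Rightarrow> 'c)
    \<Rightarrow> ('v \<Rightarrow> int \<Rightarrow> 'a \<Rightarrow> 'a) \<Rightarrow> ('v \<Rightarrow> int \<Rightarrow> 'b \<Rightarrow> 'b) \<Rightarrow> ('v \<Rightarrow> int \<Rightarrow> 'c \<Rightarrow> 'c)
    \<Rightarrow> ('a \<Rightarrow> 'n::ring_1 \<Rightarrow> 'b \<Rightarrow> 'c) \<Rightarrow> 'v \<Rightarrow> 'a \<Rightarrow> 'b \<Rightarrow> bool" where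
  "jacobi_identity s Y1 Y2 Y3 J v a b \<longleftrightarrow>
     (\<forall>(l::int) (m::int) (n::'n).
        Sum_any (\<lambda>i::nat. s ((-1) ^ i * (of_int l gchoose i))
          (Y3 v (m + l - int i) (J a (n + of_nat i) b)))
        - Sum_any (\<lambda>i::nat. s ((-1) powi l * (-1) ^ i * (of_int l gchoose i))
          (J a (n + of_int l - of_nat i) (Y2 v (m + int i) b)))
        = Sum_any (\<lambda>i::nat. s (of_int m gchoose i)
          (J (Y1 v (l + int i) a) (of_int m + n - of_nat i) b)))"


section \<open>Vertex operator algebras\<close>

record 'v voa =
  scale :: "complex \<Rightarrow> 'v \<Rightarrow> 'v"
  vertex :: "'v \<Rightarrow> int \<Rightarrow> 'v \<Rightarrow> 'v"
  vacuum :: 'v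
  conformal :: 'v

text \<open>\<open>Y\<close> may be the vertex operator map of the algebra or of a module.\<close>

definition virasoro :: "('v, 'e) voa_scheme \<Rightarrow> ('v \<Rightarrow> int \<Rightarrow> 'w \<Rightarrow> 'w) \<Rightarrow> int \<Rightarrow> 'w \<Rightarrow> 'w" where
  "virasoro V Y n = Y (conformal V) (n + 1)"

definition weight_space :: "('v, 'e) voa_scheme \<Rightarrow> int \<Rightarrow> 'v set" where
  "weight_space V n = {v. virasoro V (vertex V) 0 v = scale V (of_int n) v}"

definition vertex_operator_algebra :: "'v::ab_group_add voa \<Rightarrow> bool" where
  "vertex_operator_algebra V \<longleftrightarrow>
     vector_space (scale V) \<and>
     \<comment> \<open>grading by \<open>L(0)\<close>-eigenspaces\<close>
     is_direct_sum (scale V) UNIV UNIV (weight_space V) \<and>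
     (\<forall>n. finite_dimensional (scale V) (weight_space V n)) \<and>
     (\<exists>N. \<forall>n<N. weight_space V n = {0}) \<and>
     \<comment> \<open>vertex operators\<close>
     (\<forall>n u. linear_on (scale V) (scale V) UNIV (\<lambda>v. vertex V v n u)) \<and>
     (\<forall>v n. linear_on (scale V) (scale V) UNIV (vertex V v n)) \<and>
     (\<forall>u v. \<exists>N. \<forall>n\<ge>N. vertex V u n v = 0) \<and>
     \<comment> \<open>vacuum and creation properties\<close>
     (\<forall>n v. vertex V (vacuum V) n v = (if n = -1 then v else 0)) \<and>
     (\<forall>v. (\<forall>n\<ge>0. vertex V v n (vacuum V) = 0) \<and> vertex V v (-1) (vacuum V) = v) \<and>
     (\<forall>u v w. jacobi_identity (scale V) (vertex V) (vertex V) (vertex V) (vertex V) u v w) \<and>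
     \<comment> \<open>Virasoro relations with central charge \<open>c\<close>, and the \<open>L(-1)\<close>-derivative property\<close>
     (\<exists>c::complex. \<forall>m n v.
        virasoro V (vertex V) m (virasoro V (vertex V) n v)
        - virasoro V (vertex V) n (virasoro V (vertex V) m v)
        = scale V (of_int (m - n)) (virasoro V (vertex V) (m + n) v)
          + scale V (if m + n = 0 then of_int (m ^ 3 - m) / 12 * c else 0) v) \<and>
     (\<forall>v n u. vertex V (virasoro V (vertex V) (-1) v) n u = scale V (- of_int n) (vertex V v (n - 1) u))"


section \<open>Modules\<close>

text \<open>
  HOL cannot quantify over types, so modules live in a universe: a vector space \<open>'u\<close> with scalar
  multiplication \<open>s\<close>. The underlying space of a module is a linear subspace of \<open>'u\<close>, and only the
  values of the operators on that subspace matter. Up to isomorphism these are all modules of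
  dimension at most \<open>dim 'u\<close>. Since \<open>V\<close> has countable dimension, so does every cyclic (in
  particular every irreducible) weak module; hence, as soon as \<open>'u\<close> is infinite-dimensional, it
  contains all of them up to isomorphism. Semisimplicity of \<open>L(0)\<close> on all weak modules is
  equivalent to its semisimplicity on the cyclic ones, and regularity likewise only depends on
  the cyclic weak modules.
\<close>

record ('v, 'u) vmod =
  space :: "'u set"
  act :: "'v \<Rightarrow> int \<Rightarrow> 'u \<Rightarrow> 'u"

definition weak_module ::
  "'v::ab_group_add voa \<Rightarrow> (complex \<Rightarrow> 'u::ab_group_add \<Rightarrow> 'u) \<Rightarrow> ('v, 'u) vmod \<Rightarrow> bool" where
  "weak_module V s W \<longleftrightarrow>
     module.subspace s (space W) \<and>
     (\<forall>v n. \<forall>w\<in>space W. act W v n w \<in> space W) \<and>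
     (\<forall>v n. linear_on s s (space W) (act W v n)) \<and>
     (\<forall>n. \<forall>w\<in>space W. linear_on (scale V) s UNIV (\<lambda>v. act W v n w)) \<and>
     (\<forall>v. \<forall>w\<in>space W. \<exists>N. \<forall>n\<ge>N. act W v n w = 0) \<and>
     (\<forall>n. \<forall>w\<in>space W. act W (vacuum V) n w = (if n = -1 then w else 0)) \<and>
     (\<forall>u v. \<forall>w\<in>space W. jacobi_identity s (vertex V) (act W) (act W) (act W) u v w)"

definition L0_eigenspace ::
  "'v::ab_group_add voa \<Rightarrow> (complex \<Rightarrow> 'u::ab_group_add \<Rightarrow> 'u) \<Rightarrow> ('v, 'u) vmod \<Rightarrow> complex \<Rightarrow> 'u set" where
  "L0_eigenspace V s W h = {w \<in> space W. virasoro V (act W) 0 w = s h w}"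

text \<open>Over the complex numbers, semisimple means being the direct sum of the eigenspaces.\<close>

definition L0_semisimple ::
  "'v::ab_group_add voa \<Rightarrow> (complex \<Rightarrow> 'u::ab_group_add \<Rightarrow> 'u) \<Rightarrow> ('v, 'u) vmod \<Rightarrow> bool" where
  "L0_semisimple V s W \<longleftrightarrow> is_direct_sum s (space W) UNIV (L0_eigenspace V s W)"

definition ordinary_module ::
  "'v::ab_group_add voa \<Rightarrow> (complex \<Rightarrow> 'u::ab_group_add \<Rightarrow> 'u) \<Rightarrow> ('v, 'u) vmod \<Rightarrow> bool" where
  "ordinary_module V s W \<longleftrightarrow>
     weak_module V s W \<and>
     is_direct_sum s (space W) UNIV (L0_eigenspace V s W) \<and>
     (\<forall>h. finite_dimensional s (L0_eigenspace V s W h)) \<and>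
     (\<forall>h. \<exists>N::int. \<forall>n<N. L0_eigenspace V s W (h + of_int n) = {0})"

definition N_gradable_weak_module ::
  "'v::ab_group_add voa \<Rightarrow> (complex \<Rightarrow> 'u::ab_group_add \<Rightarrow> 'u) \<Rightarrow> ('v, 'u) vmod \<Rightarrow> bool" where
  "N_gradable_weak_module V s W \<longleftrightarrow>
     weak_module V s W \<and>
     (\<exists>G::nat \<Rightarrow> 'u set.
        is_direct_sum s (space W) UNIV G \<and>
        (\<forall>k. \<forall>v\<in>weight_space V k. \<forall>m n. \<forall>w\<in>G n.
           act W v m w \<in> (let d = k + int n - m - 1 in if d < 0 then {0} else G (nat d))))"

definition submodule ::
  "(complex \<Rightarrow> 'u::ab_group_add \<Rightarrow> 'u) \<Rightarrow> ('v, 'u) vmod \<Rightarrow> 'u set \<Rightarrow> bool" where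
  "submodule s W N \<longleftrightarrow>
     N \<subseteq> space W \<and> module.subspace s N \<and> (\<forall>v n. \<forall>w\<in>N. act W v n w \<in> N)"

definition irreducible ::
  "(complex \<Rightarrow> 'u::ab_group_add \<Rightarrow> 'u) \<Rightarrow> ('v, 'u) vmod \<Rightarrow> bool" where
  "irreducible s W \<longleftrightarrow>
     space W \<noteq> {0} \<and> (\<forall>N. submodule s W N \<longrightarrow> N = {0} \<or> N = space W)"

definition equivalent_modules ::
  "(complex \<Rightarrow> 'u::ab_group_add \<Rightarrow> 'u) \<Rightarrow> ('v, 'u) vmod \<Rightarrow> ('v, 'u) vmod \<Rightarrow> bool" where
  "equivalent_modules s W W' \<longleftrightarrow>
     (\<exists>f. linear_on s s (space W) f \<and> bij_betw f (space W) (space W') \<and>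
        (\<forall>v n. \<forall>w\<in>space W. f (act W v n w) = act W' v n (f w)))"

definition irreducible_N_gradable ::
  "'v::ab_group_add voa \<Rightarrow> (complex \<Rightarrow> 'u::ab_group_add \<Rightarrow> 'u) \<Rightarrow> ('v, 'u) vmod set" where
  "irreducible_N_gradable V s = {W. N_gradable_weak_module V s W \<and> irreducible s W}"

definition equivalence_on ::
  "(complex \<Rightarrow> 'u::ab_group_add \<Rightarrow> 'u) \<Rightarrow> ('v, 'u) vmod set \<Rightarrow> ('v, 'u) vmod rel" where
  "equivalence_on s C = {(W, W'). W \<in> C \<and> W' \<in> C \<and> equivalent_modules s W W'}"

lemma equiv_equivalence_on:
  fixes V :: "'v::ab_group_add voa" and s :: "complex \<Rightarrow> 'u::ab_group_add \<Rightarrow> 'u"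
  assumes "vector_space s"
  shows "equiv (irreducible_N_gradable V s) (equivalence_on s (irreducible_N_gradable V s))"
proof -
  interpret vector_space s by fact
  let ?C = "irreducible_N_gradable V s"
  have closed: "module.subspace s (space W)" "w \<in> space W \<Longrightarrow> act W v n w \<in> space W"
    if "W \<in> ?C" for W v n w
    using that by (auto simp: irreducible_N_gradable_def N_gradable_weak_module_def weak_module_def)
  have rfl: "equivalent_modules s W W" for W :: "('v, 'u) vmod"
    unfolding equivalent_modules_def by (rule exI[of _ id]) (auto simp: linear_on_def)
  have sy: "equivalent_modules s W' W"
    if "W \<in> ?C" "W' \<in> ?C" and eq: "equivalent_modules s W W'" for W W'
  proof -
    from eq obtain f where f: "linear_on s s (space W) f" "bij_betw f (space W) (space W')"
      "\<And>v n w. w \<in> space W \<Longrightarrow> f (act W v n w) = act W' v n (f w)"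
      by (auto simp: equivalent_modules_def)
    let ?g = "inv_into (space W) f"
    have g: "bij_betw ?g (space W') (space W)"
      by (rule bij_betw_inv_into[OF f(2)])
    have fg: "f (?g y) = y" if "y \<in> space W'" for y
      using f(2) that by (simp add: bij_betw_inv_into_right)
    have gf: "?g (f x) = x" if "x \<in> space W" for x
      using f(2) that by (simp add: bij_betw_inv_into_left)
    have gin: "?g y \<in> space W" if "y \<in> space W'" for y
      using g that by (auto simp: bij_betw_def)
    have add: "?g (x + y) = ?g x + ?g y" if "x \<in> space W'" "y \<in> space W'" for x y
    proof -
      have "f (?g x + ?g y) = x + y"
        using f(1) gin[OF that(1)] gin[OF that(2)] fg that by (simp add: linear_on_def)
      moreover have "?g x + ?g y \<in> space W"
        using closed(1)[OF \<open>W \<in> ?C\<close>] gin that by (simp add: subspace_add)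
      ultimately show ?thesis using gf by metis
    qed
    have scl: "?g (s c x) = s c (?g x)" if "x \<in> space W'" for c x
    proof -
      have "f (s c (?g x)) = s c x"
        using f(1) gin[OF that] fg that by (simp add: linear_on_def)
      moreover have "s c (?g x) \<in> space W"
        using closed(1)[OF \<open>W \<in> ?C\<close>] gin that by (simp add: subspace_scale)
      ultimately show ?thesis using gf by metis
    qed
    have comm: "?g (act W' v n x) = act W v n (?g x)" if "x \<in> space W'" for v n x
      using f(3)[OF gin[OF that], of v n] fg[OF that] gf[OF closed(2)[OF \<open>W \<in> ?C\<close> gin[OF that]], of v n]
      by simp
    show ?thesis
      unfolding equivalent_modules_def linear_on_def using g add scl comm by blast
  qed
  have tr: "equivalent_modules s W W''"
    if "equivalent_modules s W W'" "equivalent_modules s W' W''" for W W' W'' :: "('v, 'u) vmod"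
  proof -
    from that obtain f g where
      f: "linear_on s s (space W) f" "bij_betw f (space W) (space W')"
        "\<And>v n w. w \<in> space W \<Longrightarrow> f (act W v n w) = act W' v n (f w)" and
      g: "linear_on s s (space W') g" "bij_betw g (space W') (space W'')"
        "\<And>v n w. w \<in> space W' \<Longrightarrow> g (act W' v n w) = act W'' v n (g w)"
      unfolding equivalent_modules_def by blast
    have "f w \<in> space W'" if "w \<in> space W" for w
      using f(2) that by (auto simp: bij_betw_def)
    then show ?thesis
      unfolding equivalent_modules_def using f g bij_betw_trans[OF f(2) g(2)]
      by (intro exI[of _ "g \<circ> f"]) (auto simp: linear_on_def)
  qed
  show ?thesis
    by (rule equivI)
       (auto simp: refl_on_def sym_def trans_def equivalence_on_def intro: rfl sy tr)
qed

definition class_A ::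
  "'v::ab_group_add voa \<Rightarrow> (complex \<Rightarrow> 'u::ab_group_add \<Rightarrow> 'u) \<Rightarrow> bool" where
  "class_A V s \<longleftrightarrow> (\<forall>W. weak_module V s W \<longrightarrow> L0_semisimple V s W)"

text \<open>
  The direct sum is internal: \<open>S\<close> is the set of its summands, which are nonzero and hence
  pairwise distinct.
\<close>

definition regular ::
  "'v::ab_group_add voa \<Rightarrow> (complex \<Rightarrow> 'u::ab_group_add \<Rightarrow> 'u) \<Rightarrow> bool" where
  "regular V s \<longleftrightarrow>
     (\<forall>W. weak_module V s W \<longrightarrow>
        (\<exists>S. (\<forall>N\<in>S. submodule s W N \<and> ordinary_module V s (W\<lparr>space := N\<rparr>)
                \<and> irreducible s (W\<lparr>space := N\<rparr>)) \<and>
             is_direct_sum s (space W) S (\<lambda>N. N)))"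


section \<open>Intertwining operators\<close>

text \<open>
  Modes are extended by \<open>0\<close> outside the underlying spaces of the modules, so that distinct
  functions are distinct intertwining operators.
\<close>

definition intertwining_operators ::
  "'v::ab_group_add voa \<Rightarrow> (complex \<Rightarrow> 'u::ab_group_add \<Rightarrow> 'u)
    \<Rightarrow> ('v, 'u) vmod \<Rightarrow> ('v, 'u) vmod \<Rightarrow> ('v, 'u) vmod \<Rightarrow> ('u \<Rightarrow> complex \<Rightarrow> 'u \<Rightarrow> 'u) set" where
  "intertwining_operators V s W1 W2 W3 = {J.
     (\<forall>a n b. a \<notin> space W1 \<or> b \<notin> space W2 \<longrightarrow> J a n b = 0) \<and>
     (\<forall>a\<in>space W1. \<forall>n. \<forall>b\<in>space W2. J a n b \<in> space W3) \<and>
     (\<forall>a\<in>space W1. \<forall>n. linear_on s s (space W2) (J a n)) \<and>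
     (\<forall>n. \<forall>b\<in>space W2. linear_on s s (space W1) (\<lambda>a. J a n b)) \<and>
     (\<forall>a\<in>space W1. \<forall>b\<in>space W2. \<exists>N::real. \<forall>n. Re n \<ge> N \<longrightarrow> J a n b = 0) \<and>
     \<comment> \<open>\<open>J(L(-1)a, x) = d/dx J(a, x)\<close>\<close>
     (\<forall>a\<in>space W1. \<forall>n. \<forall>b\<in>space W2.
        J (virasoro V (act W1) (-1) a) n b = s (- n) (J a (n - 1) b)) \<and>
     (\<forall>v. \<forall>a\<in>space W1. \<forall>b\<in>space W2.
        jacobi_identity s (act W1) (act W2) (act W3) J v a b)}"

definition pointwise ::
  "(complex \<Rightarrow> 'u \<Rightarrow> 'u) \<Rightarrow> complex \<Rightarrow> ('u \<Rightarrow> complex \<Rightarrow> 'u \<Rightarrow> 'u) \<Rightarrow> 'u \<Rightarrow> complex \<Rightarrow> 'u \<Rightarrow> 'u" where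
  "pointwise s c J = (\<lambda>a n b. s c (J a n b))"

end

theory Submission
  imports Defs "HOL-Library.Countable_Set"
begin

text \<open>
  Following Li, let \<open>V\<close> act on the full dual of a module \<open>M\<close> by the contragredient vertex operators.
  The Jacobi identity holds pointwise, so every functional on which these operators are lower truncated
  generates a weak module; truncation holds in particular for functionals vanishing on
  \<open>C\<^sub>2(M) = span {v\<^sub>n w | n \<le> -2}\<close>. If \<open>V\<close> is of class \<open>\<A>\<close>, such a functional is a sum of
  \<open>L(0)\<close>-eigenvectors and hence supported on finitely many weight spaces, so that almost all weight
  spaces of \<open>M\<close> lie in \<open>C\<^sub>2(M)\<close>. Consequently \<open>M\<close> is spanned by a finite set modulo Zhu's subspace
  \<open>O(M)\<close>, both for \<open>M = V\<close> and for \<open>M = W1\<close>.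

  Zero modes of elements of \<open>O(V)\<close> kill lowest degree vectors. In a product of pairwise inequivalent
  irreducible modules a lowest degree vector with nonzero components generates everything, so there
  are at most as many factors as elements in the finite set. Similarly, an intertwining operator is
  determined by its components from a lowest weight vector of \<open>W2\<close> to the lowest weight space of
  \<open>W3\<close>, and these vanish on \<open>O(W1)\<close>.
\<close>

section \<open>Direct sums\<close>

text \<open>Three points shape the details. The class condition speaks only of modules inside the
  universe \<open>'u\<close>, whereas functionals on a module have another type and may form a space
  of uncountable dimension. Since each vector generates a submodule of countable dimension, which
  embeds into any infinite-dimensional space, the condition still provides
  \<open>L(0)\<close>-eigenvectors there. Lower truncation fails on the full dual, but at a fixed
  vector of the module all sums are finite. Identities are therefore stated for partial sums up to
  every sufficiently large bound, and that bound may depend on the vector. The contragredient mode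
  \<open>n\<close> of \<open>v\<close> of weight \<open>p\<close> is built from the modes
  \<open>2 * p - n - 2 - j\<close>, which are at most -2 once \<open>n\<close> is at least
  \<open>2 * p\<close>; this is how \<open>C2\<close> governs truncation. A generator of Zhu's
  subspace starts with a generator of \<open>C2\<close> and continues with terms of lower weight, so
  an induction on weights replaces one subspace by the other. Zhu's subspace is needed because the
  Jacobi identity at \<open>m = p\<close> loses both of its iterated products on a lowest degree
  vector.\<close>

lemma sum_fun_apply: "(\<Sum>i\<in>A. f i) x = (\<Sum>i\<in>A. f i x)"
  by (induction A rule: infinite_finite_induct) auto

lemma vector_space_pointwise:
  assumes "vector_space s"
  shows "vector_space (\<lambda>c f i. s c (f i))"
proof -
  interpret vector_space s by fact
  show ?thesis
    by unfold_locales (auto simp: fun_eq_iff scale_right_distrib scale_left_distrib)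
qed

lemma vector_space_complex: "vector_space ((*) :: complex \<Rightarrow> complex \<Rightarrow> complex)"
  by unfold_locales (auto simp: algebra_simps)

lemma Sum_any_additive:
  fixes g :: "'b::comm_monoid_add \<Rightarrow> 'c::comm_monoid_add"
  assumes "g 0 = 0" "\<And>x y. P x \<Longrightarrow> P y \<Longrightarrow> g (x + y) = g x + g y"
    "\<And>i. P (f i)" "P 0" "\<And>x y. P x \<Longrightarrow> P y \<Longrightarrow> P (x + y)"
    "finite {i. f i \<noteq> 0}"
  shows "g (Sum_any f) = Sum_any (\<lambda>i. g (f i))"
proof -
  have "finite A \<Longrightarrow> P (sum f A) \<and> g (sum f A) = (\<Sum>i\<in>A. g (f i))" for A
    by (induction A rule: finite_induct) (auto simp: assms)
  moreover have "Sum_any (\<lambda>i. g (f i)) = (\<Sum>i\<in>{i. f i \<noteq> 0}. g (f i))"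
    by (rule Sum_any.expand_superset) (use assms in auto)
  moreover have "Sum_any f = sum f {i. f i \<noteq> 0}"
    by (rule Sum_any.expand_superset) (use assms in auto)
  ultimately show ?thesis using assms(6) by simp
qed

locale direct_sum = vector_space s for s :: "complex \<Rightarrow> 'a::ab_group_add \<Rightarrow> 'a" +
  fixes M :: "'a set" and A :: "'i \<Rightarrow> 'a set"
  assumes ds: "is_direct_sum s M UNIV A"
begin

lemma sub: "subspace (A i)"
  and M_span: "M = span (\<Union>i. A i)"
  and indep: "finite F \<Longrightarrow> (\<And>i. i \<in> F \<Longrightarrow> x i \<in> A i) \<Longrightarrow> (\<Sum>i\<in>F. x i) = 0 \<Longrightarrow> i \<in> F \<Longrightarrow> x i = 0"
  using ds unfolding is_direct_sum_def by blast+

lemma zero_mem: "0 \<in> A i"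
  using sub subspace_0 by blast

lemma A_sub: "A i \<subseteq> M"
  unfolding M_span using span_superset by blast

lemma subM: "subspace M"
  unfolding M_span by simp

definition decomp :: "'a \<Rightarrow> ('i \<Rightarrow> 'a) \<Rightarrow> bool" where
  "decomp x f \<longleftrightarrow> (\<forall>i. f i \<in> A i) \<and> finite {i. f i \<noteq> 0} \<and> Sum_any f = x"

lemma decomp_add: "decomp x f \<Longrightarrow> decomp y g \<Longrightarrow> decomp (x + y) (\<lambda>i. f i + g i)"
proof -
  assume a: "decomp x f" "decomp y g"
  have "{i. f i + g i \<noteq> 0} \<subseteq> {i. f i \<noteq> 0} \<union> {i. g i \<noteq> 0}" by auto
  with a show ?thesis
    by (auto simp: decomp_def Sum_any.distrib subspace_add[OF sub] intro: finite_subset)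
qed

lemma decomp_scale: "decomp x f \<Longrightarrow> decomp (s c x) (\<lambda>i. s c (f i))"
proof -
  assume a: "decomp x f"
  have "{i. s c (f i) \<noteq> 0} \<subseteq> {i. f i \<noteq> 0}" by auto
  moreover have "s c (Sum_any f) = Sum_any (\<lambda>i. s c (f i))"
    by (rule Sum_any_additive[where P = "\<lambda>_. True"])
      (use a in \<open>auto simp: scale_right_distrib decomp_def\<close>)
  ultimately show ?thesis using a
    by (auto simp: decomp_def subspace_scale[OF sub] intro: finite_subset)
qed

lemma decomp_single: "x \<in> A i \<Longrightarrow> decomp x (\<lambda>j. if j = i then x else 0)"
  by (auto simp: decomp_def zero_mem Sum_any.delta)

lemma decomp_unique: assumes "decomp x f" "decomp x g" shows "f = g"
proof -
  have "decomp (x + s (-1) x) (\<lambda>i. f i + s (-1) (g i))"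
    using decomp_add decomp_scale assms by blast
  then have d: "decomp 0 (\<lambda>i. f i - g i)" by simp
  let ?F = "{i. f i - g i \<noteq> 0}"
  have fin: "finite ?F" and mem: "\<And>i. f i - g i \<in> A i" and S: "Sum_any (\<lambda>i. f i - g i) = 0"
    using d by (auto simp: decomp_def)
  have "Sum_any (\<lambda>i. f i - g i) = (\<Sum>i\<in>?F. f i - g i)"
    by (rule Sum_any.expand_superset[OF fin]) auto
  then have "(\<Sum>i\<in>?F. f i - g i) = 0" using S by simp
  from indep[OF fin mem this] show ?thesis by (auto simp: fun_eq_iff)
qed

lemma decomp_ex: "x \<in> M \<Longrightarrow> \<exists>f. decomp x f"
  unfolding M_span
proof (induction rule: span_induct_alt)
  case base show ?case
    by (rule exI[of _ "\<lambda>_. 0"]) (auto simp: decomp_def zero_mem)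
next
  case (step c x y)
  then show ?case using decomp_add decomp_scale decomp_single by blast
qed

definition comp :: "'a \<Rightarrow> 'i \<Rightarrow> 'a" where
  "comp x = (SOME f. decomp x f)"

lemma decomp_comp: "x \<in> M \<Longrightarrow> decomp x (comp x)"
  unfolding comp_def using decomp_ex by (rule someI_ex)

lemma comp_eqI: "decomp x f \<Longrightarrow> comp x = f"
  unfolding comp_def using decomp_unique someI[of "decomp x" f] by blast

lemma comp_mem: "x \<in> M \<Longrightarrow> comp x i \<in> A i"
  and comp_finite: "x \<in> M \<Longrightarrow> finite {i. comp x i \<noteq> 0}"
  using decomp_comp by (auto simp: decomp_def)

lemma comp_add: "x \<in> M \<Longrightarrow> y \<in> M \<Longrightarrow> comp (x + y) = (\<lambda>i. comp x i + comp y i)"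
  by (intro comp_eqI decomp_add decomp_comp)

lemma comp_scale: "x \<in> M \<Longrightarrow> comp (s c x) = (\<lambda>i. s c (comp x i))"
  by (intro comp_eqI decomp_scale decomp_comp)

lemma comp_hom: "x \<in> A i \<Longrightarrow> comp x = (\<lambda>j. if j = i then x else 0)"
  by (intro comp_eqI decomp_single)

text \<open>Components depend linearly on the vector, and a generator from \<open>S j\<close> has no
  component in degree \<open>i\<close> unless \<open>j = i\<close>. So only generators from
  \<open>S i\<close> contribute to the \<open>i\<close>-th component.\<close>

lemma comp_span:
  assumes "\<And>i. S i \<subseteq> A i" "x \<in> span (\<Union>i. S i)"
  shows "comp x i \<in> span (S i)"
proof -
  have "x \<in> M \<and> comp x i \<in> span (S i)"
    using assms(2)
  proof (induction rule: span_induct_alt)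
    case base
    have "comp 0 i = 0" using comp_hom[OF zero_mem[of i]] by (simp add: fun_eq_iff)
    then show ?case using subspace_0[OF subM] by (simp add: span_zero)
  next
    case (step c x y)
    then obtain j where j: "x \<in> S j" by auto
    then have xj: "x \<in> A j" using assms by auto
    then have xM: "x \<in> M" using A_sub by auto
    have "comp (s c x + y) i = s c (comp x i) + comp y i"
      using step xM by (simp add: comp_add comp_scale subspace_scale[OF subM])
    moreover have "comp x i \<in> span (S i)"
      using comp_hom[OF xj] j by (auto simp: span_zero span_base)
    ultimately show ?case
      using step xM by (auto intro: span_add span_scale subspace_add subspace_scale subM)
  qed
  then show ?thesis by simp
qed

lemma hom_span:
  assumes "\<And>i. S i \<subseteq> A i" "x \<in> span (\<Union>i. S i)" "x \<in> A i"
  shows "x \<in> span (S i)"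
  using comp_span[of S x i, OF assms(1,2)] comp_hom[OF assms(3)] by simp

text \<open>The family \<open>f\<close> may vary with the degree. This turns operators whose mode
  index depends on the weight, such as contragredient modes and zero modes, into linear maps on
  inhomogeneous vectors.\<close>

definition ext :: "('i \<Rightarrow> 'a \<Rightarrow> 'b::comm_monoid_add) \<Rightarrow> 'a \<Rightarrow> 'b" where
  "ext f x = Sum_any (\<lambda>i. f i (comp x i))"

context
  fixes t :: "complex \<Rightarrow> 'b::ab_group_add \<Rightarrow> 'b" and f :: "'i \<Rightarrow> 'a \<Rightarrow> 'b"
  assumes t: "vector_space t" and lin: "\<And>i. linear_on s t (A i) (f i)"
begin

lemma lin_zero: "f i 0 = 0"
  using lin[of i] zero_mem[of i] unfolding linear_on_def by (metis add_cancel_right_right)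

lemma ext_finite: "x \<in> M \<Longrightarrow> finite {i. f i (comp x i) \<noteq> 0}"
  by (rule finite_subset[OF _ comp_finite[of x]]) (use lin_zero in auto)

lemma ext_hom: "x \<in> A i \<Longrightarrow> ext f x = f i x"
  by (simp add: ext_def comp_hom lin_zero if_distrib[of "f _"] cong: if_cong)

lemma ext_linear: "linear_on s t M (ext f)"
proof -
  interpret t: vector_space t by fact
  have "ext f (x + y) = ext f x + ext f y" if "x \<in> M" "y \<in> M" for x y
  proof -
    have "ext f (x + y) = Sum_any (\<lambda>i. f i (comp x i) + f i (comp y i))"
      unfolding ext_def using that lin comp_mem by (simp add: comp_add linear_on_def)
    also have "\<dots> = ext f x + ext f y"
      unfolding ext_def by (rule Sum_any.distrib) (auto intro: ext_finite that)
    finally show ?thesis .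
  qed
  moreover have "ext f (s c x) = t c (ext f x)" if "x \<in> M" for x c
  proof -
    have "t c (ext f x) = Sum_any (\<lambda>i. t c (f i (comp x i)))"
      unfolding ext_def
      by (rule Sum_any_additive[where P = "\<lambda>_. True"])
        (auto simp: t.scale_right_distrib intro: ext_finite that)
    then show ?thesis
      unfolding ext_def using that lin comp_mem by (simp add: comp_scale linear_on_def)
  qed
  ultimately show ?thesis unfolding linear_on_def by blast
qed

end

end


text \<open>The homogeneous pieces absorb scalars, so span induction needs no separate case for
  multiples.\<close>

lemma (in direct_sum) hom_induct [consumes 1, case_names hom add]:
  assumes "x \<in> M" "\<And>i x. x \<in> A i \<Longrightarrow> P x"
    "\<And>x y. x \<in> M \<Longrightarrow> y \<in> M \<Longrightarrow> P x \<Longrightarrow> P y \<Longrightarrow> P (x + y)"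
  shows "P x"
proof -
  have "x \<in> M \<and> P x" using assms(1) unfolding M_span
  proof (induction rule: span_induct_alt)
    case base
    have "0 \<in> A undefined" by (rule zero_mem)
    then show ?case using assms(2) by (auto simp: span_zero)
  next
    case (step c x y)
    then obtain i where "x \<in> A i" by blast
    then have "s c x \<in> A i" by (rule subspace_scale[OF sub])
    then have "s c x \<in> M" "P (s c x)" using A_sub assms(2) by auto
    then show ?case using step assms(3) subM unfolding M_span[symmetric] by (blast intro: subspace_add)
  qed
  then show ?thesis by simp
qed

text \<open>Each functional lowers the dimension by at most one: a spanning set of its kernel
  together with one vector outside the kernel spans \<open>S\<close>. Linearity is required only on
  \<open>S\<close>, because the functionals used for fusion rules are linear only on the
  intertwining operators.\<close>

lemma finite_dim_by_functionals:
  assumes "vector_space s" "finite F" "module.subspace s S"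
    "\<And>f. f \<in> F \<Longrightarrow> linear_on s (*) S f"
    "\<And>x. x \<in> S \<Longrightarrow> (\<forall>f\<in>F. f x = 0) \<Longrightarrow> x = 0"
  shows "finite_dimensional s S"
proof -
  interpret vector_space s by fact
  show ?thesis using assms(2-)
  proof (induction F arbitrary: S rule: finite_induct)
    case empty
    then have "S = {0}" using subspace_0 by auto
    then show ?case unfolding finite_dimensional_def by (intro exI[of _ "{}"]) auto
  next
    case (insert f F)
    let ?K = "{x\<in>S. f x = 0}"
    have lf: "linear_on s (*) S f" using insert by auto
    then have add: "\<And>x y. x \<in> S \<Longrightarrow> y \<in> S \<Longrightarrow> f (x + y) = f x + f y"
      and scl: "\<And>c x. x \<in> S \<Longrightarrow> f (s c x) = c * f x"
      by (auto simp: linear_on_def)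
    have f0: "f 0 = 0" using scl[of 0 0] subspace_0[OF insert.prems(1)] by simp
    have sK: "subspace ?K"
      using insert.prems(1) by (auto simp: subspace_def add scl f0)
    have "finite_dimensional s ?K"
      by (rule insert.IH[OF sK]) (use insert.prems in \<open>auto simp: linear_on_def\<close>)
    then obtain B where B: "finite B" "span B = ?K" unfolding finite_dimensional_def by auto
    show ?case
    proof (cases "\<exists>x\<in>S. f x \<noteq> 0")
      case False
      then have "?K = S" by auto
      with B show ?thesis unfolding finite_dimensional_def by metis
    next
      case True
      then obtain x where x: "x \<in> S" "f x \<noteq> 0" by auto
      have "span (insert x B) = S"
      proof
        have "insert x B \<subseteq> S" using x B span_superset[of B] by auto
        then show "span (insert x B) \<subseteq> S" using insert.prems(1) by (rule span_minimal)
        show "S \<subseteq> span (insert x B)"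
        proof
          fix y assume y: "y \<in> S"
          let ?z = "y - s (f y / f x) x"
          have "?z = y + s (- (f y / f x)) x" by simp
          moreover have "s (- (f y / f x)) x \<in> S" using x insert.prems(1) subspace_scale by blast
          ultimately have "?z \<in> S" "f ?z = 0"
            using y x add[of y "s (- (f y / f x)) x"] scl[of x "- (f y / f x)"] subspace_add[OF insert.prems(1), of y "s (- (f y / f x)) x"]
            by auto
          then have "?z \<in> span B" using B by auto
          then show "y \<in> span (insert x B)" by (auto simp: span_insert)
        qed
      qed
      then show ?thesis using B unfolding finite_dimensional_def by (metis finite_insert)
    qed
  qed
qed

text \<open>A basis of \<open>S\<close> stays independent when \<open>x\<close> is added; prescribe
  0 on the basis and 1 at \<open>x\<close>, and extend linearly.\<close>

lemma functional_separating:
  assumes "vector_space s" "module.subspace s S" "x \<notin> S"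
  shows "\<exists>f. Vector_Spaces.linear s ((*) :: complex \<Rightarrow> complex \<Rightarrow> complex) f \<and> (\<forall>y\<in>S. f y = 0) \<and> f x = 1"
proof -
  interpret a: vector_space s by fact
  interpret p: vector_space_pair s "(*) :: complex \<Rightarrow> complex \<Rightarrow> complex"
    using vector_space_complex assms(1) by (simp add: vector_space_pair_def)
  obtain B where B: "B \<subseteq> S" "a.independent B" "S \<subseteq> a.span B" 
    using a.maximal_independent_subset[of S] by auto
  have "a.span B = S" using B assms(2) a.span_minimal by blast
  then have "x \<notin> a.span B" using assms by auto
  then have "a.independent (insert x B)" using B a.independent_insertI by blast
  from p.linear_independent_extend[OF this, of "\<lambda>y. if y = x then 1 else 0"]
  obtain f where f: "Vector_Spaces.linear s (*) f" "\<forall>y\<in>insert x B. f y = (if y = x then 1 else 0)"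
    by auto
  have "f y = 0" if "y \<in> S" for y
  proof -
    have "x \<notin> B" using B assms by auto
    then show ?thesis
      using p.linear_eq_0_on_span[OF f(1), of B y] f(2) that B by force
  qed
  then show ?thesis using f by (intro exI[of _ f]) auto
qed

section \<open>The Jacobi identity as an identity of finite sums\<close>

lemma eventually_obtain_ge:
  assumes "eventually P sequentially"
  shows "\<exists>K\<ge>N. P K"
  using assms unfolding eventually_sequentially by (meson max.cobounded1 max.cobounded2)

lemma sum_scale_gbinomial_of_nat:
  fixes s :: "complex \<Rightarrow> 'c::ab_group_add \<Rightarrow> 'c"
  assumes "vector_space s" "n < K"
  shows "(\<Sum>i<K. s (of_nat n gchoose i) (f i)) = (\<Sum>i\<le>n. s (of_nat (n choose i)) (f i))"
proof -
  interpret vector_space s by fact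
  have "(\<Sum>i<K. s (of_nat n gchoose i) (f i)) = (\<Sum>i\<le>n. s (of_nat n gchoose i) (f i))"
    by (rule sum.mono_neutral_right)
      (use assms(2) in \<open>auto simp: binomial_eq_0 simp flip: binomial_gbinomial\<close>)
  then show ?thesis by (simp only: binomial_gbinomial)
qed

text \<open>This collapses both sums on the left of the Jacobi identity at \<open>l = 0\<close>,
  which is how commutator formulas are obtained from it.\<close>

lemma sum_scale_gbinomial_0:
  fixes s :: "complex \<Rightarrow> 'c::ab_group_add \<Rightarrow> 'c"
  assumes "vector_space s" "0 < K"
  shows "(\<Sum>i<K. s (c i * (0 gchoose i)) (f i)) = s (c 0) (f 0)"
proof -
  interpret vector_space s by fact
  have "(\<Sum>i<K. s (c i * (0 gchoose i)) (f i)) = (\<Sum>i\<in>{0}. s (c i * (0 gchoose i)) (f i))"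
    by (rule sum.mono_neutral_right) (use assms(2) in \<open>auto simp: gbinomial_0_left\<close>)
  then show ?thesis by simp
qed

text \<open>All three sums are cut off at a common \<open>K\<close>. Finite sums pass through linear
  maps without support conditions, so the identity can be moved between modules in this
  form.\<close>

definition jac_eq ::
  "(complex \<Rightarrow> 'c::ab_group_add \<Rightarrow> 'c)
    \<Rightarrow> ('v \<Rightarrow> int \<Rightarrow> 'a \<Rightarrow> 'a) \<Rightarrow> ('v \<Rightarrow> int \<Rightarrow> 'b \<Rightarrow> 'b) \<Rightarrow> ('v \<Rightarrow> int \<Rightarrow> 'c \<Rightarrow> 'c)
    \<Rightarrow> ('a \<Rightarrow> 'n::ring_1 \<Rightarrow> 'b \<Rightarrow> 'c) \<Rightarrow> 'v \<Rightarrow> 'a \<Rightarrow> 'b \<Rightarrow> int \<Rightarrow> int \<Rightarrow> 'n \<Rightarrow> nat \<Rightarrow> bool" where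
  "jac_eq s Y1 Y2 Y3 J v a b l m n K \<longleftrightarrow>
     (\<Sum>i<K. s ((-1) ^ i * (of_int l gchoose i)) (Y3 v (m + l - int i) (J a (n + of_nat i) b)))
     - (\<Sum>i<K. s ((-1) powi l * (-1) ^ i * (of_int l gchoose i))
          (J a (n + of_int l - of_nat i) (Y2 v (m + int i) b)))
     = (\<Sum>i<K. s (of_int m gchoose i) (J (Y1 v (l + int i) a) (of_int m + n - of_nat i) b))"

context
  fixes s :: "complex \<Rightarrow> 'c::ab_group_add \<Rightarrow> 'c"
    and Y1 :: "'v \<Rightarrow> int \<Rightarrow> 'a::zero \<Rightarrow> 'a" and Y2 :: "'v \<Rightarrow> int \<Rightarrow> 'b::zero \<Rightarrow> 'b"
    and Y3 :: "'v \<Rightarrow> int \<Rightarrow> 'c \<Rightarrow> 'c" and J :: "'a \<Rightarrow> 'n::ring_1 \<Rightarrow> 'b \<Rightarrow> 'c"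
    and v :: 'v and a :: 'a and b :: 'b
  assumes vs: "vector_space s"
    and Y3_0: "\<And>k. Y3 v k 0 = 0" and J_0: "\<And>k. J a k 0 = 0" and J0: "\<And>k. J 0 k b = 0"
begin

lemma jacobi_sums:
  assumes "\<And>i. i \<ge> K \<Longrightarrow> J a (n + of_nat i) b = 0"
    and "\<And>i. i \<ge> K \<Longrightarrow> Y2 v (m + int i) b = 0"
    and "\<And>i. i \<ge> K \<Longrightarrow> Y1 v (l + int i) a = 0"
  shows "jac_eq s Y1 Y2 Y3 J v a b l m n K \<longleftrightarrow>
    Sum_any (\<lambda>i::nat. s ((-1) ^ i * (of_int l gchoose i))
          (Y3 v (m + l - int i) (J a (n + of_nat i) b)))
        - Sum_any (\<lambda>i::nat. s ((-1) powi l * (-1) ^ i * (of_int l gchoose i))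
          (J a (n + of_int l - of_nat i) (Y2 v (m + int i) b)))
        = Sum_any (\<lambda>i::nat. s (of_int m gchoose i)
          (J (Y1 v (l + int i) a) (of_int m + n - of_nat i) b))"
proof -
  interpret vector_space s by (fact vs)
  have *: "Sum_any f = sum f {..<K}" if "\<And>i. i \<ge> K \<Longrightarrow> f i = (0::'c)" for f
    by (rule Sum_any.expand_superset) (use that not_less in auto)
  show ?thesis
    unfolding jac_eq_def by (subst (1 2 3) *) (auto simp: assms Y3_0 J_0 J0)
qed

lemma jacobi_identity_eq:
  assumes "jacobi_identity s Y1 Y2 Y3 J v a b"
    and "\<And>i. i \<ge> K \<Longrightarrow> J a (n + of_nat i) b = 0"
    and "\<And>i. i \<ge> K \<Longrightarrow> Y2 v (m + int i) b = 0"
    and "\<And>i. i \<ge> K \<Longrightarrow> Y1 v (l + int i) a = 0"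
  shows "jac_eq s Y1 Y2 Y3 J v a b l m n K"
  using assms(1) jacobi_sums[OF assms(2-4)] unfolding jacobi_identity_def by blast

lemma jacobi_truncation_bound:
  assumes "\<exists>N. \<forall>k\<ge>N. Y2 v k b = 0" "\<exists>N. \<forall>k\<ge>N. Y1 v k a = 0" "\<And>n. \<exists>N::nat. \<forall>i\<ge>N. J a (n + of_nat i) b = 0"
  shows "\<exists>K0. \<forall>i\<ge>K0. J a (n + of_nat i) b = 0 \<and> Y2 v (m + int i) b = 0 \<and> Y1 v (l + int i) a = 0"
proof -
  from assms obtain N2 N1 N where N: "\<forall>k\<ge>N2. Y2 v k b = 0" "\<forall>k\<ge>N1. Y1 v k a = 0"
    "\<forall>i\<ge>N. J a (n + of_nat i) b = 0" by meson
  show ?thesis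
    by (rule exI[of _ "max N (max (nat (N2 - m)) (nat (N1 - l)))"]) (use N in auto)
qed

text \<open>Beyond the common truncation bound the partial sums no longer depend on
  \<open>K\<close>, so holding for all large \<open>K\<close> is the same as equality of the full
  sums.\<close>

lemma jacobi_identity_iff_eventually:
  assumes "\<exists>N. \<forall>k\<ge>N. Y2 v k b = 0" "\<exists>N. \<forall>k\<ge>N. Y1 v k a = 0" "\<And>n. \<exists>N::nat. \<forall>i\<ge>N. J a (n + of_nat i) b = 0"
  shows "jacobi_identity s Y1 Y2 Y3 J v a b \<longleftrightarrow>
     (\<forall>l m n. \<forall>\<^sub>F K in sequentially. jac_eq s Y1 Y2 Y3 J v a b l m n K)"
proof -
  have "(\<forall>\<^sub>F K in sequentially. jac_eq s Y1 Y2 Y3 J v a b l m n K) \<longleftrightarrow>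
    Sum_any (\<lambda>i::nat. s ((-1) ^ i * (of_int l gchoose i))
          (Y3 v (m + l - int i) (J a (n + of_nat i) b)))
        - Sum_any (\<lambda>i::nat. s ((-1) powi l * (-1) ^ i * (of_int l gchoose i))
          (J a (n + of_int l - of_nat i) (Y2 v (m + int i) b)))
        = Sum_any (\<lambda>i::nat. s (of_int m gchoose i)
          (J (Y1 v (l + int i) a) (of_int m + n - of_nat i) b))" (is "_ \<longleftrightarrow> ?R") for l m n
  proof -
    from jacobi_truncation_bound[OF assms, of n m l] obtain K0 where
      K0: "\<And>i. i \<ge> K0 \<Longrightarrow> J a (n + of_nat i) b = 0" "\<And>i. i \<ge> K0 \<Longrightarrow> Y2 v (m + int i) b = 0"
        "\<And>i. i \<ge> K0 \<Longrightarrow> Y1 v (l + int i) a = 0" by blast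
    have *: "jac_eq s Y1 Y2 Y3 J v a b l m n K \<longleftrightarrow> ?R" if "K \<ge> K0" for K
      by (rule jacobi_sums) (use K0 that in auto)
    have "(\<exists>N. \<forall>K\<ge>N. jac_eq s Y1 Y2 Y3 J v a b l m n K) \<longleftrightarrow> ?R"
    proof
      assume "\<exists>N. \<forall>K\<ge>N. jac_eq s Y1 Y2 Y3 J v a b l m n K"
      then obtain N where "\<forall>K\<ge>N. jac_eq s Y1 Y2 Y3 J v a b l m n K" ..
      then show ?R using *[of "max N K0"] by simp
    qed (use * in blast)
    then show ?thesis unfolding eventually_sequentially .
  qed
  then show ?thesis unfolding jacobi_identity_def by simp
qed

text \<open>
  With \<open>K\<close> so large that \<open>Y2 v k b = 0\<close> for \<open>k \<ge> K\<close>, the Jacobi identity at \<open>l = m - K\<close> expresses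
  \<open>Y3 v m (J a n b)\<close> through \<open>Y3 v (m - i) (J a (n + i) b)\<close> with \<open>i > 0\<close>, modulo modes \<open>J _ _ b\<close>.
\<close>

lemma mode_product_in_span:
  assumes "jacobi_identity s Y1 Y2 Y3 J v a b"
    and "\<exists>N. \<forall>k\<ge>N. Y2 v k b = 0" "\<exists>N. \<forall>k\<ge>N. Y1 v k a = 0" "\<And>n. \<exists>N::nat. \<forall>i\<ge>N. J a (n + of_nat i) b = 0"
    and T: "module.subspace s T" "\<And>k n. J (Y1 v k a) n b \<in> T"
  shows "Y3 v m (J a n b) \<in> T"
proof -
  interpret vector_space s by (fact vs)
  from assms(2) obtain M where M: "\<forall>k\<ge>M. Y2 v k b = 0" by auto
  \<comment> \<open>Induction on the index \<open>N\<close> from which the modes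
    \<open>J a (n + i) b\<close> vanish. Replacing \<open>n\<close> by \<open>n + i\<close> with
    \<open>i > 0\<close> lowers this index, so all terms of the first sum but the leading one are
    covered by the hypothesis.\<close>
  have "(\<forall>i\<ge>N. J a (n + of_nat i) b = 0) \<Longrightarrow> Y3 v m (J a n b) \<in> T" for N m n
  proof (induction N arbitrary: m n)
    case 0
    then have "J a n b = 0" by (metis add_0_right le0 of_nat_0)
    then show ?case using T(1) Y3_0 by (simp add: subspace_0)
  next
    case (Suc N)
    from jacobi_truncation_bound[OF assms(2-4), of n M "m - M"] obtain K0 where
      K0: "\<And>i. i \<ge> K0 \<Longrightarrow> J a (n + of_nat i) b = 0" "\<And>i. i \<ge> K0 \<Longrightarrow> Y2 v (M + int i) b = 0"
        "\<And>i. i \<ge> K0 \<Longrightarrow> Y1 v (m - M + int i) a = 0" by blast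
    define X where "X i = s ((-1) ^ i * (of_int (m - M) gchoose i)) (Y3 v (m - int i) (J a (n + of_nat i) b))" for i :: nat
    have X_in: "X (Suc i) \<in> T" for i
      unfolding X_def
    proof (intro subspace_scale T(1) Suc.IH allI impI)
      fix j assume "N \<le> j"
      then show "J a (n + of_nat (Suc i) + of_nat j) b = 0"
        using Suc.prems[rule_format, of "Suc (i + j)"] by (simp add: add.assoc)
    qed
    \<comment> \<open>The parameters give \<open>Y3\<close> the index \<open>M + (m - M) = m\<close>
      at \<open>i = 0\<close>, and \<open>Suc K0\<close> lets that term be split off. The middle sum
      vanishes since it only involves modes of \<open>v\<close> on \<open>b\<close> from
      \<open>M\<close> on.\<close>
    have "jac_eq s Y1 Y2 Y3 J v a b (m - M) M n (Suc K0)"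
      by (rule jacobi_identity_eq[OF assms(1)]) (use K0 in auto)
    then have "(\<Sum>i<Suc K0. X i) = (\<Sum>i<Suc K0. s (of_int M gchoose i) (J (Y1 v (m - M + int i) a) (of_int M + n - of_nat i) b))"
      unfolding jac_eq_def X_def using M J_0 by simp
    moreover have "\<dots> \<in> T" by (intro subspace_sum subspace_scale T)
    ultimately have "(\<Sum>i<Suc K0. X i) \<in> T" by simp
    moreover have "(\<Sum>i<Suc K0. X i) = X 0 + (\<Sum>i<K0. X (Suc i))"
      by (rule sum.lessThan_Suc_shift)
    moreover have "(\<Sum>i<K0. X (Suc i)) \<in> T" by (intro subspace_sum T X_in)
    ultimately have "X 0 \<in> T"
      using T(1) by (metis add_diff_cancel_right' subspace_diff)
    then show ?case by (simp add: X_def)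
  qed
  with assms(4)[of n] show ?thesis by blast
qed

end

section \<open>Weak modules\<close>

lemma weak_module_submodule:
  assumes "weak_module V s W" "submodule s W N"
  shows "weak_module V s (W\<lparr>space := N\<rparr>)"
  using assms unfolding weak_module_def submodule_def linear_on_def by (auto simp: subset_iff)

locale voa_alg =
  fixes V :: "'v::ab_group_add voa"
  assumes voa: "vertex_operator_algebra V"
begin

sublocale V: vector_space "scale V"
  using voa by (simp add: vertex_operator_algebra_def)

sublocale Vg: direct_sum "scale V" UNIV "weight_space V"
  by unfold_locales (use voa in \<open>simp add: vertex_operator_algebra_def\<close>)

lemma weights_bounded_below: "\<exists>N. \<forall>n<N. weight_space V n = {0}"
  and weight_space_fd: "finite_dimensional (scale V) (weight_space V n)"
  and vertex_linear_left: "linear_on (scale V) (scale V) UNIV (\<lambda>v. vertex V v n u)"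
  and vertex_linear: "linear_on (scale V) (scale V) UNIV (vertex V v n)"
  and vertex_trunc: "\<exists>N. \<forall>n\<ge>N. vertex V u n v = 0"
  and vacuum: "vertex V (vacuum V) n v = (if n = -1 then v else 0)"
  and creation: "n \<ge> 0 \<Longrightarrow> vertex V v n (vacuum V) = 0" "vertex V v (-1) (vacuum V) = v"
  and vertex_jacobi: "jacobi_identity (scale V) (vertex V) (vertex V) (vertex V) (vertex V) u v w"
  and derivative: "vertex V (virasoro V (vertex V) (-1) v) n u = scale V (- of_int n) (vertex V v (n - 1) u)"
  using voa[unfolded vertex_operator_algebra_def] by (elim conjE; simp)+

lemma virasoro_rel: "\<exists>c::complex. \<forall>m n v.
        virasoro V (vertex V) m (virasoro V (vertex V) n v)
        - virasoro V (vertex V) n (virasoro V (vertex V) m v)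
        = scale V (of_int (m - n)) (virasoro V (vertex V) (m + n) v)
          + scale V (if m + n = 0 then of_int (m ^ 3 - m) / 12 * c else 0) v"
  using voa unfolding vertex_operator_algebra_def by blast

definition adjoint_module :: "('v, 'v) vmod" where
  "adjoint_module = \<lparr>space = UNIV, act = vertex V\<rparr>"

lemma adjoint_simps [simp]: "space adjoint_module = UNIV" "act adjoint_module = vertex V"
  by (simp_all add: adjoint_module_def)

lemma weak_module_adjoint: "weak_module V (scale V) adjoint_module"
  unfolding weak_module_def adjoint_simps
  using vertex_linear vertex_linear_left vertex_trunc vacuum vertex_jacobi by auto

end

section \<open>Modes on a weak module: commutators, cyclic submodules,
  \<open>L(0)\<close>-eigenspaces\<close>

locale weak_mod = voa_alg V + s: vector_space s
  for V :: "'v::ab_group_add voa" and s :: "complex \<Rightarrow> 'u::ab_group_add \<Rightarrow> 'u" +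
  fixes W :: "('v, 'u) vmod"
  assumes wm: "weak_module V s W"
begin

abbreviation Y where "Y \<equiv> act W"
abbreviation S where "S \<equiv> space W"

lemma subspace_S: "s.subspace S"
  and Y_closed: "w \<in> S \<Longrightarrow> Y v n w \<in> S"
  and Y_linear: "linear_on s s S (Y v n)"
  and Y_linear_left: "w \<in> S \<Longrightarrow> linear_on (scale V) s UNIV (\<lambda>v. Y v n w)"
  and trunc: "w \<in> S \<Longrightarrow> \<exists>N. \<forall>n\<ge>N. Y v n w = 0"
  and vac: "w \<in> S \<Longrightarrow> Y (vacuum V) n w = (if n = -1 then w else 0)"
  and jacobi: "w \<in> S \<Longrightarrow> jacobi_identity s (vertex V) Y Y Y u v w"
  using wm[unfolded weak_module_def] by (elim conjE; simp)+

lemma S0: "0 \<in> S"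
  using subspace_S s.subspace_0 by blast

lemma Y_add: "w \<in> S \<Longrightarrow> w' \<in> S \<Longrightarrow> Y v n (w + w') = Y v n w + Y v n w'"
  and Y_scale: "w \<in> S \<Longrightarrow> Y v n (s c w) = s c (Y v n w)"
  using Y_linear[of v n] by (auto simp: linear_on_def)

lemma Y_add_left: "w \<in> S \<Longrightarrow> Y (u + v) n w = Y u n w + Y v n w"
  and Y_scale_left: "w \<in> S \<Longrightarrow> Y (scale V c v) n w = s c (Y v n w)"
  using Y_linear_left[of w n] by (auto simp: linear_on_def)

lemma Y_zero [simp]: "Y v n 0 = 0"
  using Y_scale[OF S0, of v n 0] by simp

lemma Y_zero_left: "w \<in> S \<Longrightarrow> Y 0 n w = 0"
  using Y_scale_left[of w 0 0] by simp

lemma Y_sum: "(\<And>i. i \<in> A \<Longrightarrow> f i \<in> S) \<Longrightarrow> Y v n (sum f A) = (\<Sum>i\<in>A. Y v n (f i))"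
  by (induction A rule: infinite_finite_induct)
    (auto simp: Y_add s.subspace_sum[OF subspace_S])

lemma Y_sum_left: "w \<in> S \<Longrightarrow> Y (sum f A) n w = (\<Sum>i\<in>A. Y (f i) n w)"
  by (induction A rule: infinite_finite_induct) (auto simp: Y_add_left Y_zero_left)

lemma trunc_from: "w \<in> S \<Longrightarrow> \<exists>K. \<forall>i\<ge>K. Y v (n + int i) w = 0"
proof -
  assume "w \<in> S"
  then obtain N where "\<forall>n\<ge>N. Y v n w = 0" using trunc by blast
  then show ?thesis by (intro exI[of _ "nat (N - n)"]) auto
qed

lemma jac:
  assumes "w \<in> S"
    and "\<And>i. i \<ge> K \<Longrightarrow> Y v (n + int i) w = 0"
    and "\<And>i. i \<ge> K \<Longrightarrow> Y u (m + int i) w = 0"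
    and "\<And>i. i \<ge> K \<Longrightarrow> vertex V u (l + int i) v = 0"
  shows "jac_eq s (vertex V) Y Y Y u v w l m n K"
  by (rule jacobi_identity_eq[OF s.vector_space_axioms])
    (use assms in \<open>auto intro: Y_zero_left jacobi\<close>)

lemma vertex_trunc_from: "\<exists>K. \<forall>i\<ge>K. vertex V u (l + int i) v = 0"
proof -
  obtain N where "\<forall>n\<ge>N. vertex V u n v = 0" using vertex_trunc by blast
  then show ?thesis by (intro exI[of _ "nat (N - l)"]) auto
qed

lemma jac_eventually:
  assumes "w \<in> S"
  shows "\<forall>\<^sub>F K in sequentially. jac_eq s (vertex V) Y Y Y u v w l m n K"
proof -
  obtain K1 K2 K3 where "\<forall>i\<ge>K1. Y v (n + int i) w = 0" "\<forall>i\<ge>K2. Y u (m + int i) w = 0"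
    "\<forall>i\<ge>K3. vertex V u (l + int i) v = 0"
    using trunc_from[OF assms] vertex_trunc_from by meson
  then show ?thesis
    by (intro eventually_sequentiallyI[of "max K1 (max K2 K3)"] jac assms) auto
qed

text \<open>This is the Jacobi identity at \<open>l = 0\<close>, where only the terms
  \<open>i = 0\<close> survive on the left.\<close>

lemma commutator:
  assumes "w \<in> S" "\<And>i. i \<ge> K \<Longrightarrow> vertex V u (int i) v = 0"
  shows "Y u m (Y v n w) - Y v n (Y u m w) =
    (\<Sum>i<K. s (of_int m gchoose i) (Y (vertex V u (int i) v) (m + n - int i) w))"
proof -
  obtain K' where K': "K' \<ge> Suc K" "jac_eq s (vertex V) Y Y Y u v w 0 m n K'"
    using eventually_obtain_ge[OF jac_eventually[OF assms(1), of u v 0 m n], of "Suc K"] by blast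
  have z: "(\<Sum>i<K'. s (c i * (0 gchoose i)) (f i)) = s (c 0) (f 0)" for c f
    using K'(1) by (intro sum_scale_gbinomial_0 s.vector_space_axioms) simp
  have "(\<Sum>i<K'. s (of_int m gchoose i) (Y (vertex V u (int i) v) (m + n - int i) w)) =
      (\<Sum>i<K. s (of_int m gchoose i) (Y (vertex V u (int i) v) (m + n - int i) w))"
    by (rule sum.mono_neutral_right) (use K'(1) assms in \<open>auto simp: Y_zero_left\<close>)
  then show ?thesis
    using K'(2) z[of "\<lambda>i. (-1) ^ i"] z[of "\<lambda>i. 1 * (-1) ^ i"] unfolding jac_eq_def by simp
qed

definition cyclic :: "'u \<Rightarrow> 'u set" where
  "cyclic w = s.span {Y v n w | v n. True}"

lemma cyclic_base: "w \<in> S \<Longrightarrow> w \<in> cyclic w"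
proof -
  assume "w \<in> S"
  then have "Y (vacuum V) (-1) w = w" by (simp add: vac)
  then show ?thesis unfolding cyclic_def by (metis (mono_tags, lifting) mem_Collect_eq s.span_base)
qed

lemma cyclic_sub: "w \<in> S \<Longrightarrow> cyclic w \<subseteq> S"
  unfolding cyclic_def by (rule s.span_minimal) (auto intro: Y_closed subspace_S)

text \<open>Products of two modes need not be added to the spanning set: by
  \<open>mode_product_in_span\<close> with \<open>J\<close> the action itself,
  \<open>Y u m (Y v n w)\<close> is a combination of single modes of the vectors
  \<open>vertex V u k v\<close> on \<open>w\<close>.\<close>

lemma cyclic_submodule:
  assumes "w \<in> S"
  shows "submodule s W (cyclic w)"
  unfolding submodule_def
proof (intro conjI allI ballI)
  show "cyclic w \<subseteq> S" using assms by (rule cyclic_sub)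
  show sub: "s.subspace (cyclic w)" by (simp add: cyclic_def)
  fix u m x assume "x \<in> cyclic w"
  then have "x \<in> S \<and> Y u m x \<in> cyclic w" unfolding cyclic_def
  proof (induction rule: s.span_induct_alt)
    case base show ?case by (simp add: S0 s.span_zero)
  next
    case (step c x y)
    then obtain v n where x: "x = Y v n w" by auto
    have "\<exists>N. \<forall>i\<ge>N. Y v (n + of_nat i) w = 0" for n
      using trunc_from[OF assms, of v n] by simp
    moreover have "Y (vertex V u k v) n w \<in> cyclic w" for k n
      unfolding cyclic_def by (auto intro: s.span_base)
    ultimately have "Y u m (Y v n w) \<in> cyclic w"
      using assms sub trunc[OF assms, of u] vertex_trunc[of u v]
      by (intro mode_product_in_span[OF s.vector_space_axioms _ _ _ jacobi]) (auto intro: Y_zero_left)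
    then show ?case using step x assms
      by (auto simp: cyclic_def Y_add Y_scale Y_closed s.subspace_scale[OF subspace_S] s.subspace_add[OF subspace_S]
          intro: s.span_add s.span_scale)
  qed
  then show "Y u m x \<in> cyclic w" by simp
qed

text \<open>\<open>L(-1) v = v\<^sub>-\<^sub>2 1\<close>, and the Jacobi identity for \<open>v\<close> and the vacuum at \<open>l = -2\<close>.\<close>

lemma module_derivative:
  assumes w: "w \<in> S"
  shows "Y (virasoro V (vertex V) (-1) v) n w = s (- of_int n) (Y v (n - 1) w)"
proof -
  have eq: "virasoro V (vertex V) (-1) v = vertex V v (-2) (vacuum V)"
    using derivative[of v "-1" "vacuum V"] creation(2) by simp
  \<comment> \<open>These are the coefficients of \<open>(1 - x)^(-2)\<close>.\<close>
  have nb: "(-1) ^ i * ((-2) gchoose i) = (of_nat (Suc i) :: complex)" for i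
  proof -
    have "((-2::complex) gchoose i) = (-1) ^ i * ((of_nat (Suc i)) gchoose i)"
      using gbinomial_minus[of "2::complex" i] by (simp add: algebra_simps)
    also have "(of_nat (Suc i) gchoose i) = (of_nat (Suc i choose i) :: complex)"
      by (rule binomial_gbinomial[symmetric])
    finally show ?thesis by (simp flip: power_mult_distrib mult.assoc)
  qed
  \<comment> \<open>The vacuum acts only in mode -1. This leaves at most the index
    \<open>-n - 1\<close> in the first sum and \<open>n - 1\<close> in the second, and both lie
    below \<open>K'\<close> by this choice.\<close>
  obtain K' where K': "K' \<ge> Suc (nat \<bar>n\<bar>)" "jac_eq s (vertex V) Y Y Y v (vacuum V) w (-2) 0 n K'"
    using eventually_obtain_ge[OF jac_eventually[OF w, of v "vacuum V" "-2" 0 n], of "Suc (nat \<bar>n\<bar>)"] by blast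
  have 1: "(\<Sum>i<K'. s (of_int 0 gchoose i) (Y (vertex V v (-2 + int i) (vacuum V)) (0 + n - int i) w))
      = Y (vertex V v (-2) (vacuum V)) n w"
  proof -
    have "(\<Sum>i<K'. s (of_int 0 gchoose i) (Y (vertex V v (-2 + int i) (vacuum V)) (0 + n - int i) w))
       = (\<Sum>i\<in>{0}. s (of_int 0 gchoose i) (Y (vertex V v (-2 + int i) (vacuum V)) (0 + n - int i) w))"
      by (rule sum.mono_neutral_right) (use K'(1) in \<open>auto simp: gbinomial_0_left\<close>)
    then show ?thesis by simp
  qed
  have 2: "(\<Sum>i<K'. s (of_nat (Suc i)) (Y v (0 + (-2) - int i) (Y (vacuum V) (n + int i) w)))
      = (if n < 0 then s (- of_int n) (Y v (n - 1) w) else 0)"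
  proof -
    have "(\<Sum>i<K'. s (of_nat (Suc i)) (Y v (0 + (-2) - int i) (Y (vacuum V) (n + int i) w)))
       = (\<Sum>i\<in>(if n < 0 then {nat (-n - 1)} else {}). s (of_nat (Suc i)) (Y v (0 + (-2) - int i) (Y (vacuum V) (n + int i) w)))"
      by (rule sum.mono_neutral_right) (use K'(1) w in \<open>auto simp: vac\<close>)
    moreover have "(of_nat (Suc (nat (- n - 1))) :: complex) = - of_int n" if "n < 0"
      using that by (simp add: of_nat_nat)
    ultimately show ?thesis using w by (auto simp: vac simp del: of_nat_Suc)
  qed
  have 3: "(\<Sum>i<K'. s (of_nat (Suc i)) (Y (vacuum V) (n + (-2) - int i) (Y v (0 + int i) w)))
      = (if n > 0 then s (of_int n) (Y v (n - 1) w) else 0)"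
  proof -
    have "(\<Sum>i<K'. s (of_nat (Suc i)) (Y (vacuum V) (n + (-2) - int i) (Y v (0 + int i) w)))
       = (\<Sum>i\<in>(if n > 0 then {nat (n - 1)} else {}). s (of_nat (Suc i)) (Y (vacuum V) (n + (-2) - int i) (Y v (0 + int i) w)))"
      by (rule sum.mono_neutral_right) (use K'(1) w in \<open>auto simp: vac Y_closed\<close>)
    moreover have "(of_nat (Suc (nat (n - 1))) :: complex) = of_int n" if "n > 0"
      using that by (simp add: of_nat_nat)
    ultimately show ?thesis using w by (auto simp: vac Y_closed simp del: of_nat_Suc)
  qed
  have "(if n < 0 then s (- of_int n) (Y v (n - 1) w) else 0) - (if n > 0 then s (of_int n) (Y v (n - 1) w) else 0)
     = Y (vertex V v (-2) (vacuum V)) n w"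
    using K'(2) unfolding jac_eq_def 1[symmetric] 2[symmetric] 3[symmetric] by (simp add: nb del: of_nat_Suc)
  then show ?thesis unfolding eq by (auto split: if_splits)
qed

text \<open>\<open>L(0)\<close> is mode 1 of the conformal vector, so the commutator formula has
  just two terms, with \<open>L(-1) v\<close> in mode \<open>n + 1\<close> and \<open>L(0) v\<close>
  in mode \<open>n\<close>. The former becomes \<open>-(n + 1)\<close> times \<open>Y v n w\<close>
  by the derivative property.\<close>

lemma L0_commutator:
  assumes w: "w \<in> S"
  shows "virasoro V Y 0 (Y v n w) - Y v n (virasoro V Y 0 w) =
    s (- of_int (n + 1)) (Y v n w) + Y (virasoro V (vertex V) 0 v) n w"
proof -
  obtain K where K: "\<And>i. i \<ge> K \<Longrightarrow> vertex V (conformal V) (int i) v = 0"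
    using vertex_trunc_from[of "conformal V" 0 v] by auto
  have "Y (conformal V) 1 (Y v n w) - Y v n (Y (conformal V) 1 w) =
    (\<Sum>i<K+2. s (of_int 1 gchoose i) (Y (vertex V (conformal V) (int i) v) (1 + n - int i) w))"
    by (rule commutator) (use w K in auto)
  also have "\<dots> = (\<Sum>i\<le>1. s (of_nat (1 choose i)) (Y (vertex V (conformal V) (int i) v) (1 + n - int i) w))"
  proof -
    have "1 < K + 2" by simp
    from sum_scale_gbinomial_of_nat[OF s.vector_space_axioms this] show ?thesis
      by (simp only: of_nat_1 of_int_1)
  qed
  also have "\<dots> = Y (virasoro V (vertex V) (-1) v) (n + 1) w + Y (virasoro V (vertex V) 0 v) n w"
    by (simp add: virasoro_def add.commute)
  finally show ?thesis using module_derivative[OF w, of v "n + 1"] by (simp add: virasoro_def)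
qed

lemma L0_eigenspace_subset: "L0_eigenspace V s W h \<subseteq> S"
  by (auto simp: L0_eigenspace_def)

lemma L0_eigenspace_shift:
  assumes "v \<in> weight_space V p" "w \<in> L0_eigenspace V s W h"
  shows "Y v n w \<in> L0_eigenspace V s W (of_int p + h - of_int n - 1)"
proof -
  have w: "w \<in> S" and e: "virasoro V Y 0 w = s h w" using assms by (auto simp: L0_eigenspace_def)
  have "virasoro V Y 0 (Y v n w) - s h (Y v n w) = s (- of_int (n + 1)) (Y v n w) + s (of_int p) (Y v n w)"
    using L0_commutator[OF w, of v n] assms(1) w by (simp only: e Y_scale weight_space_def Y_scale_left mem_Collect_eq)
  also have "\<dots> = s (of_int p + h - of_int n - 1) (Y v n w) - s h (Y v n w)"
    by (simp add: algebra_simps flip: s.scale_left_distrib s.scale_left_diff_distrib)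
  finally show ?thesis
    using w by (simp add: L0_eigenspace_def Y_closed)
qed

lemma subspace_L0_eigenspace: "s.subspace (L0_eigenspace V s W h)"
  using subspace_S
  by (auto simp: s.subspace_def L0_eigenspace_def virasoro_def Y_add Y_scale s.scale_right_distrib s.scale_left_commute)

text \<open>Applying \<open>L(0) - g\<close> to a relation removes the vector of eigenvalue
  \<open>g\<close> and multiplies the others by the nonzero numbers \<open>k - g\<close>.\<close>

lemma L0_eigenspace_independent:
  assumes "finite F" "\<And>h. h \<in> F \<Longrightarrow> x h \<in> L0_eigenspace V s W h" "(\<Sum>h\<in>F. x h) = 0" "h \<in> F"
  shows "x h = 0"
  using assms
proof (induction F arbitrary: x h rule: finite_induct)
  case (insert g F)
  have xS: "x k \<in> S" if "k \<in> insert g F" for k using insert.prems(1)[OF that] by (auto simp: L0_eigenspace_def)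
  have e: "virasoro V Y 0 (x k) = s k (x k)" if "k \<in> insert g F" for k
    using insert.prems(1)[OF that] by (auto simp: L0_eigenspace_def)
  have "(\<Sum>k\<in>insert g F. virasoro V Y 0 (x k)) = virasoro V Y 0 (\<Sum>k\<in>insert g F. x k)"
    unfolding virasoro_def by (rule Y_sum[symmetric]) (use xS in auto)
  also have "\<dots> = 0" using insert.prems(2) by (simp add: virasoro_def)
  finally have "(\<Sum>k\<in>insert g F. s k (x k)) = 0" using e by simp
  moreover have "(\<Sum>k\<in>insert g F. s g (x k)) = 0"
    using insert.prems(2) by (metis s.scale_sum_right s.scale_zero_right)
  ultimately have "(\<Sum>k\<in>F. s (k - g) (x k)) = 0"
    using insert.hyps by (simp add: s.scale_left_diff_distrib sum_subtractf)
      (metis (no_types, lifting) add_left_imp_eq)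
  have z: "x k = 0" if "k \<in> F" for k
  proof -
    have "s (k - g) (x k) = 0"
      by (rule insert.IH[of "\<lambda>k. s (k - g) (x k)"])
        (use that insert.prems subspace_L0_eigenspace \<open>(\<Sum>k\<in>F. s (k - g) (x k)) = 0\<close> in \<open>auto intro: s.subspace_scale\<close>)
    then show ?thesis using that insert.hyps by auto
  qed
  then have "x g = 0" using insert by simp
  then show ?case using z insert.prems(3) by auto
qed auto

text \<open>Eigenvectors for distinct eigenvalues are independent anyway, so semisimplicity only
  asks that they span.\<close>

lemma L0_semisimpleI:
  assumes "S \<subseteq> s.span (\<Union>h. L0_eigenspace V s W h)"
  shows "L0_semisimple V s W"
proof -
  have "S = s.span (\<Union>h. L0_eigenspace V s W h)"
    using assms s.span_minimal[of "\<Union>h. L0_eigenspace V s W h" S] subspace_S L0_eigenspace_subset by blast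
  then show ?thesis
    unfolding L0_semisimple_def is_direct_sum_def
  proof (intro conjI allI impI ballI)
    fix F x h
    assume "finite F \<and> F \<subseteq> UNIV \<and> (\<forall>i\<in>F. x i \<in> L0_eigenspace V s W i) \<and> sum x F = 0" "h \<in> F"
    then show "x h = 0" by (elim conjE) (rule L0_eigenspace_independent[of F], auto)
  qed (use subspace_L0_eigenspace in auto)
qed

end

context voa_alg
begin

lemma weak_mod_adjoint: "weak_mod V (scale V) adjoint_module"
  by unfold_locales (rule weak_module_adjoint)

lemma L0_eigenspace_adjoint: "L0_eigenspace V (scale V) adjoint_module (of_int k) = weight_space V k"
  by (simp add: L0_eigenspace_def weight_space_def)

lemma weight_shift:
  assumes "v \<in> weight_space V p" "u \<in> weight_space V q"
  shows "vertex V v n u \<in> weight_space V (p + q - n - 1)"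
  using weak_mod.L0_eigenspace_shift[OF weak_mod_adjoint assms(1), of u "of_int q" n] assms(2)
  by (simp flip: L0_eigenspace_adjoint)

end

section \<open>The operator \<open>L(1)\<close>\<close>

text \<open>Applied to a mode \<open>vertex V a n b\<close>, the \<open>k\<close>-th divided power
  of \<open>L(1)\<close> is distributed over \<open>a\<close>, the mode index and \<open>b\<close>;
  a triple records the three shares.\<close>

definition triples :: "nat \<Rightarrow> (nat \<times> nat \<times> nat) set" where
  "triples k = {(j, i, r). j + i + r = k}"

lemma finite_triples [simp]: "finite (triples k)"
  by (rule finite_subset[of _ "{..k} \<times> {..k} \<times> {..k}"]) (auto simp: triples_def)

text \<open>Applying \<open>L(1)\<close> once more raises one entry of a triple. These reindexings
  bring the three resulting sums to the same index set, with boundary terms filled in as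
  zero.\<close>

lemma sum_triples_shift:
  fixes H :: "nat \<Rightarrow> nat \<Rightarrow> nat \<Rightarrow> 'b::comm_monoid_add"
  shows "(\<Sum>(j, i, r)\<in>triples k. H (Suc j) i r) = (\<Sum>(j, i, r)\<in>triples (Suc k). if j = 0 then 0 else H j i r)"
    and "(\<Sum>(j, i, r)\<in>triples k. H j (Suc i) r) = (\<Sum>(j, i, r)\<in>triples (Suc k). if i = 0 then 0 else H j i r)"
    and "(\<Sum>(j, i, r)\<in>triples k. H j i (Suc r)) = (\<Sum>(j, i, r)\<in>triples (Suc k). if r = 0 then 0 else H j i r)"
proof -
  show "(\<Sum>(j, i, r)\<in>triples k. H (Suc j) i r) = (\<Sum>(j, i, r)\<in>triples (Suc k). if j = 0 then 0 else H j i r)"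
    by (rule sum.reindex_bij_witness_not_neutral[where S' = "{}" and T' = "{(j, i, r)\<in>triples (Suc k). j = 0}"
        and i = "\<lambda>(j, i, r). (j - 1, i, r)" and j = "\<lambda>(j, i, r). (Suc j, i, r)"])
      (auto simp: triples_def intro: finite_subset[OF _ finite_triples[of "Suc k"]])
  show "(\<Sum>(j, i, r)\<in>triples k. H j (Suc i) r) = (\<Sum>(j, i, r)\<in>triples (Suc k). if i = 0 then 0 else H j i r)"
    by (rule sum.reindex_bij_witness_not_neutral[where S' = "{}" and T' = "{(j, i, r)\<in>triples (Suc k). i = 0}"
        and i = "\<lambda>(j, i, r). (j, i - 1, r)" and j = "\<lambda>(j, i, r). (j, Suc i, r)"])
      (auto simp: triples_def intro: finite_subset[OF _ finite_triples[of "Suc k"]])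
  show "(\<Sum>(j, i, r)\<in>triples k. H j i (Suc r)) = (\<Sum>(j, i, r)\<in>triples (Suc k). if r = 0 then 0 else H j i r)"
    by (rule sum.reindex_bij_witness_not_neutral[where S' = "{}" and T' = "{(j, i, r)\<in>triples (Suc k). r = 0}"
        and i = "\<lambda>(j, i, r). (j, i, r - 1)" and j = "\<lambda>(j, i, r). (j, i, Suc r)"])
      (auto simp: triples_def intro: finite_subset[OF _ finite_triples[of "Suc k"]])
qed

text \<open>Both sides sum over the quadruples with \<open>j + k + i + r < B\<close>. They differ
  only in the range of further quadruples, where \<open>G\<close> is zero.\<close>

lemma sum_triples_rearrange:
  fixes G :: "nat \<Rightarrow> nat \<Rightarrow> nat \<Rightarrow> nat \<Rightarrow> 'b::comm_monoid_add"
  assumes "\<And>j k i r. j + k + i + r \<ge> B \<Longrightarrow> G j k i r = 0"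
  shows "(\<Sum>i<B. \<Sum>q<B. \<Sum>(j, r, k)\<in>triples q. G j k i r) = (\<Sum>j<B. \<Sum>k<B. \<Sum>t<B. \<Sum>i\<le>t. G j k i (t - i))"
proof -
  define Q where "Q = {(j, k, i, r). j + k + i + r < B}"
  define Z1 where "Z1 = {(i, q, j, r, k). (i, q, j, r, k) \<in> (SIGMA i:{..<B}. SIGMA q:{..<B}. triples q) \<and> j + k + i + r \<ge> B}"
  define Z2 where "Z2 = {(j, k, t, i). (j, k, t, i) \<in> (SIGMA j:{..<B}. SIGMA k:{..<B}. SIGMA t:{..<B}. {..t}) \<and> j + k + t \<ge> B}"
  have f1: "finite Z1"
    by (rule finite_subset[of _ "SIGMA i:{..<B}. SIGMA q:{..<B}. triples q"]) (auto simp: Z1_def)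
  have f2: "finite Z2"
    by (rule finite_subset[of _ "SIGMA j:{..<B}. SIGMA k:{..<B}. SIGMA t:{..<B}. {..t}"]) (auto simp: Z2_def)
  have "(\<Sum>i<B. \<Sum>q<B. \<Sum>(j, r, k)\<in>triples q. G j k i r)
      = (\<Sum>(i, q, j, r, k)\<in>(SIGMA i:{..<B}. SIGMA q:{..<B}. triples q). G j k i r)"
    by (simp add: sum.Sigma)
  also have "\<dots> = (\<Sum>(j, k, i, r)\<in>Q. G j k i r)"
    by (rule sum.reindex_bij_witness_not_neutral[where S' = Z1 and T' = "{}"
        and i = "\<lambda>(j, k, i, r). (i, j + r + k, j, r, k)" and j = "\<lambda>(i, q, j, r, k). (j, k, i, r)"])
      (use f1 assms in \<open>auto simp: Z1_def Q_def triples_def\<close>)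
  also have "\<dots> = (\<Sum>(j, k, t, i)\<in>(SIGMA j:{..<B}. SIGMA k:{..<B}. SIGMA t:{..<B}. {..t}). G j k i (t - i))"
    by (rule sum.reindex_bij_witness_not_neutral[where S' = "{}" and T' = Z2
        and j = "\<lambda>(j, k, i, r). (j, k, i + r, i)" and i = "\<lambda>(j, k, t, i). (j, k, i, t - i)"])
      (use f2 assms in \<open>auto simp: Z2_def Q_def\<close>)
  also have "\<dots> = (\<Sum>j<B. \<Sum>k<B. \<Sum>t<B. \<Sum>i\<le>t. G j k i (t - i))"
    by (simp add: sum.Sigma)
  finally show ?thesis .
qed

text \<open>Compare coefficients of \<open>z^t\<close> in
  \<open>(1 + z)^x (1 - z/(1 + z))^m = (1 + z)^(x - m)\<close>. The proof instead moves
  \<open>m\<close> by one with Pascal's rule and uses the identity for the smaller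
  \<open>t\<close>.\<close>

lemma gbinomial_alternating_Vandermonde:
  fixes x :: complex and m :: int
  shows "(\<Sum>i\<le>t. (-1) ^ i * (of_int m gchoose i) * ((x - of_nat i) gchoose (t - i))) = (x - of_int m) gchoose t"
proof (induction t arbitrary: x m)
  case 0
  show ?case by simp
next
  case (Suc t)
  define G where "G m x t = (\<Sum>i\<le>t. (-1) ^ i * (of_int m gchoose i) * ((x - of_nat i) gchoose (t - i)))"
    for m :: int and x :: complex and t
  \<comment> \<open>Pascal's rule for the upper entry \<open>m + 1\<close> splits off the same sum
    at order \<open>t\<close> with \<open>x - 1\<close> for \<open>x\<close>, which the induction
    hypothesis evaluates.\<close>
  have step: "G (m + 1) x (Suc t) = G m x (Suc t) - ((x - of_int m - 1) gchoose t)" for m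
  proof -
    have pascal: "of_int (m + 1) gchoose Suc i = (of_int m gchoose i) + ((of_int m :: complex) gchoose Suc i)" for i
      using gbinomial_Suc_Suc[of "of_int m :: complex" i] by simp
    have "G (m + 1) x (Suc t) = (x gchoose Suc t)
        + (\<Sum>i\<le>t. (-1) ^ Suc i * (of_int (m + 1) gchoose Suc i) * ((x - of_nat (Suc i)) gchoose (t - i)))"
      unfolding G_def sum.atMost_Suc_shift by simp
    also have "\<dots> = (x gchoose Suc t)
        + ((\<Sum>i\<le>t. (-1) ^ Suc i * (of_int m gchoose Suc i) * ((x - of_nat (Suc i)) gchoose (t - i)))
          - (\<Sum>i\<le>t. (-1) ^ i * (of_int m gchoose i) * ((x - 1 - of_nat i) gchoose (t - i))))"
    proof -
      have "(-1) ^ Suc i * (of_int (m + 1) gchoose Suc i) * ((x - of_nat (Suc i)) gchoose (t - i))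
          = (-1) ^ Suc i * (of_int m gchoose Suc i) * ((x - of_nat (Suc i)) gchoose (t - i))
            - (-1) ^ i * (of_int m gchoose i) * ((x - 1 - of_nat i) gchoose (t - i))" for i
      proof -
        have "x - of_nat (Suc i) = x - 1 - of_nat i" by simp
        then show ?thesis unfolding pascal by (simp only: power_Suc) (simp add: algebra_simps)
      qed
      then show ?thesis by (simp only: sum_subtractf)
    qed
    also have "\<dots> = G m x (Suc t) - ((x - 1 - of_int m) gchoose t)"
      unfolding Suc.IH by (simp add: G_def sum.atMost_Suc_shift del: sum.atMost_Suc)
    finally show ?thesis by (simp add: diff_right_commute)
  qed
  have pascal: "(x - of_int m) gchoose Suc t = ((x - of_int m - 1) gchoose t) + ((x - of_int (m + 1)) gchoose Suc t)" for m
    using gbinomial_Suc_Suc[of "x - of_int m - 1" t] by (simp add: algebra_simps)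
  have "G m x (Suc t) = (x - of_int m) gchoose Suc t" for m
  \<comment> \<open>\<open>m\<close> is an arbitrary integer, so the recursion is used upwards and
    downwards from 0.\<close>
  proof (induction m rule: int_induct[of _ 0])
    case base
    show ?case by (simp add: G_def sum.atMost_Suc_shift del: sum.atMost_Suc)
  next
    case (step1 i)
    then show ?case using step[of i] pascal[of i] by simp
  next
    case (step2 i)
    then show ?case using step[of "i - 1"] pascal[of "i - 1"] by simp
  qed
  then show ?case by (simp only: G_def)
qed

section \<open>Divided powers of \<open>L(1)\<close> and how they pass through vertex
  operators\<close>

context voa_alg
begin

abbreviation L :: "int \<Rightarrow> 'v \<Rightarrow> 'v" where "L \<equiv> virasoro V (vertex V)"

text \<open>The coefficient of \<open>x^k\<close> in the exponential of \<open>x L(1)\<close>;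
  dividing by the factorial keeps factorials out of the product formula
  \<open>D_vertex\<close>.\<close>

definition D :: "nat \<Rightarrow> 'v \<Rightarrow> 'v" where
  "D k v = scale V (1 / fact k) ((virasoro V (vertex V) 1 ^^ k) v)"

interpretation A: weak_mod V "scale V" adjoint_module by (rule weak_mod_adjoint)

lemma L_vacuum: "n \<ge> -1 \<Longrightarrow> L n (vacuum V) = 0"
  by (simp add: virasoro_def creation)

lemma conformal_eq: "L (-2) (vacuum V) = conformal V"
  by (simp add: virasoro_def creation)

lemma conformal_weight: "conformal V \<in> weight_space V 2"
proof -
  obtain c :: complex where c: "\<And>m n v. L m (L n v) - L n (L m v) = scale V (of_int (m - n)) (L (m + n) v)
          + scale V (if m + n = 0 then of_int (m ^ 3 - m) / 12 * c else 0) v"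
    using virasoro_rel by meson
  have "L n 0 = 0" for n using A.Y_zero by (simp add: virasoro_def)
  then have "L 0 (L (-2) (vacuum V)) = scale V 2 (L (-2) (vacuum V))"
    using c[of 0 "-2" "vacuum V"] by (simp add: L_vacuum)
  then show ?thesis by (simp add: weight_space_def conformal_eq)
qed

text \<open>\<open>[L(1), L(-2)] = 3 L(-1)\<close> has no central term and kills the vacuum. It
  makes the contragredient series of the conformal vector reduce to one term.\<close>

lemma L1_conformal: "L 1 (conformal V) = 0"
proof -
  obtain c :: complex where c: "\<And>m n v. L m (L n v) - L n (L m v) = scale V (of_int (m - n)) (L (m + n) v)
          + scale V (if m + n = 0 then of_int (m ^ 3 - m) / 12 * c else 0) v"
    using virasoro_rel by meson
  have "L n 0 = 0" for n using A.Y_zero by (simp add: virasoro_def)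
  then show ?thesis
    using c[of 1 "-2" "vacuum V"] by (simp add: L_vacuum conformal_eq)
qed

lemma L1_weight: "v \<in> weight_space V p \<Longrightarrow> L 1 v \<in> weight_space V (p - 1)"
  using weight_shift[OF conformal_weight, of v p 2] by (simp add: virasoro_def algebra_simps)

lemma L1_add: "L 1 (u + v) = L 1 u + L 1 v"
  and L1_scale: "L 1 (scale V c v) = scale V c (L 1 v)"
  using A.Y_add A.Y_scale by (simp_all add: virasoro_def)

lemma L1_sum: "L 1 (sum f B) = (\<Sum>i\<in>B. L 1 (f i))"
  using A.Y_sum[of B f] by (simp add: virasoro_def)

lemma D_0 [simp]: "D 0 v = v"
  by (simp add: D_def)

lemma L1_D: "L 1 (D k v) = scale V (of_nat (Suc k)) (D (Suc k) v)"
  by (simp add: D_def L1_scale field_simps del: of_nat_Suc)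

lemma D_Suc: "D (Suc k) v = scale V (1 / of_nat (Suc k)) (L 1 (D k v))"
  by (simp add: L1_D del: of_nat_Suc)

lemma D_add: "D k (u + v) = D k u + D k v"
  by (induction k) (simp_all add: D_Suc L1_add V.scale_right_distrib)

lemma D_scale: "D k (scale V c v) = scale V c (D k v)"
  by (induction k) (simp_all add: D_Suc L1_scale mult.commute)

lemma D_weight: "v \<in> weight_space V p \<Longrightarrow> D k v \<in> weight_space V (p - int k)"
proof (induction k)
  case (Suc k)
  then have "L 1 (D k v) \<in> weight_space V (p - int k - 1)" by (intro L1_weight) auto
  then show ?case unfolding D_Suc by (intro V.subspace_scale Vg.sub) (simp add: algebra_simps)
qed simp

text \<open>\<open>L(1)\<close> lowers the weight by one and weights are bounded below; hence the
  contragredient modes are finite sums.\<close>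

lemma D_nilpotent: "v \<in> weight_space V p \<Longrightarrow> \<exists>B. \<forall>j\<ge>B. D j v = 0"
proof -
  assume v: "v \<in> weight_space V p"
  obtain N where N: "\<forall>n<N. weight_space V n = {0}" using weights_bounded_below by blast
  have "D j v = 0" if "j \<ge> nat (p - N + 1)" for j
  proof -
    have "p - int j < N" using that by linarith
    then show ?thesis using N D_weight[OF v, of j] by blast
  qed
  then show ?thesis by blast
qed

text \<open>\<open>L(1)\<close> is mode 2 of the conformal vector, so the commutator has three
  terms, from \<open>L(-1) a\<close>, \<open>2 L(0) a\<close> and \<open>L(1) a\<close>. The first
  two combine to the coefficient \<open>-(n + 2) + 2 p\<close>.\<close>

lemma L1_vertex:
  assumes "a \<in> weight_space V p"
  shows "L 1 (vertex V a n b) = vertex V (L 1 a) n b + scale V (of_int (2 * p - n - 2)) (vertex V a (n + 1) b)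
    + vertex V a n (L 1 b)"
proof -
  obtain K where K: "\<And>i. i \<ge> K \<Longrightarrow> vertex V (conformal V) (int i) a = 0"
    using A.vertex_trunc_from[of "conformal V" 0 a] by auto
  have "vertex V (conformal V) 2 (vertex V a n b) - vertex V a n (vertex V (conformal V) 2 b) =
    (\<Sum>i<K+3. scale V (of_int 2 gchoose i) (vertex V (vertex V (conformal V) (int i) a) (2 + n - int i) b))"
    using A.commutator[of b "K + 3" "conformal V" a 2 n] K by simp
  also have "\<dots> = (\<Sum>i\<le>2. scale V (of_nat (2 choose i)) (vertex V (vertex V (conformal V) (int i) a) (2 + n - int i) b))"
    using sum_scale_gbinomial_of_nat[OF V.vector_space_axioms, of 2 "K + 3"] by simp
  also have "\<dots> = vertex V (L (-1) a) (n + 2) b + scale V 2 (vertex V (L 0 a) (n + 1) b) + vertex V (L 1 a) n b"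
    by (simp add: virasoro_def numeral_2_eq_2 algebra_simps)
  also have "\<dots> = scale V (of_int (2 * p - n - 2)) (vertex V a (n + 1) b) + vertex V (L 1 a) n b"
  proof -
    have "L 0 a = scale V (of_int p) a" using assms by (simp add: weight_space_def)
    moreover have "vertex V (scale V (of_int p) a) (n + 1) b = scale V (of_int p) (vertex V a (n + 1) b)"
      using A.Y_scale_left[of b "of_int p" a "n + 1"] by simp
    ultimately show ?thesis by (simp add: derivative algebra_simps flip: V.scale_left_distrib)
  qed
  finally show ?thesis by (simp add: virasoro_def diff_eq_eq algebra_simps)
qed

text \<open>\<open>L1_vertex\<close> is iterated. The binomial is the solution of the recursion that
  this produces for the coefficient of a triple, normalised to 1 at order 0.\<close>

lemma D_vertex:
  assumes a: "a \<in> weight_space V p"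
  shows "D k (vertex V a n b) = (\<Sum>(j, i, r)\<in>triples k.
    scale V (of_int (2 * p - n - 2 - int j) gchoose i) (vertex V (D j a) (n + int i) (D r b)))"
proof (induction k)
  case 0
  have "triples 0 = {(0, 0, 0)}" by (auto simp: triples_def)
  then show ?case by simp
next
  case (Suc k)
  let ?X = "\<lambda>j. of_int (2 * p - n - 2 - int j) :: complex"
  let ?Y = "\<lambda>j i r. vertex V (D j a) (n + int i) (D r b)"
  have Ysc: "vertex V (scale V c x) n' y = scale V c (vertex V x n' y)" "vertex V x n' (scale V c y) = scale V c (vertex V x n' y)" for c x y n'
    using A.Y_scale_left[of y c x n'] A.Y_scale[of y x n' c] by auto
  have "L 1 (D k (vertex V a n b)) = (\<Sum>(j, i, r)\<in>triples k. scale V (?X j gchoose i) (L 1 (?Y j i r)))"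
    unfolding Suc L1_sum by (simp add: L1_scale case_prod_unfold)
  \<comment> \<open>Each summand is written as a function of the entry that was raised, in the shape
    that \<open>sum_triples_shift\<close> expects.\<close>
  also have "\<dots> = (\<Sum>(j, i, r)\<in>triples k.
      scale V ((?X (Suc j - 1) gchoose i) * of_nat (Suc j)) (?Y (Suc j) i r)
      + scale V ((?X j gchoose (Suc i - 1)) * (?X j - of_nat j - of_nat (Suc i) + 1)) (?Y j (Suc i) r)
      + scale V ((?X j gchoose i) * of_nat (Suc r)) (?Y j i (Suc r)))"
  proof (rule sum.cong, simp, clarify)
    fix j i r
    have "L 1 (?Y j i r) = vertex V (L 1 (D j a)) (n + int i) (D r b)
      + scale V (of_int (2 * (p - int j) - (n + int i) - 2)) (vertex V (D j a) (n + int i + 1) (D r b))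
      + vertex V (D j a) (n + int i) (L 1 (D r b))"
      by (rule L1_vertex[OF D_weight[OF a]])
    also have "of_int (2 * (p - int j) - (n + int i) - 2) = ?X j - of_nat j - of_nat (Suc i) + 1"
      by simp
    also have "n + int i + 1 = n + int (Suc i)" by simp
    finally show "scale V (?X j gchoose i) (L 1 (?Y j i r)) =
      scale V ((?X (Suc j - 1) gchoose i) * of_nat (Suc j)) (?Y (Suc j) i r)
      + scale V ((?X j gchoose (Suc i - 1)) * (?X j - of_nat j - of_nat (Suc i) + 1)) (?Y j (Suc i) r)
      + scale V ((?X j gchoose i) * of_nat (Suc r)) (?Y j i (Suc r))"
      by (simp only: V.scale_right_distrib V.scale_scale L1_D Ysc diff_Suc_1)
  qed
  also have "\<dots> = (\<Sum>(j, i, r)\<in>triples k. scale V ((?X (Suc j - 1) gchoose i) * of_nat (Suc j)) (?Y (Suc j) i r))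
      + (\<Sum>(j, i, r)\<in>triples k. scale V ((?X j gchoose (Suc i - 1)) * (?X j - of_nat j - of_nat (Suc i) + 1)) (?Y j (Suc i) r))
      + (\<Sum>(j, i, r)\<in>triples k. scale V ((?X j gchoose i) * of_nat (Suc r)) (?Y j i (Suc r)))"
    by (simp only: sum.distrib case_prod_unfold)
  also have "\<dots> = (\<Sum>(j, i, r)\<in>triples (Suc k). if j = 0 then 0 else scale V ((?X (j - 1) gchoose i) * of_nat j) (?Y j i r))
      + (\<Sum>(j, i, r)\<in>triples (Suc k). if i = 0 then 0 else scale V ((?X j gchoose (i - 1)) * (?X j - of_nat j - of_nat i + 1)) (?Y j i r))
      + (\<Sum>(j, i, r)\<in>triples (Suc k). if r = 0 then 0 else scale V ((?X j gchoose i) * of_nat r) (?Y j i r))"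
    by (simp only: sum_triples_shift(1)[of "\<lambda>j i r. scale V ((?X (j - 1) gchoose i) * of_nat j) (?Y j i r)"]
        sum_triples_shift(2)[of "\<lambda>j i r. scale V ((?X j gchoose (i - 1)) * (?X j - of_nat j - of_nat i + 1)) (?Y j i r)"]
        sum_triples_shift(3)[of "\<lambda>j i r. scale V ((?X j gchoose i) * of_nat r) (?Y j i r)"])
  also have "\<dots> = (\<Sum>(j, i, r)\<in>triples (Suc k).
      (if j = 0 then 0 else scale V ((?X (j - 1) gchoose i) * of_nat j) (?Y j i r))
      + (if i = 0 then 0 else scale V ((?X j gchoose (i - 1)) * (?X j - of_nat j - of_nat i + 1)) (?Y j i r))
      + (if r = 0 then 0 else scale V ((?X j gchoose i) * of_nat r) (?Y j i r)))"
    by (simp add: sum.distrib case_prod_unfold)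
  also have "\<dots> = (\<Sum>(j, i, r)\<in>triples (Suc k). scale V (of_nat (Suc k)) (scale V (?X j gchoose i) (?Y j i r)))"
  proof (rule sum.cong, simp, clarify)
    fix j i r assume "(j, i, r) \<in> triples (Suc k)"
    then have k: "of_nat (Suc k) = (of_nat j + of_nat i + of_nat r :: complex)"
      by (auto simp: triples_def simp flip: of_nat_add)
    define x where "x = ?X j"
    have xj: "?X (j - 1) = x + 1" if "j \<noteq> 0" using that by (simp add: x_def of_nat_diff)
    \<comment> \<open>With \<open>j + i + r = k + 1\<close> this is Pascal's rule for
      \<open>x + 1\<close> together with \<open>i binom(x, i) = (x - i + 1) binom(x, i - 1)\<close>;
      the contributions of \<open>j\<close> to \<open>binom(x, i - 1)\<close> cancel.\<close>
    have e: "(if j = 0 then 0 else (?X (j - 1) gchoose i) * of_nat j)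
      + (if i = 0 then 0 else (x gchoose (i - 1)) * (x - of_nat j - of_nat i + 1))
      + (if r = 0 then 0 else (x gchoose i) * of_nat r) = of_nat (Suc k) * (x gchoose i)"
    proof (cases i)
      case 0
      then show ?thesis unfolding k by simp
    next
      case (Suc i')
      have 1: "(x + 1) gchoose i = (x gchoose i') + (x gchoose i)"
        unfolding Suc by (rule gbinomial_Suc_Suc)
      have 2: "of_nat i * (x gchoose i) = (x - of_nat i') * (x gchoose i')"
        using gbinomial_absorb_comp[of x i'] gbinomial_absorption[of i' x] unfolding Suc
        by (metis gbinomial_absorption gbinomial_absorb_comp)
      have "((x + 1) gchoose i) * of_nat j + (x gchoose i') * (x - of_nat j - of_nat i + 1) + (x gchoose i) * of_nat r
        = of_nat (Suc k) * (x gchoose i)"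
        unfolding 1 k using 2 by (simp add: Suc algebra_simps)
      moreover have "(if j = 0 then 0 else (?X (j - 1) gchoose i) * of_nat j) = ((x + 1) gchoose i) * of_nat j"
      proof (cases "j = 0")
        case False
        then show ?thesis by (simp only: xj[OF False] if_False)
      qed simp
      moreover have "(if r = 0 then 0 else (x gchoose i) * of_nat r) = (x gchoose i) * of_nat r"
        by simp
      moreover have "(if i = 0 then 0 else (x gchoose (i - 1)) * (x - of_nat j - of_nat i + 1))
          = (x gchoose i') * (x - of_nat j - of_nat i + 1)"
        by (simp add: Suc)
      ultimately show ?thesis by (simp only:)
    qed
    show "(if j = 0 then 0 else scale V ((?X (j - 1) gchoose i) * of_nat j) (?Y j i r))
      + (if i = 0 then 0 else scale V ((?X j gchoose (i - 1)) * (?X j - of_nat j - of_nat i + 1)) (?Y j i r))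
      + (if r = 0 then 0 else scale V ((?X j gchoose i) * of_nat r) (?Y j i r))
      = scale V (of_nat (Suc k)) (scale V (?X j gchoose i) (?Y j i r))"
    proof -
      have d: "scale V (if Q then 0 else c) y = (if Q then 0 else scale V c y)" for Q c y
        by simp
      have "scale V (of_nat (Suc k)) (scale V (?X j gchoose i) (?Y j i r)) = scale V (of_nat (Suc k) * (x gchoose i)) (?Y j i r)"
        by (simp only: V.scale_scale x_def)
      then show ?thesis
        unfolding e[symmetric] by (simp only: V.scale_left_distrib d x_def)
    qed
  qed
  also have "\<dots> = scale V (of_nat (Suc k)) (\<Sum>(j, i, r)\<in>triples (Suc k). scale V (?X j gchoose i) (?Y j i r))"
    by (simp add: V.scale_sum_right case_prod_unfold)
  finally show ?case unfolding L1_D by (simp del: of_nat_Suc)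
qed

end

section \<open>Contragredient vertex operators\<close>

lemma sum_swap3: "(\<Sum>i\<in>A. \<Sum>j\<in>B. \<Sum>k\<in>C. f i j k) = (\<Sum>j\<in>B. \<Sum>k\<in>C. \<Sum>i\<in>A. f i j k)"
  by (subst sum.swap, rule sum.cong, simp, rule sum.swap)

lemma (in voa_alg) homogeneous_induct:
  assumes "\<And>p v. v \<in> weight_space V p \<Longrightarrow> P v" "\<And>u v. P u \<Longrightarrow> P v \<Longrightarrow> P (u + v)"
  shows "P v"
proof -
  have "v \<in> V.span (\<Union>p. weight_space V p)" using Vg.M_span by simp
  then show ?thesis
  proof (induction rule: V.span_induct_alt)
    case base then show ?case using assms(1)[OF Vg.zero_mem] .
  next
    case (step c x y)
    then show ?case using assms V.subspace_scale[OF Vg.sub] by blast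
  qed
qed

lemma (in voa_alg) D_eq_0:
  assumes "L 1 v = 0" "j \<ge> 1"
  shows "D j v = 0"
proof -
  have "D (Suc i) v = 0" for i
  proof (induction i)
    case 0
    show ?case by (subst D_Suc) (simp add: assms)
  next
    case (Suc i)
    have "L 1 0 = 0" using L1_scale[of 0 0] by simp
    then show ?case by (subst D_Suc) (simp add: Suc)
  qed
  then show ?thesis using assms(2) by (cases j) auto
qed

context weak_mod
begin

definition th :: "int \<Rightarrow> 'v \<Rightarrow> int \<Rightarrow> 'u \<Rightarrow> 'u" where
  "th p v n w = s ((-1) powi p) (Sum_any (\<lambda>j::nat. Y (D j v) (2 * p - n - 2 - int j) w))"

text \<open>
  The transpose of the \<open>n\<close>-th mode of the contragredient vertex operator: by
  \<open>Y'(v, x) = Y(e\<^bsup>x L(1)\<^esup> (-x\<^sup>-\<^sup>2)\<^bsup>L(0)\<^esup> v, x\<^sup>-\<^sup>1)\<^sup>t\<close>, it is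
  \<open>(-1)\<^sup>p \<Sum>\<^sub>j (L(1)\<^sup>j v / j!)\<close> in mode \<open>2p - n - 2 - j\<close> for \<open>v\<close> of weight \<open>p\<close>.
\<close>

definition Theta :: "'v \<Rightarrow> int \<Rightarrow> 'u \<Rightarrow> 'u" where
  "Theta v n w = Vg.ext (\<lambda>p v. th p v n w) v"

lemma th_bound:
  assumes "w \<in> S" "\<And>j. j \<ge> B \<Longrightarrow> D j v = 0"
  shows "th p v n w = s ((-1) powi p) (\<Sum>j<B. Y (D j v) (2 * p - n - 2 - int j) w)"
proof -
  have "Sum_any (\<lambda>j::nat. Y (D j v) (2 * p - n - 2 - int j) w) = (\<Sum>j<B. Y (D j v) (2 * p - n - 2 - int j) w)"
  proof (rule Sum_any.expand_superset)
    show "{j. Y (D j v) (2 * p - n - 2 - int j) w \<noteq> 0} \<subseteq> {..<B}"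
    proof
      fix j assume j: "j \<in> {j. Y (D j v) (2 * p - n - 2 - int j) w \<noteq> 0}"
      have "\<not> B \<le> j"
      proof
        assume "B \<le> j"
        then show False using j assms(2)[of j] Y_zero_left[OF assms(1)] by simp
      qed
      then show "j \<in> {..<B}" by simp
    qed
  qed simp
  then show ?thesis by (simp add: th_def)
qed

lemma th_linear: "w \<in> S \<Longrightarrow> linear_on (scale V) s (weight_space V p) (\<lambda>v. th p v n w)"
proof -
  assume w: "w \<in> S"
  have "th p (u + v) n w = th p u n w + th p v n w" if uv: "u \<in> weight_space V p" "v \<in> weight_space V p" for u v
  proof -
    obtain B1 B2 where B: "\<forall>j\<ge>B1. D j u = 0" "\<forall>j\<ge>B2. D j v = 0" using D_nilpotent uv by meson
    define B where "B = max B1 B2"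
    have z: "D j u = 0" "D j v = 0" if "j \<ge> B" for j using that B by (auto simp: B_def)
    have "th p (u + v) n w = s ((-1) powi p) (\<Sum>j<B. Y (D j (u + v)) (2 * p - n - 2 - int j) w)"
      by (rule th_bound[OF w]) (simp add: D_add z)
    also have "\<dots> = th p u n w + th p v n w"
      using z by (simp add: th_bound[OF w, of B] D_add Y_add_left w sum.distrib s.scale_right_distrib)
    finally show ?thesis .
  qed
  moreover have "th p (scale V c v) n w = s c (th p v n w)" if v: "v \<in> weight_space V p" for c v
  proof -
    obtain B where B: "\<And>j. j \<ge> B \<Longrightarrow> D j v = 0" using D_nilpotent v by meson
    have "th p (scale V c v) n w = s ((-1) powi p) (\<Sum>j<B. Y (D j (scale V c v)) (2 * p - n - 2 - int j) w)"
      by (rule th_bound[OF w]) (simp add: D_scale B)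
    also have "\<dots> = s c (th p v n w)"
      by (simp add: th_bound[OF w, of B] B D_scale Y_scale_left w mult.commute flip: s.scale_sum_right)
    finally show ?thesis .
  qed
  ultimately show ?thesis unfolding linear_on_def by blast
qed

lemma Theta_hom: "v \<in> weight_space V p \<Longrightarrow> w \<in> S \<Longrightarrow> Theta v n w = th p v n w"
  unfolding Theta_def by (rule Vg.ext_hom[OF s.vector_space_axioms th_linear])

lemma Theta_linear_left: "w \<in> S \<Longrightarrow> linear_on (scale V) s UNIV (\<lambda>v. Theta v n w)"
  unfolding Theta_def by (rule Vg.ext_linear[OF s.vector_space_axioms th_linear])

lemma Theta_add_left: "w \<in> S \<Longrightarrow> Theta (u + v) n w = Theta u n w + Theta v n w"
  and Theta_scale_left: "w \<in> S \<Longrightarrow> Theta (scale V c v) n w = s c (Theta v n w)"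
  using Theta_linear_left[of w n] by (auto simp: linear_on_def)

lemma Theta_bound:
  assumes "v \<in> weight_space V p" "w \<in> S" "\<And>j. j \<ge> B \<Longrightarrow> D j v = 0"
  shows "Theta v n w = s ((-1) powi p) (\<Sum>j<B. Y (D j v) (2 * p - n - 2 - int j) w)"
  using Theta_hom[OF assms(1,2)] th_bound[OF assms(2,3)] by simp

lemma Theta_closed: "w \<in> S \<Longrightarrow> Theta v n w \<in> S"
proof (induction v rule: homogeneous_induct)
  case (1 p v)
  then obtain B where B: "\<And>j. j \<ge> B \<Longrightarrow> D j v = 0" using D_nilpotent by meson
  have eq: "Theta v n w = s ((-1) powi p) (\<Sum>j<B. Y (D j v) (2 * p - n - 2 - int j) w)"
    using Theta_bound[of v p w B n] 1 B by blast
  show ?case unfolding eq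
    by (intro s.subspace_scale s.subspace_sum subspace_S Y_closed 1)
next
  case (2 u v)
  then show ?case by (simp add: Theta_add_left s.subspace_add[OF subspace_S])
qed

lemma Theta_add: "w \<in> S \<Longrightarrow> w' \<in> S \<Longrightarrow> Theta v n (w + w') = Theta v n w + Theta v n w'"
proof (induction v rule: homogeneous_induct)
  case (1 p v)
  then obtain B where B: "\<And>j. j \<ge> B \<Longrightarrow> D j v = 0" using D_nilpotent by meson
  have "w + w' \<in> S" using 1 s.subspace_add[OF subspace_S] by blast
  then show ?case using 1 B
    by (simp add: Theta_bound[OF 1(1), of _ B] Y_add sum.distrib s.scale_right_distrib)
next
  case (2 u v)
  then show ?case by (simp add: Theta_add_left s.subspace_add[OF subspace_S])
qed

lemma Theta_scale: "w \<in> S \<Longrightarrow> Theta v n (s c w) = s c (Theta v n w)"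
proof (induction v rule: homogeneous_induct)
  case (1 p v)
  then obtain B where B: "\<And>j. j \<ge> B \<Longrightarrow> D j v = 0" using D_nilpotent by meson
  have "s c w \<in> S" using 1 s.subspace_scale[OF subspace_S] by blast
  then show ?case using 1 B
    by (simp add: Theta_bound[OF 1(1), of _ B] Y_scale mult.commute flip: s.scale_sum_right)
next
  case (2 u v)
  then show ?case by (simp add: Theta_add_left s.subspace_scale[OF subspace_S] s.scale_right_distrib)
qed

lemma Theta_sum: "(\<And>i. i \<in> A \<Longrightarrow> f i \<in> S) \<Longrightarrow> Theta v n (sum f A) = (\<Sum>i\<in>A. Theta v n (f i))"
proof (induction A rule: infinite_finite_induct)
  case (infinite A)
  then show ?case using Theta_scale[OF S0, of v n 0] by simp
next
  case empty
  then show ?case using Theta_scale[OF S0, of v n 0] by simp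
qed (simp add: Theta_add s.subspace_sum[OF subspace_S])

text \<open>Only \<open>j = 0\<close> contributes because \<open>L(1)\<close> kills the conformal
  vector; the sign is \<open>(-1)^2\<close> and the mode is \<open>2 * 2 - 1 - 2 = 1\<close>. Thus
  \<open>L(0)\<close> on the dual is the transpose of \<open>L(0)\<close>.\<close>

lemma Theta_conformal: "w \<in> S \<Longrightarrow> Theta (conformal V) 1 w = virasoro V Y 0 w"
proof -
  assume w: "w \<in> S"
  have "D j (conformal V) = 0" if "j \<ge> 1" for j using that by (intro D_eq_0 L1_conformal)
  from Theta_bound[OF conformal_weight w this, where n = 1] show ?thesis by (simp add: virasoro_def)
qed

lemma Theta_vacuum: "w \<in> S \<Longrightarrow> Theta (vacuum V) n w = (if n = -1 then w else 0)"
proof -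
  assume w: "w \<in> S"
  have h: "vacuum V \<in> weight_space V 0" by (simp add: weight_space_def L_vacuum)
  have "D j (vacuum V) = 0" if "j \<ge> 1" for j using that by (intro D_eq_0) (simp_all add: L_vacuum)
  from Theta_bound[OF h w this, where n = n] show ?thesis using w by (auto simp: vac)
qed

text \<open>\<open>Theta\<close> consists of transposes, so products occur in the reverse order: a
  functional applied to this equation gives the Jacobi identity of the dual action at
  \<open>w\<close>.\<close>

definition anti_jac :: "'v \<Rightarrow> 'v \<Rightarrow> 'u \<Rightarrow> int \<Rightarrow> int \<Rightarrow> int \<Rightarrow> nat \<Rightarrow> bool" where
  "anti_jac a b w l m n B \<longleftrightarrow>
    (\<Sum>i<B. s ((-1) ^ i * (of_int l gchoose i)) (Theta b (n + int i) (Theta a (m + l - int i) w)))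
    - (\<Sum>i<B. s ((-1) powi l * (-1) ^ i * (of_int l gchoose i)) (Theta a (m + int i) (Theta b (n + l - int i) w)))
    = (\<Sum>i<B. s (of_int m gchoose i) (Theta (vertex V a (l + int i) b) (m + n - int i) w))"

lemma vertex_zero_left [simp]: "vertex V 0 n b = 0"
  using weak_mod.Y_zero_left[OF weak_mod_adjoint, of b n] by simp

lemma vertex_zero [simp]: "vertex V a n 0 = 0"
  using weak_mod.Y_zero[OF weak_mod_adjoint, of a n] by simp

text \<open>Both sides are expanded into modes of \<open>D j a\<close> and \<open>D k b\<close> on
  \<open>W\<close>, where the Jacobi identity is known for each pair \<open>(j, k)\<close>. The left
  sides match with the two products interchanged; the right sides match by \<open>D_vertex\<close>
  and the alternating Vandermonde identity.\<close>

lemma anti_jac_hom: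
  assumes a: "a \<in> weight_space V p" and b: "b \<in> weight_space V q" and w: "w \<in> S"
  shows "\<forall>\<^sub>F B in sequentially. anti_jac a b w l m n B"
proof -
  \<comment> \<open>These indices turn \<open>Theta a (m + l - i)\<close> into the modes
    \<open>M j + i\<close> of \<open>D j a\<close>, and \<open>Theta b (n + i)\<close> into the
    modes \<open>N k + l - i\<close> of \<open>D k b\<close>.\<close>
  define M where "M j = 2 * p - m - l - 2 - int j" for j
  define N where "N k = 2 * q - n - l - 2 - int k" for k
  obtain N0 where N0: "\<forall>n<N0. weight_space V n = {0}" using weights_bounded_below by blast
  obtain Ba where Ba: "\<forall>j\<ge>Ba. D j a = 0" using D_nilpotent[OF a] by blast
  obtain Bb where Bb: "\<forall>j\<ge>Bb. D j b = 0" using D_nilpotent[OF b] by blast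
  \<comment> \<open>Only finitely many pairs \<open>(j, k)\<close> have both divided powers nonzero,
    so one cutoff serves all of them.\<close>
  have ev: "\<forall>\<^sub>F B in sequentially. \<forall>j\<in>{..<Ba}. \<forall>k\<in>{..<Bb}. jac_eq s (vertex V) Y Y Y (D j a) (D k b) w l (M j) (N k) B"
    by (intro eventually_ball_finite ballI jac_eventually w) auto
  have ge: "\<forall>\<^sub>F B in sequentially. B \<ge> max (max Ba Bb) (nat (p + q - l - N0))"
    by (rule eventually_ge_at_top)
  show ?thesis
    using ev ge
  proof eventually_elim
    case (elim B)
    have Da: "D j a = 0" if "j \<ge> B" for j using Ba that elim by auto
    have Db: "D j b = 0" if "j \<ge> B" for j using Bb that elim by auto
    have jacB: "jac_eq s (vertex V) Y Y Y (D j a) (D k b) w l (M j) (N k) B" for j k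
    proof (cases "j < Ba \<and> k < Bb")
      case False
      then have "D j a = 0 \<or> D k b = 0" using Ba Bb by auto
      then show ?thesis unfolding jac_eq_def using w by (auto simp: Y_zero_left Y_closed)
    qed (use elim in auto)
    \<comment> \<open>The weight of this vector is below every weight of \<open>V\<close>, by the
      second bound imposed on \<open>B\<close>.\<close>
    have van: "vertex V (D j a) (l + int t) (D k b) = 0" if "j + k + t \<ge> B" for j k t
    proof -
      have "vertex V (D j a) (l + int t) (D k b) \<in> weight_space V (p - int j + (q - int k) - (l + int t) - 1)"
        by (rule weight_shift[OF D_weight[OF a] D_weight[OF b]])
      moreover have "p - int j + (q - int k) - (l + int t) - 1 < N0" using that elim by linarith
      ultimately show ?thesis using N0 by blast
    qed
    have ab: "vertex V a (l + int i) b \<in> weight_space V (p + q - (l + int i) - 1)" for i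
      by (rule weight_shift[OF a b])
    have Dvan: "D r (vertex V a (l + int i) b) = 0" if "r \<ge> B" for r i
    proof -
      have "p + q - (l + int i) - 1 - int r < N0" using that elim by linarith
      then show ?thesis using N0 D_weight[OF ab, of r i] by blast
    qed
    define e :: complex where "e = (-1) powi p * (-1) powi q"
    define f :: complex where "f = (-1) powi l"
    have ff: "f * (f * x) = x" for x by (simp add: f_def flip: mult.assoc power_int_mult_distrib)
    have fi: "inverse f = f" using ff[of 1] by (intro inverse_unique) simp
    define X where "X j k i = Y (D k b) (N k + l - int i) (Y (D j a) (M j + int i) w)" for j k i
    define Z where "Z j k i = Y (D j a) (M j + l - int i) (Y (D k b) (N k + int i) w)" for j k i
    define U where "U j k t = Y (vertex V (D j a) (l + int t) (D k b)) (M j + N k - int t) w" for j k t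
    define c where "c i = ((-1) ^ i * (of_int l gchoose i) :: complex)" for i :: nat
    define d where "d i j r = ((-1) ^ i * (of_int m gchoose i) * (of_int (2 * p - l - int i - 2 - int j) gchoose r) :: complex)"
      for i j r :: nat
    \<comment> \<open>Here the product with \<open>D j a\<close> outermost comes first, while in
      \<open>anti_jac\<close> its transposed counterpart is the second product. Restoring the order
      costs the factor \<open>- e * f\<close>.\<close>
    have jac3: "(\<Sum>i<B. s (c i) (Z j k i)) - (\<Sum>i<B. s (f * c i) (X j k i)) = (\<Sum>t<B. s (of_int (M j) gchoose t) (U j k t))" for j k
      using jacB[of j k] unfolding jac_eq_def Z_def X_def U_def c_def f_def by (simp add: mult.assoc)
    have ThA: "Theta a k x = s ((-1) powi p) (\<Sum>j<B. Y (D j a) (2 * p - k - 2 - int j) x)" if "x \<in> S" for k x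
      by (rule Theta_bound[OF a that Da])
    have ThB: "Theta b k x = s ((-1) powi q) (\<Sum>j<B. Y (D j b) (2 * q - k - 2 - int j) x)" if "x \<in> S" for k x
      by (rule Theta_bound[OF b that Db])
    have "Theta b (n + int i) (Theta a (m + l - int i) w) = s e (\<Sum>j<B. \<Sum>k<B. X j k i)" for i
    proof -
      have "Theta a (m + l - int i) w = s ((-1) powi p) (\<Sum>j<B. Y (D j a) (M j + int i) w)"
        unfolding ThA[OF w] M_def by (simp add: algebra_simps)
      then have "Theta b (n + int i) (Theta a (m + l - int i) w) = s ((-1) powi p) (\<Sum>j<B. Theta b (n + int i) (Y (D j a) (M j + int i) w))"
        using w by (simp add: Theta_scale Theta_sum Y_closed s.subspace_sum[OF subspace_S])
      also have "\<dots> = s ((-1) powi p) (\<Sum>j<B. s ((-1) powi q) (\<Sum>k<B. X j k i))"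
      proof -
        have "2 * q - (n + int i) - 2 - int k = N k + l - int i" for k by (simp add: N_def)
        then show ?thesis by (simp only: ThB[OF Y_closed[OF w]] X_def)
      qed
      finally show ?thesis by (simp add: e_def flip: s.scale_sum_right)
    qed
    then have "(\<Sum>i<B. s (c i) (Theta b (n + int i) (Theta a (m + l - int i) w)))
        = (\<Sum>i<B. \<Sum>j<B. \<Sum>k<B. s (c i * e) (X j k i))"
      by (simp only: s.scale_sum_right s.scale_scale)
    also have "\<dots> = (\<Sum>j<B. \<Sum>k<B. \<Sum>i<B. s (c i * e) (X j k i))"
      by (rule sum_swap3)
    also have "\<dots> = (\<Sum>j<B. \<Sum>k<B. \<Sum>i<B. s (e * f * (f * c i)) (X j k i))"
    proof -
      have "c i * e = e * f * (f * c i)" for i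
        using ff[of "c i"] by (simp add: mult.assoc mult.commute[of _ e])
      then show ?thesis by (simp only:)
    qed
    also have "\<dots> = s (e * f) (\<Sum>j<B. \<Sum>k<B. \<Sum>i<B. s (f * c i) (X j k i))"
      by (simp only: s.scale_sum_right s.scale_scale)
    finally have "(\<Sum>i<B. s (c i) (Theta b (n + int i) (Theta a (m + l - int i) w)))
        = s (e * f) (\<Sum>j<B. \<Sum>k<B. \<Sum>i<B. s (f * c i) (X j k i))" .
    moreover have "Theta a (m + int i) (Theta b (n + l - int i) w) = s e (\<Sum>j<B. \<Sum>k<B. Z j k i)" for i
    proof -
      have "Theta b (n + l - int i) w = s ((-1) powi q) (\<Sum>k<B. Y (D k b) (N k + int i) w)"
        unfolding ThB[OF w] N_def by (simp add: algebra_simps)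
      then have "Theta a (m + int i) (Theta b (n + l - int i) w) = s ((-1) powi q) (\<Sum>k<B. Theta a (m + int i) (Y (D k b) (N k + int i) w))"
        using w by (simp add: Theta_scale Theta_sum Y_closed s.subspace_sum[OF subspace_S])
      also have "\<dots> = s ((-1) powi q) (\<Sum>k<B. s ((-1) powi p) (\<Sum>j<B. Z j k i))"
      proof -
        have "2 * p - (m + int i) - 2 - int j = M j + l - int i" for j by (simp add: M_def)
        then show ?thesis by (simp only: ThA[OF Y_closed[OF w]] Z_def)
      qed
      also have "\<dots> = s e (\<Sum>k<B. \<Sum>j<B. Z j k i)"
        by (simp add: e_def mult.commute flip: s.scale_sum_right)
      finally show ?thesis by (subst sum.swap)
    qed
    then have "(\<Sum>i<B. s (f * c i) (Theta a (m + int i) (Theta b (n + l - int i) w)))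
        = s (e * f) (\<Sum>j<B. \<Sum>k<B. \<Sum>i<B. s (c i) (Z j k i))"
    proof -
      assume *: "\<And>i. Theta a (m + int i) (Theta b (n + l - int i) w) = s e (\<Sum>j<B. \<Sum>k<B. Z j k i)"
      have "f * c i * e = e * f * c i" for i by simp
      then have "(\<Sum>i<B. s (f * c i) (Theta a (m + int i) (Theta b (n + l - int i) w)))
          = (\<Sum>i<B. \<Sum>j<B. \<Sum>k<B. s (e * f * c i) (Z j k i))"
        by (simp only: * s.scale_sum_right s.scale_scale)
      also have "\<dots> = (\<Sum>j<B. \<Sum>k<B. \<Sum>i<B. s (e * f * c i) (Z j k i))"
        by (rule sum_swap3)
      finally show ?thesis by (simp only: s.scale_sum_right s.scale_scale)
    qed
    ultimately have "(\<Sum>i<B. s (c i) (Theta b (n + int i) (Theta a (m + l - int i) w)))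
      - (\<Sum>i<B. s (f * c i) (Theta a (m + int i) (Theta b (n + l - int i) w)))
      = - s (e * f) (\<Sum>j<B. \<Sum>k<B. \<Sum>t<B. s (of_int (M j) gchoose t) (U j k t))"
      by (simp add: jac3[symmetric] sum_subtractf s.scale_right_diff_distrib)
    also have "(\<Sum>j<B. \<Sum>k<B. \<Sum>t<B. s (of_int (M j) gchoose t) (U j k t))
      = (\<Sum>j<B. \<Sum>k<B. \<Sum>t<B. \<Sum>i\<le>t. s (d i j (t - i)) (U j k t))"
    proof (intro sum.cong refl)
      fix j k t
      \<comment> \<open>The upper entry is \<open>M j = x - m\<close> for
        \<open>x = 2 p - l - 2 - j\<close>. The expansion creates the factor
        \<open>binom(m, i)\<close> required on the right side of \<open>anti_jac\<close>.\<close>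
      have "(of_int (M j) :: complex) gchoose t = (\<Sum>i\<le>t. d i j (t - i))"
        using gbinomial_alternating_Vandermonde[where t = t and m = m and x = "of_int (2 * p - l - 2 - int j)"]
        by (simp add: M_def d_def algebra_simps)
      then show "s (of_int (M j) gchoose t) (U j k t) = (\<Sum>i\<le>t. s (d i j (t - i)) (U j k t))"
        by (simp add: s.scale_sum_left)
    qed
    \<comment> \<open>The terms are regrouped by the summation index \<open>i\<close> of the right
      side and the order \<open>r\<close> of the divided power applied to
      \<open>vertex V a (l + i) b\<close>.\<close>
    also have "\<dots> = (\<Sum>i<B. \<Sum>r<B. \<Sum>(j, r', k)\<in>triples r. s (d i j r') (U j k (i + r')))"
    proof -
      have "(\<Sum>j<B. \<Sum>k<B. \<Sum>t<B. \<Sum>i\<le>t. s (d i j (t - i)) (U j k t))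
         = (\<Sum>j<B. \<Sum>k<B. \<Sum>t<B. \<Sum>i\<le>t. s (d i j (t - i)) (U j k (i + (t - i))))"
        by (intro sum.cong refl) simp
      also have "\<dots> = (\<Sum>i<B. \<Sum>r<B. \<Sum>(j, r', k)\<in>triples r. s (d i j r') (U j k (i + r')))"
      proof (rule sum_triples_rearrange[symmetric])
        fix j k i r :: nat
        assume "B \<le> j + k + i + r"
        then have "vertex V (D j a) (l + int (i + r)) (D k b) = 0" by (intro van) auto
        then have "U j k (i + r) = 0" unfolding U_def using w by (simp only: Y_zero_left)
        then show "s (d i j r) (U j k (i + r)) = 0"
          by simp
      qed
      finally show ?thesis .
    qed
    also have "- s (e * f) \<dots> = (\<Sum>i<B. s (of_int m gchoose i) (Theta (vertex V a (l + int i) b) (m + n - int i) w))"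
    proof -
      have "s (of_int m gchoose i) (Theta (vertex V a (l + int i) b) (m + n - int i) w)
        = - s (e * f) (\<Sum>r<B. \<Sum>(j, r', k)\<in>triples r. s (d i j r') (U j k (i + r')))" for i
      proof -
        let ?P = "p + q - (l + int i) - 1"
        \<comment> \<open>The weight of \<open>vertex V a (l + i) b\<close> contains the summand -1,
          which supplies the minus sign coming from the interchange; \<open>f\<close> is its own
          inverse.\<close>
        have sg: "(-1) powi ?P = - (e * f * (-1) ^ i)"
          by (simp add: e_def f_def power_int_diff power_int_add)
            (simp add: divide_inverse fi[unfolded f_def] flip: power_inverse)
        have "Y (D r (vertex V a (l + int i) b)) (2 * ?P - (m + n - int i) - 2 - int r) w
          = (\<Sum>(j, r', k)\<in>triples r. s (of_int (2 * p - l - int i - 2 - int j) gchoose r') (U j k (i + r')))" for r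
        proof -
          have "Y (D r (vertex V a (l + int i) b)) (2 * ?P - (m + n - int i) - 2 - int r) w
            = (\<Sum>x\<in>triples r. case x of (j, r', k) \<Rightarrow> Y (scale V (of_int (2 * p - (l + int i) - 2 - int j) gchoose r') (vertex V (D j a) (l + int i + int r') (D k b))) (2 * ?P - (m + n - int i) - 2 - int r) w)"
            unfolding D_vertex[OF a] by (simp add: Y_sum_left[OF w] case_prod_unfold)
          also have "\<dots> = (\<Sum>(j, r', k)\<in>triples r. s (of_int (2 * p - l - int i - 2 - int j) gchoose r') (U j k (i + r')))"
          proof (rule sum.cong, simp, clarify)
            fix j r' k assume "(j, r', k) \<in> triples r"
            then have r: "int r = int j + int r' + int k" by (auto simp: triples_def)
            have i1: "2 * ?P - (m + n - int i) - 2 - int r = M j + N k - int (i + r')"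
              unfolding r M_def N_def by simp
            have i2: "l + int i + int r' = l + int (i + r')" "2 * p - (l + int i) - 2 - int j = 2 * p - l - int i - 2 - int j" by auto
            show "Y (scale V (of_int (2 * p - (l + int i) - 2 - int j) gchoose r') (vertex V (D j a) (l + int i + int r') (D k b))) (2 * ?P - (m + n - int i) - 2 - int r) w
              = s (of_int (2 * p - l - int i - 2 - int j) gchoose r') (U j k (i + r'))"
              unfolding i1 i2 Y_scale_left[OF w] U_def ..
          qed
          finally show ?thesis .
        qed
        then have "Theta (vertex V a (l + int i) b) (m + n - int i) w = s (- (e * f * (-1) ^ i)) (\<Sum>r<B. \<Sum>(j, r', k)\<in>triples r. s (of_int (2 * p - l - int i - 2 - int j) gchoose r') (U j k (i + r')))"
        proof -
          assume *: "\<And>r. Y (D r (vertex V a (l + int i) b)) (2 * ?P - (m + n - int i) - 2 - int r) w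
            = (\<Sum>(j, r', k)\<in>triples r. s (of_int (2 * p - l - int i - 2 - int j) gchoose r') (U j k (i + r')))"
          have "Theta (vertex V a (l + int i) b) (m + n - int i) w
            = s ((-1) powi ?P) (\<Sum>r<B. Y (D r (vertex V a (l + int i) b)) (2 * ?P - (m + n - int i) - 2 - int r) w)"
            by (rule Theta_bound[OF ab w Dvan])
          then show ?thesis by (simp only: sg *)
        qed
        then show ?thesis
          by (simp add: d_def s.scale_sum_right case_prod_unfold mult_ac sum_negf)
      qed
      then show ?thesis by (simp add: sum_negf s.scale_sum_right)
    qed
    finally show ?case unfolding anti_jac_def c_def f_def by (simp add: mult.assoc)
  qed
qed

lemma anti_jac_eventually:
  assumes w: "w \<in> S"
  shows "\<forall>\<^sub>F B in sequentially. anti_jac a b w l m n B"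
proof (induction a rule: homogeneous_induct)
  case (1 p a)
  then show ?case
  proof (induction b rule: homogeneous_induct)
    case (1 q b)
    then show ?case by (intro anti_jac_hom w)
  next
    case (2 b b')
    have v: "vertex V a k (b + b') = vertex V a k b + vertex V a k b'" for k
      using weak_mod.Y_add[OF weak_mod_adjoint, of b b' a k] by simp
    from 2(1)[OF 2(3)] 2(2)[OF 2(3)] show ?case
    proof eventually_elim
      case (elim B)
      then show ?case unfolding anti_jac_def using w
        by (simp add: v Theta_add_left Theta_add Theta_closed sum.distrib s.scale_right_distrib add_diff_add)
    qed
  qed
next
  case (2 a a')
  have v: "vertex V (a + a') k b = vertex V a k b + vertex V a' k b" for k
    using weak_mod.Y_add_left[OF weak_mod_adjoint, of b a a' k] by simp
  from 2 show ?case
  proof eventually_elim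
    case (elim B)
    then show ?case unfolding anti_jac_def using w
      by (simp add: v Theta_add_left Theta_add Theta_closed sum.distrib s.scale_right_distrib add_diff_add)
  qed
qed

end

section \<open>The dual of a weak module\<close>

context weak_mod
begin

abbreviation dscale :: "complex \<Rightarrow> ('u \<Rightarrow> complex) \<Rightarrow> 'u \<Rightarrow> complex" where
  "dscale \<equiv> \<lambda>c f x. c * f x"

lemma vector_space_dscale: "vector_space dscale"
  by (rule vector_space_pointwise[OF vector_space_complex])

definition dact :: "'v \<Rightarrow> int \<Rightarrow> ('u \<Rightarrow> complex) \<Rightarrow> 'u \<Rightarrow> complex" where
  "dact v n \<alpha> = (\<lambda>w. if w \<in> S then \<alpha> (Theta v n w) else 0)"

text \<open>The lower truncated part of the full dual. The bound \<open>N\<close> is uniform in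
  \<open>w\<close> because truncation concerns the functional as a whole. Values outside
  \<open>S\<close> are fixed as 0 so that equality of functionals is equality of functions.\<close>

definition dual_space :: "('u \<Rightarrow> complex) set" where
  "dual_space = {\<alpha>. linear_on s (*) S \<alpha> \<and> (\<forall>w. w \<notin> S \<longrightarrow> \<alpha> w = 0) \<and>
     (\<forall>v. \<exists>N. \<forall>n\<ge>N. \<forall>w\<in>S. \<alpha> (Theta v n w) = 0)}"

definition dual :: "('v, 'u \<Rightarrow> complex) vmod" where
  "dual = \<lparr>space = dual_space, act = dact\<rparr>"

lemma dual_spaceD:
  assumes "\<alpha> \<in> dual_space"
  shows "w \<in> S \<Longrightarrow> w' \<in> S \<Longrightarrow> \<alpha> (w + w') = \<alpha> w + \<alpha> w'" "w \<in> S \<Longrightarrow> \<alpha> (s c w) = c * \<alpha> w"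
    "w \<notin> S \<Longrightarrow> \<alpha> w = 0" "\<exists>N. \<forall>n\<ge>N. \<forall>w\<in>S. \<alpha> (Theta v n w) = 0" "\<alpha> 0 = 0"
proof -
  show *: "w \<in> S \<Longrightarrow> \<alpha> (s c w) = c * \<alpha> w" for w c
    using assms unfolding dual_space_def linear_on_def by blast
  show "\<alpha> 0 = 0" using *[OF S0, of 0] by simp
qed (use assms in \<open>auto simp: dual_space_def linear_on_def\<close>)

lemma dual_sum:
  assumes "\<alpha> \<in> dual_space" "\<And>i. i \<in> A \<Longrightarrow> f i \<in> S"
  shows "\<alpha> (sum f A) = (\<Sum>i\<in>A. \<alpha> (f i))"
  using assms(2)
  by (induction A rule: infinite_finite_induct)
    (auto simp: dual_spaceD[OF assms(1)] s.subspace_sum[OF subspace_S])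

lemma dual_diff:
  assumes "\<alpha> \<in> dual_space" "w \<in> S" "w' \<in> S"
  shows "\<alpha> (w - w') = \<alpha> w - \<alpha> w'"
  using dual_spaceD(1)[OF assms(1), of "w - w'" w'] s.subspace_diff[OF subspace_S assms(2,3)] assms by simp

lemma Theta_commutator:
  assumes "w \<in> S" "\<And>i. i \<ge> K \<Longrightarrow> vertex V a (int i) b = 0"
  shows "Theta b n (Theta a m w) - Theta a m (Theta b n w) =
    (\<Sum>i<K. s (of_int m gchoose i) (Theta (vertex V a (int i) b) (m + n - int i) w))"
proof -
  obtain K' where K': "K' \<ge> Suc K" "anti_jac a b w 0 m n K'"
    using eventually_obtain_ge[OF anti_jac_eventually[OF assms(1), of a b 0 m n], of "Suc K"] by blast
  have z: "(\<Sum>i<K'. s (c i * (0 gchoose i)) (f i)) = s (c 0) (f 0)" for c f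
    using K'(1) by (intro sum_scale_gbinomial_0 s.vector_space_axioms) simp
  have T0: "Theta 0 k w = 0" for k using Theta_scale_left[OF assms(1), of 0 0 k] by simp
  have "(\<Sum>i<K'. s (of_int m gchoose i) (Theta (vertex V a (int i) b) (m + n - int i) w)) =
      (\<Sum>i<K. s (of_int m gchoose i) (Theta (vertex V a (int i) b) (m + n - int i) w))"
    by (rule sum.mono_neutral_right) (use K'(1) assms in \<open>auto simp: T0\<close>)
  then show ?thesis
    using K'(2) z[of "\<lambda>i. (-1) ^ i"] z[of "\<lambda>i. 1 * (-1) ^ i"] unfolding anti_jac_def by simp
qed

lemma dact_linear:
  assumes "\<alpha> \<in> dual_space"
  shows "linear_on s (*) S (dact v n \<alpha>)"
  unfolding linear_on_def dact_def
  using subspace_S assms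
  by (auto simp: s.subspace_def Theta_add Theta_scale dual_spaceD Theta_closed)

text \<open>By the commutator formula, \<open>v\<close> in mode \<open>m\<close> on
  \<open>dact u n \<alpha>\<close> differs from \<open>dact u n\<close> of \<open>v\<close> in mode
  \<open>m\<close> on \<alpha> by finitely many modes of vectors \<open>vertex V v i u\<close> on
  \<alpha>. All of these vanish for large \<open>m\<close>, uniformly in \<open>w\<close>.\<close>

lemma dact_closed:
  assumes \<alpha>: "\<alpha> \<in> dual_space"
  shows "dact u n \<alpha> \<in> dual_space"
proof -
  have "\<exists>N. \<forall>m\<ge>N. \<forall>w\<in>S. dact u n \<alpha> (Theta v m w) = 0" for v
  proof -
    obtain K where K: "\<And>i. i \<ge> K \<Longrightarrow> vertex V v (int i) u = 0"
      using vertex_trunc_from[of v 0 u] by auto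
    obtain N where N: "\<forall>m\<ge>N. \<forall>w\<in>S. \<alpha> (Theta v m w) = 0" using dual_spaceD(4)[OF \<alpha>] by blast
    have "\<forall>i. \<exists>Ni. \<forall>m\<ge>Ni. \<forall>w\<in>S. \<alpha> (Theta (vertex V v (int i) u) m w) = 0"
      using dual_spaceD(4)[OF \<alpha>] by blast
    then obtain Ni where Ni: "\<And>i m w. m \<ge> Ni i \<Longrightarrow> w \<in> S \<Longrightarrow> \<alpha> (Theta (vertex V v (int i) u) m w) = 0"
      by metis
    define N' where "N' = max N (Max (insert 0 ((\<lambda>i. Ni i - n + int i) ` {..<K})))"
    have "dact u n \<alpha> (Theta v m w) = 0" if m: "m \<ge> N'" and w: "w \<in> S" for m w
    proof -
      have mi: "Ni i \<le> m + n - int i" if "i < K" for i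
      proof -
        have "Ni i - n + int i \<le> Max (insert 0 ((\<lambda>i. Ni i - n + int i) ` {..<K}))"
          using that by (intro Max_ge) auto
        then show ?thesis using m unfolding N'_def by linarith
      qed
      have "Theta u n (Theta v m w) = Theta v m (Theta u n w) +
         (\<Sum>i<K. s (of_int m gchoose i) (Theta (vertex V v (int i) u) (m + n - int i) w))"
        using Theta_commutator[OF w, of K v u n m] K by (simp add: diff_eq_eq add.commute)
      then have "\<alpha> (Theta u n (Theta v m w)) = \<alpha> (Theta v m (Theta u n w)) +
         (\<Sum>i<K. (of_int m gchoose i) * \<alpha> (Theta (vertex V v (int i) u) (m + n - int i) w))"
        using w \<alpha> by (simp add: dual_spaceD dual_sum Theta_closed s.subspace_scale[OF subspace_S] s.subspace_sum[OF subspace_S])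
      also have "\<dots> = 0" using m N w mi Ni by (simp add: Theta_closed N'_def)
      finally show ?thesis using w by (simp add: dact_def Theta_closed)
    qed
    then show ?thesis by blast
  qed
  then show ?thesis
    using dact_linear[OF \<alpha>] unfolding dual_space_def by (auto simp: dact_def)
qed

lemma dual_subspace: "module.subspace dscale dual_space"
proof -
  interpret d: vector_space dscale by (rule vector_space_dscale)
  show ?thesis
    unfolding d.subspace_def
  proof (intro conjI ballI allI)
    show "0 \<in> dual_space" by (auto simp: dual_space_def linear_on_def)
  next
    fix \<alpha> \<beta> assume ab: "\<alpha> \<in> dual_space" "\<beta> \<in> dual_space"
    have "\<exists>N. \<forall>n\<ge>N. \<forall>w\<in>S. (\<alpha> + \<beta>) (Theta v n w) = 0" for v
    proof -
      obtain N1 N2 where "\<forall>n\<ge>N1. \<forall>w\<in>S. \<alpha> (Theta v n w) = 0" "\<forall>n\<ge>N2. \<forall>w\<in>S. \<beta> (Theta v n w) = 0"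
        using dual_spaceD(4) ab by meson
      then show ?thesis by (intro exI[of _ "max N1 N2"]) auto
    qed
    then show "\<alpha> + \<beta> \<in> dual_space"
      using ab by (auto simp: dual_space_def linear_on_def algebra_simps)
  next
    fix c \<alpha> assume a: "\<alpha> \<in> dual_space"
    have "\<exists>N. \<forall>n\<ge>N. \<forall>w\<in>S. c * \<alpha> (Theta v n w) = 0" for v
      using dual_spaceD(4)[OF a, of v] by auto
    then show "(\<lambda>x. c * \<alpha> x) \<in> dual_space"
      using a by (auto simp: dual_space_def linear_on_def algebra_simps)
  qed
qed

lemma dact_trunc: "\<alpha> \<in> dual_space \<Longrightarrow> \<exists>N. \<forall>n\<ge>N. dact v n \<alpha> = 0"
proof -
  assume "\<alpha> \<in> dual_space"
  then obtain N where "\<forall>n\<ge>N. \<forall>w\<in>S. \<alpha> (Theta v n w) = 0" using dual_spaceD(4) by blast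
  then show ?thesis by (intro exI[of _ N]) (auto simp: dact_def fun_eq_iff)
qed

lemma dact_left: "\<alpha> \<in> dual_space \<Longrightarrow> linear_on (scale V) dscale UNIV (\<lambda>v. dact v n \<alpha>)"
  by (auto simp: linear_on_def dact_def fun_eq_iff Theta_add_left Theta_scale_left dual_spaceD Theta_closed)

text \<open>Truncation of \<alpha> gives a cutoff \<open>K0\<close> that is uniform in
  \<open>w\<close>, whereas \<open>anti_jac\<close> holds only from a bound depending on
  \<open>w\<close>. Terms from \<open>K0\<close> on vanish as functionals, so the two cutoffs can be
  compared at each \<open>w\<close>.\<close>

lemma dual_jacobi:
  assumes \<alpha>: "\<alpha> \<in> dual_space"
  shows "jacobi_identity dscale (vertex V) dact dact dact a b \<alpha>"
proof -
  have tr: "\<exists>N::nat. \<forall>i\<ge>N. dact b (n + of_nat i) \<alpha> = 0" for n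
  proof -
    obtain N where N: "\<forall>n\<ge>N. dact b n \<alpha> = 0" using dact_trunc[OF \<alpha>] by blast
    show ?thesis by (rule exI[of _ "nat (N - n)"]) (use N in auto)
  qed
  have z1: "dact v k 0 = 0" for v k by (auto simp: dact_def fun_eq_iff)
  have z2: "dact 0 k \<alpha> = 0" for k
  proof
    fix w show "dact 0 k \<alpha> w = 0 w"
      using Theta_scale_left[of w 0 0 k] by (simp add: dact_def dual_spaceD[OF \<alpha>])
  qed
  show ?thesis
  proof (subst jacobi_identity_iff_eventually[where J = dact and ?Y1.0 = "vertex V" and ?Y2.0 = dact and ?Y3.0 = dact and v = a and a = b and b = \<alpha>, OF vector_space_dscale z1 z1 z2 dact_trunc[OF \<alpha>] vertex_trunc tr], intro allI)
    fix l m n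
    obtain K0 where K0: "\<forall>i\<ge>K0. dact b (n + of_nat i) \<alpha> = 0 \<and> dact a (m + int i) \<alpha> = 0 \<and> vertex V a (l + int i) b = 0"
      using jacobi_truncation_bound[where J = dact and ?Y1.0 = "vertex V" and ?Y2.0 = dact and ?Y3.0 = dact and v = a and a = b and b = \<alpha>, OF vector_space_dscale z1 z1 z2 dact_trunc[OF \<alpha>] vertex_trunc tr] by blast
    have "jac_eq dscale (vertex V) dact dact dact a b \<alpha> l m n K" if K: "K \<ge> K0" for K
    proof -
      let ?A = "\<lambda>K w. \<Sum>i<K. ((-1) ^ i * (of_int l gchoose i)) * dact a (m + l - int i) (dact b (n + of_nat i) \<alpha>) w"
      let ?B = "\<lambda>K w. \<Sum>i<K. ((-1) powi l * (-1) ^ i * (of_int l gchoose i))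
        * dact b (n + of_int l - of_nat i) (dact a (m + int i) \<alpha>) w"
      let ?C = "\<lambda>K w. \<Sum>i<K. (of_int m gchoose i) * dact (vertex V a (l + int i) b) (of_int m + n - of_nat i) \<alpha> w"
      have "?A K w - ?B K w = ?C K w" for w
      proof (cases "w \<in> S")
        case False
        then show ?thesis by (simp add: dact_def)
      next
        case w: True
        \<comment> \<open>\<open>B\<close> may depend on \<open>w\<close>; the sums up to
          \<open>K\<close> and up to \<open>B\<close> agree because both bounds are at least
          \<open>K0\<close>.\<close>
        obtain B where B: "B \<ge> K" "anti_jac a b w l m n B"
          using eventually_obtain_ge[OF anti_jac_eventually[OF w, of a b l m n], of K] by blast
        have ext: "(\<Sum>i<K. f i) = (\<Sum>i<B. f i)" if "\<And>i. i \<ge> K0 \<Longrightarrow> f i = 0" for f :: "nat \<Rightarrow> complex"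
          by (rule sum.mono_neutral_left) (use that B K in auto)
        have e1: "dact a k (dact b k' \<alpha>) w = \<alpha> (Theta b k' (Theta a k w))" for a b k k'
          using w by (simp add: dact_def Theta_closed)
        have e2: "dact x k \<alpha> w = \<alpha> (Theta x k w)" for x k using w by (simp add: dact_def)
        have "\<alpha> ((\<Sum>i<B. s ((-1) ^ i * (of_int l gchoose i)) (Theta b (n + int i) (Theta a (m + l - int i) w)))
          - (\<Sum>i<B. s ((-1) powi l * (-1) ^ i * (of_int l gchoose i)) (Theta a (m + int i) (Theta b (n + l - int i) w))))
          = \<alpha> (\<Sum>i<B. s (of_int m gchoose i) (Theta (vertex V a (l + int i) b) (m + n - int i) w))"
          using B(2) unfolding anti_jac_def by simp
        then have "?A B w - ?B B w = ?C B w"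
          unfolding e1 e2 using w
          by (simp add: dual_diff[OF \<alpha>] dual_sum[OF \<alpha>] dual_spaceD(2)[OF \<alpha>] Theta_closed
              s.subspace_sum[OF subspace_S] s.subspace_scale[OF subspace_S])
        moreover have "?A K w = ?A B w" by (rule ext) (use K0 in \<open>simp add: z1\<close>)
        moreover have "?B K w = ?B B w" by (rule ext) (use K0 in \<open>simp add: z1\<close>)
        moreover have "?C K w = ?C B w" by (rule ext) (use K0 in \<open>simp add: z2\<close>)
        ultimately show ?thesis by simp
      qed
      then show ?thesis
        unfolding jac_eq_def by (auto simp: fun_eq_iff sum_fun_apply)
    qed
    then show "\<forall>\<^sub>F K in sequentially. jac_eq dscale (vertex V) dact dact dact a b \<alpha> l m n K"
      by (rule eventually_sequentiallyI)
  qed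
qed

lemma dual_weak_module: "weak_module V dscale dual"
  unfolding weak_module_def dual_def vmod.simps
proof (intro conjI allI ballI)
  fix v n
  show "linear_on dscale dscale dual_space (dact v n)"
    by (auto simp: linear_on_def dact_def fun_eq_iff)
next
  fix n \<alpha> assume a: "\<alpha> \<in> dual_space"
  show "dact (vacuum V) n \<alpha> = (if n = -1 then \<alpha> else 0)"
    using a by (auto simp: dact_def fun_eq_iff Theta_vacuum dual_spaceD)
qed (auto intro: dual_subspace dact_closed dact_trunc dact_left dual_jacobi)

lemma dual_virasoro: "\<alpha> \<in> dual_space \<Longrightarrow> w \<in> S \<Longrightarrow> virasoro V (act dual) 0 \<alpha> w = \<alpha> (virasoro V Y 0 w)"
  by (simp add: dual_def virasoro_def dact_def Theta_conformal[unfolded virasoro_def])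

end

section \<open>Transport into the universe\<close>

lemma (in voa_alg) countable_spanning: "\<exists>C. countable C \<and> V.span C = UNIV"
proof -
  have "\<forall>k. \<exists>B. finite B \<and> V.span B = weight_space V k"
    using weight_space_fd unfolding finite_dimensional_def by blast
  then obtain B where B: "\<And>k. finite (B k)" "\<And>k. V.span (B k) = weight_space V k" by metis
  have "countable (\<Union>k. B k)" using B(1) by (intro countable_UN) (auto intro: countable_finite)
  moreover have "V.span (\<Union>k. B k) = UNIV"
  proof -
    have "(\<Union>k. weight_space V k) \<subseteq> V.span (\<Union>k. B k)"
      using B(2) V.span_mono[of "B _" "\<Union>k. B k"] by blast
    then show ?thesis using V.span_minimal[of _ "V.span (\<Union>k. B k)"] Vg.M_span by blast
  qed
  ultimately show ?thesis by blast
qed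

lemma (in weak_mod) cyclic_countable:
  assumes w: "w \<in> S"
  shows "\<exists>C. countable C \<and> s.span C = cyclic w"
proof -
  obtain C where C: "countable C" "V.span C = UNIV" using countable_spanning by blast
  let ?C = "(\<lambda>(v, n). Y v n w) ` (C \<times> UNIV)"
  have "s.span ?C = cyclic w"
  proof
    show "s.span ?C \<subseteq> cyclic w" unfolding cyclic_def by (intro s.span_mono) auto
    have "Y v n w \<in> s.span ?C" for v n
    proof -
      have "v \<in> V.span C" using C by simp
      then show ?thesis
      proof (induction rule: V.span_induct_alt)
        case base show ?case by (simp add: Y_zero_left w s.span_zero)
      next
        case (step c x y)
        then have "Y x n w \<in> s.span ?C" by (intro s.span_base) auto
        with step show ?case by (simp add: Y_add_left Y_scale_left w s.span_add s.span_scale)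
      qed
    qed
    then show "cyclic w \<subseteq> s.span ?C" unfolding cyclic_def by (intro s.span_minimal) auto
  qed
  moreover have "countable ?C" using C by auto
  ultimately show ?thesis by blast
qed

text \<open>A basis chosen inside \<open>C\<close> is countable and can be sent injectively into an
  infinite basis of the target; independence of the image makes the linear extension injective on
  the span.\<close>

lemma linear_embedding:
  assumes s: "vector_space s" and inf: "\<not> finite_dimensional s (UNIV :: 'u::ab_group_add set)"
    and t: "vector_space (t :: complex \<Rightarrow> 'x::ab_group_add \<Rightarrow> 'x)" and C: "countable C"
  shows "\<exists>f. Vector_Spaces.linear t s f \<and> inj_on f (module.span t C)"
proof -
  interpret s: vector_space s by fact
  interpret t: vector_space t by fact
  interpret p: vector_space_pair t s by unfold_locales
  obtain B where B: "B \<subseteq> C" "t.independent B" "C \<subseteq> t.span B"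
    using t.maximal_independent_subset[of C] by auto
  obtain E where E: "s.independent E" "UNIV \<subseteq> s.span E"
    using s.maximal_independent_subset[of UNIV] by auto
  have "infinite E" using inf E unfolding finite_dimensional_def by blast
  then obtain e :: "nat \<Rightarrow> 'u" where e: "inj e" "range e \<subseteq> E"
    using infinite_countable_subset by blast
  have "countable B" using B C countable_subset by blast
  define g where "g = e \<circ> to_nat_on B"
  have gi: "inj_on g B" unfolding g_def
    using e inj_on_to_nat_on[OF \<open>countable B\<close>] by (intro comp_inj_on) (auto intro: inj_on_subset)
  obtain f where f: "Vector_Spaces.linear t s f" "\<forall>x\<in>B. f x = g x"
    using p.linear_independent_extend[OF B(2), of g] by blast
  interpret f: Vector_Spaces.linear t s f by (rule f)
  have "s.independent (f ` B)"
    by (rule s.independent_mono[OF E(1)]) (use f e in \<open>auto simp: g_def\<close>)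
  moreover have "inj_on f B" using gi f(2) by (auto simp: inj_on_def)
  ultimately have "inj_on f (t.span B)" by (rule f.inj_on_span_independent_image)
  moreover have "t.span C \<subseteq> t.span B" using t.span_minimal[OF B(3)] by simp
  ultimately show ?thesis using f(1) by (meson inj_on_subset)
qed

context weak_mod
begin

text \<open>The structure of \<open>W\<close> is transported along a linear embedding into the
  universe \<open>'x\<close>. The image is a weak module to which the class condition applies, and
  its \<open>L(0)\<close>-eigenspaces are the images of those of \<open>W\<close>.\<close>

lemma class_A_semisimple:
  assumes t: "vector_space t" "\<not> finite_dimensional t (UNIV :: 'x::ab_group_add set)"
    and A: "class_A V t" and C: "countable C" "S = s.span C"
  shows "L0_semisimple V s W"
proof -
  interpret t: vector_space t by fact
  obtain f where f: "Vector_Spaces.linear s t f" "inj_on f S"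
    using linear_embedding[OF t s.vector_space_axioms C(1)] unfolding C(2)[symmetric] by blast
  interpret f: Vector_Spaces.linear s t f by (rule f)
  define g where "g = inv_into S f"
  have gf: "g (f x) = x" if "x \<in> S" for x using f(2) that by (simp add: g_def)
  define U :: "('v, 'x) vmod" where "U = \<lparr>space = f ` S, act = \<lambda>v n u. f (Y v n (g u))\<rparr>"
  have Us [simp]: "space U = f ` S" and Ua: "\<And>v n x. x \<in> S \<Longrightarrow> act U v n (f x) = f (Y v n x)"
    by (simp_all add: U_def gf)
  have S_add: "x \<in> S \<Longrightarrow> y \<in> S \<Longrightarrow> x + y \<in> S" and S_scale: "x \<in> S \<Longrightarrow> s c x \<in> S" for x y c
    using subspace_S by (auto simp: s.subspace_def)
  have U0: "act U v n 0 = 0" for v n using Ua[OF S0, of v n] by (simp add: f.zero)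
  have wU: "weak_module V t U"
    unfolding weak_module_def
  proof (intro conjI allI ballI)
    show "t.subspace (space U)"
      unfolding Us using subspace_S by (rule f.subspace_image)
  next
    fix v n w assume "w \<in> space U"
    then show "act U v n w \<in> space U" using Ua Y_closed by auto
  next
    fix v n show "linear_on t t (space U) (act U v n)"
      unfolding linear_on_def Us
      by (auto simp: Ua Y_closed Y_add Y_scale S_add S_scale simp flip: f.add f.scale)
  next
    fix n w assume "w \<in> space U"
    then obtain x where x: "x \<in> S" "w = f x" by auto
    show "linear_on (scale V) t UNIV (\<lambda>v. act U v n w)"
      unfolding linear_on_def by (simp add: x Ua Y_add_left Y_scale_left f.add f.scale)
  next
    fix v w assume "w \<in> space U"
    then obtain x where x: "x \<in> S" "w = f x" by auto
    obtain N where "\<forall>n\<ge>N. Y v n x = 0" using trunc[OF x(1), of v] by blast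
    then show "\<exists>N. \<forall>n\<ge>N. act U v n w = 0"
      using x by (intro exI[of _ N]) (simp add: Ua f.zero)
  next
    fix n w assume "w \<in> space U"
    then obtain x where x: "x \<in> S" "w = f x" by auto
    then show "act U (vacuum V) n w = (if n = -1 then w else 0)"
      by (simp add: Ua vac f.zero)
  next
    fix u v w assume "w \<in> space U"
    then obtain x where x: "x \<in> S" "w = f x" by auto
    have tr: "\<exists>N. \<forall>n\<ge>N. act U u n w = 0" for u
    proof -
      obtain N where "\<forall>n\<ge>N. Y u n x = 0" using trunc[OF x(1), of u] by blast
      then show ?thesis using x by (intro exI[of _ N]) (simp add: Ua f.zero)
    qed
    have tr': "\<exists>N::nat. \<forall>i\<ge>N. act U v (n + of_nat i) w = 0" for n
    proof -
      obtain N where "\<forall>i\<ge>N. Y v (n + int i) x = 0" using trunc_from[OF x(1), of v n] by blast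
      then show ?thesis using x by (intro exI[of _ N]) (simp add: Ua f.zero)
    qed
    have z: "act U 0 k w = 0" for k
      using x by (simp add: Ua Y_zero_left f.zero)
    show "jacobi_identity t (vertex V) (act U) (act U) (act U) u v w"
    proof (subst jacobi_identity_iff_eventually[where J = "act U" and ?Y1.0 = "vertex V" and ?Y2.0 = "act U" and ?Y3.0 = "act U" and v = u and a = v and b = w, OF t(1) U0 U0 z tr vertex_trunc tr'], intro allI)
      fix l m n
      show "\<forall>\<^sub>F K in sequentially. jac_eq t (vertex V) (act U) (act U) (act U) u v w l m n K"
        using jac_eventually[OF x(1), of u v l m n]
      proof eventually_elim
        case (elim K)
        have "f ((\<Sum>i<K. s ((-1) ^ i * (of_int l gchoose i)) (Y u (m + l - int i) (Y v (n + of_nat i) x)))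
     - (\<Sum>i<K. s ((-1) powi l * (-1) ^ i * (of_int l gchoose i))
          (Y v (n + of_int l - of_nat i) (Y u (m + int i) x))))
     = f (\<Sum>i<K. s (of_int m gchoose i) (Y (vertex V u (l + int i) v) (of_int m + n - of_nat i) x))"
          using elim unfolding jac_eq_def by simp
        then show ?case
          unfolding jac_eq_def x(2) using x(1)
          by (simp add: Ua Y_closed f.diff f.sum f.scale)
      qed
    qed
  qed
  then have ss: "L0_semisimple V t U" using A unfolding class_A_def by blast
  have eig: "L0_eigenspace V t U h = f ` L0_eigenspace V s W h" for h
  proof -
    have "virasoro V (act U) 0 (f x) = t h (f x) \<longleftrightarrow> virasoro V Y 0 x = s h x" if "x \<in> S" for x
    proof -
      have "virasoro V (act U) 0 (f x) = f (virasoro V Y 0 x)" "t h (f x) = f (s h x)"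
        using that by (simp_all add: virasoro_def Ua f.scale)
      moreover have "virasoro V Y 0 x \<in> S" "s h x \<in> S" using that by (simp_all add: virasoro_def Y_closed S_scale)
      ultimately show ?thesis using f(2) by (metis inj_onD)
    qed
    then show ?thesis unfolding L0_eigenspace_def by auto
  qed
  have "f ` S = t.span (\<Union>h. f ` L0_eigenspace V s W h)"
    using ss unfolding L0_semisimple_def is_direct_sum_def eig by simp
  also have "\<dots> = f ` s.span (\<Union>h. L0_eigenspace V s W h)"
    by (simp add: image_UN flip: f.span_image)
  finally have fS: "f ` S = f ` s.span (\<Union>h. L0_eigenspace V s W h)" .
  have "s.span (\<Union>h. L0_eigenspace V s W h) \<subseteq> S"
    by (rule s.span_minimal) (use L0_eigenspace_subset subspace_S in auto)
  with fS f(2) have "S = s.span (\<Union>h. L0_eigenspace V s W h)"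
    by (metis inj_on_image_eq_iff order_refl)
  then show ?thesis by (intro L0_semisimpleI) simp
qed

text \<open>The submodule generated by \<open>w\<close> has a countable spanning set, whatever the
  dimension of \<open>W\<close>; this makes the class condition available on duals.\<close>

lemma class_A_eigenvectors:
  assumes t: "vector_space t" "\<not> finite_dimensional t (UNIV :: 'x::ab_group_add set)"
    and A: "class_A V t" and w: "w \<in> S"
  shows "w \<in> s.span (\<Union>h. L0_eigenspace V s W h)"
proof -
  let ?W = "W\<lparr>space := cyclic w\<rparr>"
  interpret C: weak_mod V s ?W
    by unfold_locales (rule weak_module_submodule[OF wm cyclic_submodule[OF w]])
  obtain C where "countable C" "s.span C = cyclic w" using cyclic_countable[OF w] by blast
  then have "L0_semisimple V s ?W"
    by (intro C.class_A_semisimple[OF t A]) auto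
  then have "cyclic w = s.span (\<Union>h. L0_eigenspace V s ?W h)"
    unfolding L0_semisimple_def is_direct_sum_def by simp
  moreover have "L0_eigenspace V s ?W h \<subseteq> L0_eigenspace V s W h" for h
    using cyclic_sub[OF w] by (auto simp: L0_eigenspace_def)
  ultimately show ?thesis
    using cyclic_base[OF w] s.span_mono[of "\<Union>h. L0_eigenspace V s ?W h" "\<Union>h. L0_eigenspace V s W h"] by blast
qed

end

section \<open>\<open>C\<^sub>2\<close>-cofiniteness\<close>

locale graded_mod = weak_mod +
  assumes graded: "is_direct_sum s S UNIV (L0_eigenspace V s W)"
begin

abbreviation E :: "complex \<Rightarrow> 'b set" where "E \<equiv> L0_eigenspace V s W"

sublocale G: direct_sum s S E
  by unfold_locales (rule graded)

definition C2 :: "'b set" where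
  "C2 = s.span {Y v n w | v n w. n \<le> -2 \<and> w \<in> S}"

text \<open>Generators of \<open>C2\<close> sorted by weight. They show that \<open>C2\<close> is a
  graded subspace, so that a functional may be tested on it one weight at a time.\<close>

definition C2_hom :: "complex \<Rightarrow> 'b set" where
  "C2_hom h = {Y v n w | v n w p g. n \<le> -2 \<and> v \<in> weight_space V p \<and> w \<in> E g \<and> h = of_int p + g - of_int n - 1}"

lemma C2_base: "n \<le> -2 \<Longrightarrow> w \<in> S \<Longrightarrow> Y v n w \<in> C2"
  unfolding C2_def by (intro s.span_base) blast

lemma C2_hom_sub: "C2_hom h \<subseteq> E h"
  unfolding C2_hom_def using L0_eigenspace_shift by blast

lemma C2_eq: "C2 = s.span (\<Union>h. C2_hom h)"
proof
  show "C2 \<subseteq> s.span (\<Union>h. C2_hom h)"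
    unfolding C2_def
  proof (rule s.span_minimal, clarify)
    fix v n w assume n: "n \<le> (-2 :: int)" and "w \<in> S"
    then show "Y v n w \<in> s.span (\<Union>h. C2_hom h)"
    proof (induction v rule: homogeneous_induct)
      case (1 p v)
      from 1(3) show ?case
      proof (induction w rule: G.hom_induct)
        case (hom g w)
        then have "Y v n w \<in> C2_hom (of_int p + g - of_int n - 1)"
          unfolding C2_hom_def using 1 by blast
        then show ?case by (intro s.span_base) blast
      next
        case (add x y)
        then show ?case by (simp add: Y_add s.span_add)
      qed
    next
      case (2 u v)
      then show ?case by (simp add: Y_add_left s.span_add)
    qed
  qed simp
  show "s.span (\<Union>h. C2_hom h) \<subseteq> C2"
    unfolding C2_def
    by (rule s.span_mono) (use L0_eigenspace_subset in \<open>fastforce simp: C2_hom_def\<close>)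
qed

lemma C2_comp: "x \<in> C2 \<Longrightarrow> G.comp x h \<in> C2"
proof -
  assume "x \<in> C2"
  then have "G.comp x h \<in> s.span (C2_hom h)"
    unfolding C2_eq by (intro G.comp_span C2_hom_sub)
  moreover have "s.span (C2_hom h) \<subseteq> C2"
    unfolding C2_eq by (rule s.span_mono) blast
  ultimately show ?thesis by blast
qed

lemma subspace_C2: "s.subspace C2"
  by (simp add: C2_def)

text \<open>
  A functional that vanishes on \<open>C2\<close> generates a weak module, hence is a sum of
  \<open>L(0)\<close>-eigenvectors and involves only finitely many weights. Infinitely many weights outside
  \<open>C2\<close> would allow for a functional involving all of them.
\<close>

lemma cofinite_C2:
  assumes t: "vector_space t" "\<not> finite_dimensional t (UNIV :: 'x::ab_group_add set)"
    and A: "class_A V t"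
  shows "finite {h. \<not> E h \<subseteq> C2}"
proof (rule ccontr)
  assume inf: "infinite {h. \<not> E h \<subseteq> C2}"
  define H where "H = {h. \<not> E h \<subseteq> C2}"
  have "\<forall>h\<in>H. \<exists>w. w \<in> E h \<and> w \<notin> C2" by (auto simp: H_def)
  then obtain w where w: "\<And>h. h \<in> H \<Longrightarrow> w h \<in> E h" "\<And>h. h \<in> H \<Longrightarrow> w h \<notin> C2" by metis
  have "\<forall>h\<in>H. \<exists>f. Vector_Spaces.linear s (*) f \<and> (\<forall>y\<in>C2. f y = 0) \<and> f (w h) = 1"
    using functional_separating[OF s.vector_space_axioms subspace_C2] w by blast
  then obtain f where f: "\<And>h. h \<in> H \<Longrightarrow> Vector_Spaces.linear s (*) (f h)"
    "\<And>h y. h \<in> H \<Longrightarrow> y \<in> C2 \<Longrightarrow> f h y = 0" "\<And>h. h \<in> H \<Longrightarrow> f h (w h) = 1" by metis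
  \<comment> \<open>Weights where nothing has to be detected get the zero functional;
    \<open>G.ext\<close> then glues all weights, even infinitely many, into one functional.\<close>
  define g where "g h = (if h \<in> H then f h else (\<lambda>_. 0))" for h
  have glin: "linear_on s (*) (E h) (g h)" for h
  proof (cases "h \<in> H")
    case True
    then interpret Vector_Spaces.linear s "(*)" "f h" by (rule f)
    show ?thesis using True by (simp add: linear_on_def g_def add scale)
  qed (simp add: linear_on_def g_def)
  define \<alpha> where "\<alpha> x = (if x \<in> S then G.ext g x else 0)" for x
  have \<alpha>_lin: "linear_on s (*) S \<alpha>"
    using G.ext_linear[OF vector_space_complex glin] subspace_S
    unfolding linear_on_def \<alpha>_def by (auto simp: s.subspace_def)
  have \<alpha>_C2: "\<alpha> x = 0" if "x \<in> C2" for x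
  proof -
    have "g h (G.comp x h) = 0" for h
      using f(2)[OF _ C2_comp[OF that]] by (simp add: g_def)
    then show ?thesis by (simp add: \<alpha>_def G.ext_def)
  qed
  have \<alpha>_w: "\<alpha> (w h) = 1" if "h \<in> H" for h
  proof -
    have "w h \<in> S" using w(1)[OF that] L0_eigenspace_subset by blast
    then have "\<alpha> (w h) = g h (w h)"
      using G.ext_hom[OF vector_space_complex glin w(1)[OF that]] by (simp add: \<alpha>_def)
    then show ?thesis using f(3) that by (simp add: g_def)
  qed
  have tr: "\<exists>N. \<forall>n\<ge>N. \<forall>w\<in>S. Theta v n w \<in> C2" for v
  proof (induction v rule: homogeneous_induct)
    case (1 p v)
    then obtain B where B: "\<And>j. j \<ge> B \<Longrightarrow> D j v = 0" using D_nilpotent by meson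
    \<comment> \<open>From \<open>n = 2 * p\<close> on, every mode \<open>2 * p - n - 2 - j\<close>
      is at most -2.\<close>
    have "Theta v n w \<in> C2" if "n \<ge> 2 * p" "w \<in> S" for n w
    proof -
      have eq: "Theta v n w = s ((-1) powi p) (\<Sum>j<B. Y (D j v) (2 * p - n - 2 - int j) w)"
        by (rule Theta_bound[OF 1 that(2) B])
      show ?thesis
        unfolding eq by (intro s.subspace_scale s.subspace_sum subspace_C2 C2_base that) (use that in auto)
    qed
    then show ?case by blast
  next
    case (2 u v)
    then obtain N1 N2 where "\<forall>n\<ge>N1. \<forall>w\<in>S. Theta u n w \<in> C2" "\<forall>n\<ge>N2. \<forall>w\<in>S. Theta v n w \<in> C2" by blast
    then show ?case
      by (intro exI[of _ "max N1 N2"]) (auto simp: Theta_add_left intro: s.subspace_add[OF subspace_C2])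
  qed
  have \<alpha>: "\<alpha> \<in> dual_space"
    unfolding dual_space_def
  proof (intro CollectI conjI allI impI \<alpha>_lin)
    fix w assume "w \<notin> S" then show "\<alpha> w = 0" by (simp add: \<alpha>_def)
  next
    fix v
    obtain N where "\<forall>n\<ge>N. \<forall>w\<in>S. Theta v n w \<in> C2" using tr by blast
    then show "\<exists>N. \<forall>n\<ge>N. \<forall>w\<in>S. \<alpha> (Theta v n w) = 0" using \<alpha>_C2 by blast
  qed
  interpret dual: weak_mod V dscale dual
    by (intro weak_mod.intro weak_mod_axioms.intro voa_alg_axioms vector_space_dscale dual_weak_module)
  have "\<alpha> \<in> dual.s.span (\<Union>h. L0_eigenspace V dscale dual h)"
    by (rule dual.class_A_eigenvectors[OF t A]) (simp add: dual_def \<alpha>)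
  \<comment> \<open>A dual eigenvector of eigenvalue \<open>k\<close> vanishes on \<open>E h\<close>
    for \<open>h\<close> different from \<open>k\<close>, as \<open>L(0)\<close> acts by its
    transpose. So each eigenvector adds at most one weight to the support.\<close>
  then have "finite {h. \<exists>x\<in>E h. \<alpha> x \<noteq> 0}"
  proof (induction rule: dual.s.span_induct_alt)
    case (step c \<beta> \<gamma>)
    then obtain k where \<beta>: "\<beta> \<in> L0_eigenspace V dscale dual k" by blast
    have \<beta>d: "\<beta> \<in> dual_space" using \<beta> by (simp add: L0_eigenspace_def dual_def)
    have "\<beta> x = 0" if "x \<in> E h" "h \<noteq> k" for x h
    proof -
      have xS: "x \<in> S" and e: "virasoro V Y 0 x = s h x" using that by (auto simp: L0_eigenspace_def)
      have "k * \<beta> x = virasoro V (act dual) 0 \<beta> x" using \<beta> by (simp add: L0_eigenspace_def)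
      also have "\<dots> = h * \<beta> x" using dual_virasoro[OF \<beta>d xS] e dual_spaceD(2)[OF \<beta>d xS] by simp
      finally show ?thesis using that(2) by simp
    qed
    then have "{h. \<exists>x\<in>E h. ((\<lambda>x. c * \<beta> x) + \<gamma>) x \<noteq> 0} \<subseteq> insert k {h. \<exists>x\<in>E h. \<gamma> x \<noteq> 0}" by auto
    then show ?case using step(2) by (meson finite_insert finite_subset)
  qed simp
  moreover have "H \<subseteq> {h. \<exists>x\<in>E h. \<alpha> x \<noteq> 0}"
  proof
    fix h assume "h \<in> H"
    then have "w h \<in> E h" "\<alpha> (w h) \<noteq> 0" using w(1) \<alpha>_w by auto
    then show "h \<in> {h. \<exists>x\<in>E h. \<alpha> x \<noteq> 0}" by blast
  qed
  ultimately show False using inf finite_subset unfolding H_def by blast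
qed

text \<open>
  The coefficients \<open>Res\<^sub>x x\<^sup>l (1 + x)\<^sup>p Y(v, x) a\<close>, \<open>l \<le> -2\<close>, of Zhu's subspace \<open>O\<close>.
\<close>

definition relators :: "'b set" where
  "relators = {(\<Sum>i<K. s (of_int p gchoose i) (Y v (l + int i) a)) | K p v l a h.
     v \<in> weight_space V p \<and> l \<le> -2 \<and> a \<in> E h \<and> (\<forall>i\<ge>K. Y v (l + int i) a = 0)}"

text \<open>The term \<open>i = 0\<close> of a relator is a generator of \<open>C2\<close> and the
  terms \<open>i > 0\<close> have smaller weight, so weight spaces inside \<open>C2\<close> are
  reached by induction on the weight. The finitely many other weight spaces are put into
  \<open>X\<close> through finite spanning sets.\<close>

lemma spanning_mod_relators:
  assumes cof: "finite {h. \<not> E h \<subseteq> C2}" and fd: "\<And>h. finite_dimensional s (E h)"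
    and lb: "\<And>h. \<exists>N::int. \<forall>n<N. E (h + of_int n) = {0}"
  shows "\<exists>X. finite X \<and> X \<subseteq> S \<and> S = s.span (X \<union> relators)"
proof -
  have "\<forall>h. \<exists>B. finite B \<and> s.span B = E h"
    using fd unfolding finite_dimensional_def by blast
  then obtain B where B: "\<And>h. finite (B h)" "\<And>h. s.span (B h) = E h" by metis
  define X where "X = (\<Union>h\<in>{h. \<not> E h \<subseteq> C2}. B h)"
  define T where "T = s.span (X \<union> relators)"
  have T: "s.subspace T" by (simp add: T_def)
  have ET: "E h \<subseteq> T" for h
  proof -
    obtain N :: int where N: "\<forall>n<N. E (h + of_int n) = {0}" using lb by blast
    \<comment> \<open>Weights are bounded below only along each coset of the integers, so the
      induction climbs within the coset of \<open>h\<close>.\<close>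
    have low: "\<forall>n. n < N + int k \<longrightarrow> E (h + of_int n) \<subseteq> T" for k
    proof (induction k)
      case 0
      then show ?case using N T by (auto simp: s.subspace_0)
    next
      case (Suc k)
      show ?case
      proof (intro allI impI)
        fix n assume n: "n < N + int (Suc k)"
        have low: "E (h + of_int m) \<subseteq> T" if "m < n" for m using Suc that n by auto
        define g where "g = h + of_int n"
        show "E (h + of_int n) \<subseteq> T"
          unfolding g_def[symmetric]
        proof (cases "E g \<subseteq> C2")
          case False
          then have "B g \<subseteq> X \<union> relators" unfolding X_def by blast
          then show "E g \<subseteq> T" unfolding T_def B(2)[symmetric] by (rule s.span_mono)
        next
          case True
          have "C2_hom g \<subseteq> T"
          proof
            fix y assume "y \<in> C2_hom g"
            then obtain v m w p g' where y: "y = Y v m w" "m \<le> -2" "v \<in> weight_space V p" "w \<in> E g'"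
              "g = of_int p + g' - of_int m - 1" unfolding C2_hom_def by blast
            have wS: "w \<in> S" using y(4) L0_eigenspace_subset by blast
            obtain K where K: "\<forall>i\<ge>K. Y v (m + int i) w = 0" using trunc_from[OF wS] by blast
            let ?r = "\<lambda>i. s (of_int p gchoose i) (Y v (m + int i) w)"
            \<comment> \<open>The extra term guarantees that the index 0, with binomial coefficient
              1, occurs and can be split off.\<close>
            have "(\<Sum>i<Suc K. ?r i) \<in> relators"
              unfolding relators_def using y(2-4) K
              by (intro CollectI exI[of _ "Suc K"] exI[of _ p] exI[of _ v] exI[of _ m] exI[of _ w] exI[of _ g']) auto
            then have "(\<Sum>i<Suc K. ?r i) \<in> T" unfolding T_def by (intro s.span_base) simp
            moreover have "(\<Sum>i<Suc K. ?r i) = ?r 0 + (\<Sum>i<K. ?r (Suc i))"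
              by (rule sum.lessThan_Suc_shift)
            moreover have "(\<Sum>i<K. ?r (Suc i)) \<in> T"
            proof (intro s.subspace_sum s.subspace_scale T)
              fix i
              have "Y v (m + int (Suc i)) w \<in> E (of_int p + g' - of_int (m + int (Suc i)) - 1)"
                by (rule L0_eigenspace_shift[OF y(3,4)])
              also have "of_int p + g' - of_int (m + int (Suc i)) - 1 = h + of_int (n - int (Suc i))"
                using y(5) by (simp add: g_def algebra_simps)
              finally show "Y v (m + int (Suc i)) w \<in> T" using low[of "n - int (Suc i)"] by auto
            qed
            ultimately have "?r 0 \<in> T"
              using s.subspace_diff[OF T, of "?r 0 + (\<Sum>i<K. ?r (Suc i))" "\<Sum>i<K. ?r (Suc i)"]
              by (simp only: add_diff_cancel_right')
            then show "y \<in> T" by (simp add: y(1))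
          qed
          then have "s.span (C2_hom g) \<subseteq> T" using T by (rule s.span_minimal)
          moreover have "x \<in> s.span (C2_hom g)" if "x \<in> E g" for x
          proof (rule G.hom_span[OF C2_hom_sub _ that])
            show "x \<in> s.span (\<Union>h. C2_hom h)" using that True unfolding C2_eq by (rule set_rev_mp)
          qed
          ultimately show "E g \<subseteq> T" by blast
        qed
      qed
    qed
    have "E (h + of_int 0) \<subseteq> T"
      by (rule low[of "nat (1 - N)", rule_format]) simp
    then show ?thesis by simp
  qed
  have "s.span (\<Union>h. E h) \<subseteq> T" using ET T by (intro s.span_minimal UN_least)
  then have "S \<subseteq> T" unfolding G.M_span .
  have XS: "X \<subseteq> S"
  proof
    fix x assume "x \<in> X"
    then obtain h where "x \<in> B h" unfolding X_def by blast
    then have "x \<in> E h" unfolding B(2)[symmetric] by (rule s.span_base)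
    then show "x \<in> S" using L0_eigenspace_subset by blast
  qed
  have "relators \<subseteq> S"
  proof
    fix x assume "x \<in> relators"
    then obtain K p v l a h where x: "x = (\<Sum>i<K. s (of_int p gchoose i) (Y v (l + int i) a))" "a \<in> E h"
      unfolding relators_def by blast
    then have "a \<in> S" using L0_eigenspace_subset by blast
    then show "x \<in> S"
      unfolding x(1) by (intro s.subspace_sum[OF subspace_S] s.subspace_scale[OF subspace_S] Y_closed)
  qed
  then have "T \<subseteq> S" unfolding T_def using XS subspace_S by (intro s.span_minimal Un_least)
  moreover have "finite X" unfolding X_def using cof B(1) by simp
  ultimately show ?thesis using \<open>S \<subseteq> T\<close> XS unfolding T_def by blast
qed

end

section \<open>The adjoint module\<close>

context voa_alg
begin

lemma graded_adjoint: "graded_mod V (scale V) adjoint_module"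
proof -
  interpret A: weak_mod V "scale V" adjoint_module by (rule weak_mod_adjoint)
  have "(\<Union>p. weight_space V p) \<subseteq> (\<Union>h. L0_eigenspace V (scale V) adjoint_module h)"
    using L0_eigenspace_adjoint by blast
  then have "L0_semisimple V (scale V) adjoint_module"
    using V.span_mono by (intro A.L0_semisimpleI) (simp add: Vg.M_span)
  then show ?thesis
    by unfold_locales (simp add: L0_semisimple_def)
qed

text \<open>\<open>V\<close> is spanned by eigenvectors with integral eigenvalues, so homogeneous
  vectors of any other weight have no generator to come from. This reconciles the integer grading of
  \<open>V\<close> with the complex weights of modules.\<close>

lemma L0_eigenspace_adjoint_nonint:
  assumes "h \<notin> \<int>"
  shows "L0_eigenspace V (scale V) adjoint_module h = {0}"
proof -
  interpret A: graded_mod V "scale V" adjoint_module by (rule graded_adjoint)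
  define T where "T g = (if g \<in> \<int> then A.E g else {})" for g
  have "x = 0" if x: "x \<in> A.E h" for x
  proof -
    have "(\<Union>p. weight_space V p) \<subseteq> (\<Union>g. T g)"
      unfolding T_def L0_eigenspace_adjoint[symmetric] by force
    then have "x \<in> V.span (\<Union>g. T g)"
      using V.span_mono[of "\<Union>p. weight_space V p" "\<Union>g. T g"] Vg.M_span by blast
    moreover have "T i \<subseteq> A.E i" for i by (simp add: T_def)
    ultimately have "x \<in> V.span (T h)"
      using A.G.hom_span[of T x h] x by blast
    then show ?thesis using assms by (simp add: T_def)
  qed
  then show ?thesis using A.G.zero_mem by blast
qed

lemma ordinary_adjoint: "ordinary_module V (scale V) adjoint_module"
proof -
  interpret A: graded_mod V "scale V" adjoint_module by (rule graded_adjoint)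
  have "finite_dimensional (scale V) (A.E h)" for h
  proof (cases "h \<in> \<int>")
    case True
    then show ?thesis using weight_space_fd by (auto elim!: Ints_cases simp: L0_eigenspace_adjoint)
  next
    case False
    then show ?thesis unfolding finite_dimensional_def
      by (intro exI[of _ "{}"]) (simp add: L0_eigenspace_adjoint_nonint)
  qed
  moreover have "\<exists>N::int. \<forall>n<N. A.E (h + of_int n) = {0}" for h
  proof (cases "h \<in> \<int>")
    case True
    then obtain k where k: "h = of_int k" by (auto elim: Ints_cases)
    obtain N where N: "\<forall>n<N. weight_space V n = {0}" using weights_bounded_below by blast
    have "A.E (h + of_int n) = {0}" if "n < N - k" for n
      using N that by (simp add: k L0_eigenspace_adjoint flip: of_int_add)
    then show ?thesis by blast
  next
    case False
    have "h + of_int n \<notin> \<int>" for n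
      using False Ints_diff[of "h + of_int n" "of_int n"] by auto
    then show ?thesis by (intro exI[of _ 0]) (simp add: L0_eigenspace_adjoint_nonint)
  qed
  ultimately show ?thesis
    unfolding ordinary_module_def using weak_module_adjoint A.graded by blast
qed

end

text \<open>The universe of \<open>t\<close> need not be the one containing \<open>W\<close>, so the
  same statement serves for \<open>V\<close> itself and for \<open>W1\<close>.\<close>

lemma (in weak_mod) ordinary_spanning:
  assumes t: "vector_space t" "\<not> finite_dimensional t (UNIV :: 'x::ab_group_add set)"
    and A: "class_A V t" and o: "ordinary_module V s W"
  shows "\<exists>X. finite X \<and> X \<subseteq> S \<and> S = s.span (X \<union> graded_mod.relators V s W)"
proof -
  interpret G: graded_mod V s W
    by unfold_locales (use o in \<open>simp add: ordinary_module_def\<close>)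
  show ?thesis
    by (rule G.spanning_mod_relators[OF G.cofinite_C2[OF t A]]) (use o in \<open>auto simp: ordinary_module_def\<close>)
qed

section \<open>Finite products of weak modules\<close>

definition single :: "'i \<Rightarrow> 'u \<Rightarrow> 'i \<Rightarrow> 'u::zero" where
  "single i x = (\<lambda>j. if j = i then x else 0)"

lemma single_apply [simp]: "single i x i = x" "j \<noteq> i \<Longrightarrow> single i x j = 0"
  by (simp_all add: single_def)

definition product_act :: "('i \<Rightarrow> ('v, 'u::zero) vmod) \<Rightarrow> 'i set \<Rightarrow> 'v \<Rightarrow> int \<Rightarrow> ('i \<Rightarrow> 'u) \<Rightarrow> 'i \<Rightarrow> 'u" where
  "product_act W I v n f = (\<lambda>i. if i \<in> I then act (W i) v n (f i) else 0)"

definition product_module :: "('i \<Rightarrow> ('v, 'u::zero) vmod) \<Rightarrow> 'i set \<Rightarrow> ('v, 'i \<Rightarrow> 'u) vmod" where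
  "product_module W I = \<lparr>space = {f. (\<forall>i\<in>I. f i \<in> space (W i)) \<and> (\<forall>i. i \<notin> I \<longrightarrow> f i = 0)}, act = product_act W I\<rparr>"

locale mod_family = voa_alg V + s: vector_space s
  for V :: "'v::ab_group_add voa" and s :: "complex \<Rightarrow> 'u::ab_group_add \<Rightarrow> 'u" +
  fixes W :: "'i \<Rightarrow> ('v, 'u) vmod" and I :: "'i set"
  assumes fin: "finite I" and wmI: "\<And>i. i \<in> I \<Longrightarrow> weak_module V s (W i)"
begin

abbreviation pscale :: "complex \<Rightarrow> ('i \<Rightarrow> 'u) \<Rightarrow> 'i \<Rightarrow> 'u" where
  "pscale \<equiv> \<lambda>c f i. s c (f i)"

lemma weak_mod_I: "i \<in> I \<Longrightarrow> weak_mod V s (W i)"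
  by unfold_locales (rule wmI)

text \<open>Finitely many factors have a largest bound. Truncation and the eventual Jacobi identity
  thereby become uniform over the product.\<close>

lemma common_bound:
  assumes "\<And>i. i \<in> I \<Longrightarrow> \<exists>N. \<forall>n\<ge>N. P i n" "\<And>i n. i \<notin> I \<Longrightarrow> P i n"
  shows "\<exists>N::'b::linorder. \<forall>n\<ge>N. \<forall>i. P i n"
proof (cases "I = {}")
  case False
  from assms(1) obtain N where N: "\<And>i n. i \<in> I \<Longrightarrow> n \<ge> N i \<Longrightarrow> P i n" by metis
  have "P i n" if "n \<ge> Max (N ` I)" for n i
  proof (cases "i \<in> I")
    case True
    then have "N i \<le> Max (N ` I)" using fin by (intro Max_ge) auto
    then show ?thesis using N[OF True] that by (meson order_trans)
  qed (use assms in auto)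
  then show ?thesis by blast
qed (use assms in auto)

lemma product_module_weak_module: "weak_module V pscale (product_module W I)"
proof -
  interpret p: vector_space pscale by (rule vector_space_pointwise[OF s.vector_space_axioms])
  let ?P = "{f. (\<forall>i\<in>I. f i \<in> space (W i)) \<and> (\<forall>i. i \<notin> I \<longrightarrow> f i = 0)}"
  note d = weak_mod.Y_add weak_mod.Y_scale weak_mod.Y_add_left weak_mod.Y_scale_left
  show ?thesis
    unfolding weak_module_def product_module_def vmod.simps
  proof (intro conjI allI ballI)
    show "p.subspace ?P"
      using weak_mod.subspace_S[OF weak_mod_I] unfolding p.subspace_def s.subspace_def by auto
  next
    fix v n f assume "f \<in> ?P"
    then show "product_act W I v n f \<in> ?P"
      using weak_mod.Y_closed[OF weak_mod_I] by (auto simp: product_act_def)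
  next
    fix v n
    show "linear_on pscale pscale ?P (product_act W I v n)"
      by (auto simp: linear_on_def product_act_def fun_eq_iff d[OF weak_mod_I])
  next
    fix n f assume "f \<in> ?P"
    then show "linear_on (scale V) pscale UNIV (\<lambda>v. product_act W I v n f)"
      by (auto simp: linear_on_def product_act_def fun_eq_iff d[OF weak_mod_I])
  next
    fix v f assume f: "f \<in> ?P"
    have "\<exists>N. \<forall>n\<ge>N. \<forall>i. product_act W I v n f i = 0"
      by (rule common_bound) (use f weak_mod.trunc[OF weak_mod_I] in \<open>auto simp: product_act_def\<close>)
    then show "\<exists>N. \<forall>n\<ge>N. product_act W I v n f = 0" by (simp add: fun_eq_iff)
  next
    fix n f assume "f \<in> ?P"
    then show "product_act W I (vacuum V) n f = (if n = -1 then f else 0)"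
      by (auto simp: product_act_def fun_eq_iff weak_mod.vac[OF weak_mod_I])
  next
    fix u v f assume f: "f \<in> ?P"
    have tr: "\<exists>N. \<forall>n\<ge>N. product_act W I u n f = 0" for u
    proof -
      have "\<exists>N. \<forall>n\<ge>N. \<forall>i. product_act W I u n f i = 0"
        by (rule common_bound) (use f weak_mod.trunc[OF weak_mod_I] in \<open>auto simp: product_act_def\<close>)
      then show ?thesis by (simp add: fun_eq_iff)
    qed
    have tr': "\<exists>N::nat. \<forall>i\<ge>N. product_act W I v (n + of_nat i) f = 0" for n
    proof -
      obtain N where N: "\<forall>n\<ge>N. product_act W I v n f = 0" using tr by blast
      show ?thesis by (rule exI[of _ "nat (N - n)"]) (use N in auto)
    qed
    have z1: "product_act W I v n 0 = 0" for v n
      by (auto simp: product_act_def fun_eq_iff weak_mod.Y_zero[OF weak_mod_I])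
    have z2: "product_act W I 0 n f = 0" for n
      using f by (auto simp: product_act_def fun_eq_iff weak_mod.Y_zero_left[OF weak_mod_I])
    show "jacobi_identity pscale (vertex V) (product_act W I) (product_act W I) (product_act W I) u v f"
    proof (subst jacobi_identity_iff_eventually[where J = "product_act W I" and ?Y1.0 = "vertex V" and ?Y2.0 = "product_act W I"
          and ?Y3.0 = "product_act W I" and v = u and a = v and b = f, OF p.vector_space_axioms z1 z1 z2 tr vertex_trunc tr'], intro allI)
      fix l m n
      let ?J = "\<lambda>i K. i \<in> I \<longrightarrow> jac_eq s (vertex V) (act (W i)) (act (W i)) (act (W i)) u v (f i) l m n K"
      have "\<exists>N. \<forall>K\<ge>N. \<forall>i. ?J i K"
        by (rule common_bound)
          (use f weak_mod.jac_eventually[OF weak_mod_I] in \<open>auto simp: eventually_sequentially\<close>)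
      then obtain N where N: "\<And>K i. K \<ge> N \<Longrightarrow> ?J i K" by blast
      have "jac_eq pscale (vertex V) (product_act W I) (product_act W I) (product_act W I) u v f l m n K" if "K \<ge> N" for K
      proof -
        have "(\<Sum>i<K. s ((-1) ^ i * (of_int l gchoose i)) (product_act W I u (m + l - int i) (product_act W I v (n + of_nat i) f) j))
           - (\<Sum>i<K. s ((-1) powi l * (-1) ^ i * (of_int l gchoose i))
                (product_act W I v (n + of_int l - of_nat i) (product_act W I u (m + int i) f) j))
           = (\<Sum>i<K. s (of_int m gchoose i) (product_act W I (vertex V u (l + int i) v) (of_int m + n - of_nat i) f j))" for j
        proof (cases "j \<in> I")
          case True
          then show ?thesis using N[OF that, of j] by (simp add: jac_eq_def product_act_def)
        qed (simp add: product_act_def)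
        then show ?thesis unfolding jac_eq_def by (auto simp: fun_eq_iff sum_fun_apply)
      qed
      then show "\<forall>\<^sub>F K in sequentially. jac_eq pscale (vertex V) (product_act W I) (product_act W I) (product_act W I) u v f l m n K"
        by (rule eventually_sequentiallyI)
    qed
  qed
qed

end

definition componentwise_submodule ::
  "(complex \<Rightarrow> 'u::ab_group_add \<Rightarrow> 'u) \<Rightarrow> ('i \<Rightarrow> ('v, 'u) vmod) \<Rightarrow> 'i set \<Rightarrow> ('i \<Rightarrow> 'u) set \<Rightarrow> bool" where
  "componentwise_submodule s W I N \<longleftrightarrow> submodule (\<lambda>c f i. s c (f i)) (product_module W I) N"

lemma componentwise_submoduleD:
  assumes "vector_space s" "componentwise_submodule s W I N"
  shows "f \<in> N \<Longrightarrow> i \<in> I \<Longrightarrow> f i \<in> space (W i)" "f \<in> N \<Longrightarrow> i \<notin> I \<Longrightarrow> f i = 0"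
    "f \<in> N \<Longrightarrow> g \<in> N \<Longrightarrow> f + g \<in> N" "f \<in> N \<Longrightarrow> (\<lambda>i. s c (f i)) \<in> N" "0 \<in> N"
    "f \<in> N \<Longrightarrow> product_act W I v n f \<in> N" "f \<in> N \<Longrightarrow> g \<in> N \<Longrightarrow> f - g \<in> N"
    "(\<And>i. i \<in> A \<Longrightarrow> F i \<in> N) \<Longrightarrow> sum F A \<in> N"
proof -
  interpret p: vector_space "\<lambda>c f i. s c (f i)" by (rule vector_space_pointwise) fact
  have sub: "p.subspace N" and N: "N \<subseteq> space (product_module W I)" "\<And>f. f \<in> N \<Longrightarrow> act (product_module W I) v n f \<in> N"
    using assms(2) unfolding componentwise_submodule_def submodule_def by auto
  show "f \<in> N \<Longrightarrow> i \<in> I \<Longrightarrow> f i \<in> space (W i)" "f \<in> N \<Longrightarrow> i \<notin> I \<Longrightarrow> f i = 0" "f \<in> N \<Longrightarrow> product_act W I v n f \<in> N"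
    using N by (auto simp: product_module_def)
  show "f \<in> N \<Longrightarrow> g \<in> N \<Longrightarrow> f + g \<in> N" by (rule p.subspace_add[OF sub])
  show "f \<in> N \<Longrightarrow> (\<lambda>i. s c (f i)) \<in> N" by (rule p.subspace_scale[OF sub])
  show "0 \<in> N" by (rule p.subspace_0[OF sub])
  show "f \<in> N \<Longrightarrow> g \<in> N \<Longrightarrow> f - g \<in> N" by (rule p.subspace_diff[OF sub])
  show "(\<And>i. i \<in> A \<Longrightarrow> F i \<in> N) \<Longrightarrow> sum F A \<in> N" by (rule p.subspace_sum[OF sub])
qed

text \<open>Schur's lemma: the kernel and the image are submodules, and a nonzero value forces the
  kernel to be zero and the image to be everything.\<close>

lemma irreducible_homomorphism:
  assumes s: "vector_space s"
    and wm: "weak_mod V s W" "weak_mod V s W'" and irr: "irreducible s W" "irreducible s W'"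
    and h: "linear_on s s (space W) h" "\<And>x. x \<in> space W \<Longrightarrow> h x \<in> space W'"
      "\<And>v n x. x \<in> space W \<Longrightarrow> h (act W v n x) = act W' v n (h x)"
    and nz: "x0 \<in> space W" "h x0 \<noteq> 0"
  shows "equivalent_modules s W W'"
proof -
  interpret W: weak_mod V s W by fact
  interpret W': weak_mod V s W' by fact
  have add: "x \<in> space W \<Longrightarrow> y \<in> space W \<Longrightarrow> h (x + y) = h x + h y"
    and scl: "x \<in> space W \<Longrightarrow> h (s c x) = s c (h x)" for x y c
    using h(1) by (auto simp: linear_on_def)
  have S: "x \<in> space W \<Longrightarrow> y \<in> space W \<Longrightarrow> x + y \<in> space W" "x \<in> space W \<Longrightarrow> s c x \<in> space W" for x y c
    using W.subspace_S by (auto simp: W.s.subspace_def)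
  have h0: "h 0 = 0" using scl[OF W.S0, of 0] by simp
  let ?K = "{x \<in> space W. h x = 0}"
  have "submodule s W ?K"
    unfolding submodule_def W.s.subspace_def
    by (auto simp: add scl S h0 W.S0 h(3) W.Y_closed)
  then have K: "?K = {0}" using irr(1) nz unfolding irreducible_def by blast
  have inj: "inj_on h (space W)"
  proof (rule inj_onI)
    fix x y assume xy: "x \<in> space W" "y \<in> space W" "h x = h y"
    have "h (x + s (-1) y) = h x + s (-1) (h y)" by (simp only: add scl S xy)
    then have "h (x + s (-1) y) = 0" using xy(3) by simp
    then have "x + s (-1) y \<in> ?K" using xy S by blast
    then show "x = y" using K by simp
  qed
  have "submodule s W' (h ` space W)"
    unfolding submodule_def W.s.subspace_def
  proof (intro conjI allI ballI)
    show "h ` space W \<subseteq> space W'" using h(2) by blast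
    show "0 \<in> h ` space W" using h0 W.S0 by (metis imageI)
  next
    fix x y assume "x \<in> h ` space W" "y \<in> h ` space W"
    then obtain x' y' where "x' \<in> space W" "x = h x'" "y' \<in> space W" "y = h y'" by blast
    then show "x + y \<in> h ` space W" using S(1) add[of x' y'] by (intro image_eqI[of _ _ "x' + y'"]) auto
  next
    fix c x assume "x \<in> h ` space W"
    then obtain x' where "x' \<in> space W" "x = h x'" by blast
    then show "s c x \<in> h ` space W" using S(2) scl[of x' c] by (intro image_eqI[of _ _ "s c x'"]) auto
  next
    fix v n x assume "x \<in> h ` space W"
    then obtain x' where "x' \<in> space W" "x = h x'" by blast
    then show "act W' v n x \<in> h ` space W"
      using W.Y_closed h(3)[of x' v n] by (intro image_eqI[of _ _ "act W v n x'"]) auto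
  qed
  moreover have "h ` space W \<noteq> {0}" using nz by blast
  ultimately have "h ` space W = space W'" using irr(2) unfolding irreducible_def by blast
  then show ?thesis
    unfolding equivalent_modules_def bij_betw_def using h(1,3) inj by blast
qed

text \<open>
  If the submodule meets the last factor trivially, it is the graph of a homomorphism from the
  product of the other factors, which is nonzero on one of them.
\<close>

lemma (in voa_alg) subdirect_product_full:
  fixes s :: "complex \<Rightarrow> 'u::ab_group_add \<Rightarrow> 'u" and W :: "'i \<Rightarrow> ('v, 'u) vmod"
  assumes s: "vector_space s" and "finite I"
    and "\<And>i. i \<in> I \<Longrightarrow> weak_module V s (W i)" "\<And>i. i \<in> I \<Longrightarrow> irreducible s (W i)"
    and "\<And>i j. i \<in> I \<Longrightarrow> j \<in> I \<Longrightarrow> i \<noteq> j \<Longrightarrow> \<not> equivalent_modules s (W i) (W j)"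
    and "componentwise_submodule s W I N" "\<And>i. i \<in> I \<Longrightarrow> \<exists>f\<in>N. f i \<noteq> 0"
    and "i \<in> I" "x \<in> space (W i)"
  shows "single i x \<in> N"
  using assms(2-)
proof (induction I arbitrary: N i x rule: finite_induct)
  case empty
  then show ?case by simp
next
  case (insert k I)
  interpret s: vector_space s by fact
  interpret p: vector_space "\<lambda>c f i. s c (f i)" by (rule vector_space_pointwise) fact
  note N = componentwise_submoduleD[OF s insert.prems(4)]
  have wm: "weak_mod V s (W j)" if "j \<in> insert k I" for j
    using insert.prems(1)[OF that] by unfold_locales
  \<comment> \<open>The projection of \<open>N\<close> to the factors in \<open>I\<close>, to which
    the induction hypothesis applies.\<close>
  define N' where "N' = {f(k := 0) | f. f \<in> N}"
  have act0: "act (W j) v n 0 = 0" if "j \<in> insert k I" for j v n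
    using weak_mod.Y_zero[OF wm[OF that]] .
  have cut: "product_act W I v n (f(k := 0)) = (product_act W (insert k I) v n f)(k := 0)" for v n f
    using insert.hyps(2) by (auto simp: product_act_def fun_eq_iff)
  have "componentwise_submodule s W I N'"
    unfolding componentwise_submodule_def submodule_def
  proof (intro conjI allI ballI)
    show "N' \<subseteq> space (product_module W I)"
      using N(1,2) insert.hyps(2) by (auto simp: N'_def product_module_def)
    show "p.subspace N'"
      unfolding p.subspace_def
    proof (intro conjI allI ballI)
      have "0 = (0::'i \<Rightarrow> 'u)(k := 0)" by (auto simp: fun_eq_iff)
      then show "0 \<in> N'" unfolding N'_def using N(5) by blast
    next
      fix f g assume "f \<in> N'" "g \<in> N'"
      then obtain f' g' where "f' \<in> N" "f = f'(k := 0)" "g' \<in> N" "g = g'(k := 0)" by (auto simp: N'_def)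
      moreover have "f'(k := 0) + g'(k := 0) = (f' + g')(k := 0)" by (auto simp: fun_eq_iff)
      ultimately show "f + g \<in> N'" unfolding N'_def using N(3) by blast
    next
      fix c f assume "f \<in> N'"
      then obtain f' where "f' \<in> N" "f = f'(k := 0)" by (auto simp: N'_def)
      moreover have "(\<lambda>i. s c ((f'(k := 0)) i)) = (\<lambda>i. s c (f' i))(k := 0)" by (auto simp: fun_eq_iff)
      ultimately show "(\<lambda>i. s c (f i)) \<in> N'" unfolding N'_def using N(4)[of f' c] by blast
    qed
  next
    fix v n f assume "f \<in> N'"
    then obtain f' where "f' \<in> N" "f = f'(k := 0)" by (auto simp: N'_def)
    then show "act (product_module W I) v n f \<in> N'"
      using N(6)[of f' v n] by (auto simp: product_module_def cut N'_def)
  qed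
  moreover have "\<exists>f\<in>N'. f i \<noteq> 0" if i: "i \<in> I" for i
  proof -
    obtain f where "f \<in> N" "f i \<noteq> 0" using insert.prems(5)[of i] i by blast
    moreover have "i \<noteq> k" using i insert.hyps(2) by blast
    ultimately show ?thesis unfolding N'_def by (intro bexI[of _ "f(k := 0)"]) auto
  qed
  ultimately have *: "single i x \<in> N'" if "i \<in> I" "x \<in> space (W i)" for i x
    using that insert.prems(1-3) by (intro insert.IH) auto
  then have lift: "\<exists>f\<in>N. f(k := 0) = single i x" if "i \<in> I" "x \<in> space (W i)" for i x
  proof -
    have "single i x \<in> N'" using that by (rule *)
    then obtain f where "single i x = f(k := 0)" "f \<in> N" unfolding N'_def by blast
    then show ?thesis by (intro bexI[of _ f]) simp_all
  qed
  \<comment> \<open>The intersection of \<open>N\<close> with the last factor is zero or all of it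
    by irreducibility.\<close>
  define Nk where "Nk = {x \<in> space (W k). single k x \<in> N}"
  have Nk0: "f = single k (f k)" if "f(k := 0) = 0" for f :: "'i \<Rightarrow> 'u"
    using that by (auto simp: fun_eq_iff single_def split: if_splits)
  have product_act_single: "product_act W (insert k I) v n (single k x) = single k (act (W k) v n x)" for v n x
    using act0 by (auto simp: product_act_def single_def fun_eq_iff)
  have "submodule s (W k) Nk"
  proof -
    interpret k: weak_mod V s "W k" by (rule wm) simp
    have e: "single k (0::'u) = 0" "single k (x + y) = single k x + single k y"
      "single k (s c x) = (\<lambda>i. s c (single k x i))" for x y c
      by (auto simp: single_def fun_eq_iff)
    show ?thesis
      unfolding submodule_def s.subspace_def Nk_def
      using k.subspace_S N(3,4,5,6)
      by (auto simp: e s.subspace_def k.Y_closed simp flip: product_act_single)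
  qed
  then consider "Nk = {0}" | "Nk = space (W k)"
    using insert.prems(2)[of k] unfolding irreducible_def by blast
  then show ?case
  proof cases
    case 2
    have k: "single k y \<in> N" if "y \<in> space (W k)" for y using 2 that by (auto simp: Nk_def)
    show ?thesis
    proof (cases "i = k")
      case False
      \<comment> \<open>The last factor lies in \<open>N\<close>, so the last coordinate of a lift
        can be subtracted.\<close>
      then obtain f where f: "f \<in> N" "f(k := 0) = single i x" using lift insert.prems(6,7) by blast
      have "single i x = f - single k (f k)"
      proof
        fix j show "single i x j = (f - single k (f k)) j"
          using fun_cong[OF f(2), of j] by (cases "j = k") simp_all
      qed
      then show ?thesis using N(7)[OF f(1) k[OF N(1)[OF f(1)]]] by (simp only: insertI1)
    qed (use k insert.prems in auto)
  next
    case 1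
    have zero: "f k = 0" if f: "f \<in> N" "f(k := 0) = 0" for f
    proof -
      have "single k (f k) \<in> N" unfolding Nk0[OF f(2), symmetric] by (rule f(1))
      then have "f k \<in> Nk" using N(1)[OF f(1), of k] by (simp add: Nk_def)
      then show ?thesis using 1 by simp
    qed
    have uniq: "f k = g k" if "f \<in> N" "g \<in> N" "f(k := 0) = g(k := 0)" for f g
    proof -
      have "(f - g)(k := 0) = 0"
      proof
        fix j show "((f - g)(k := 0)) j = 0 j"
          using fun_cong[OF that(3), of j] by (cases "j = k") simp_all
      qed
      from zero[OF N(7)[OF that(1,2)] this] show ?thesis by simp
    qed
    \<comment> \<open>By \<open>uniq\<close> the last coordinate of a lift is determined by the
      others. Hence \<open>l i x k\<close> depends linearly on \<open>x\<close> and commutes with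
      the action.\<close>
    define l where "l i x = (SOME f. f \<in> N \<and> f(k := 0) = single i x)" for i x
    have l: "l i x \<in> N" "(l i x)(k := 0) = single i x" if "i \<in> I" "x \<in> space (W i)" for i x
      using someI_ex[of "\<lambda>f. f \<in> N \<and> f(k := 0) = single i x"] lift[OF that] unfolding l_def by blast+
    obtain f where f: "f \<in> N" "f k \<noteq> 0" using insert.prems(5)[of k] by blast
    have fI: "f i \<in> space (W i)" if "i \<in> I" for i using N(1)[OF f(1), of i] that by simp
    \<comment> \<open>\<open>f\<close> and the sum of the lifts of its coordinates agree off
      \<open>k\<close>, hence also at \<open>k\<close>. So some single lift has a nonzero last
      coordinate and gives the forbidden equivalence.\<close>
    let ?g = "\<Sum>i\<in>I. l i (f i)"
    have gN: "?g \<in> N" by (intro N(8) l fI)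
    have "f(k := 0) = ?g(k := 0)"
    proof
      fix j
      have "?g j = f j" if "j \<noteq> k"
      proof -
        have "?g j = (\<Sum>i\<in>I. ((l i (f i))(k := 0)) j)" using that by (simp add: sum_fun_apply)
        also have "\<dots> = (\<Sum>i\<in>I. single i (f i) j)" using l(2) fI by simp
        also have "\<dots> = (\<Sum>i\<in>I. if i = j then f j else 0)" by (intro sum.cong) (auto simp: single_def)
        also have "\<dots> = f j" using insert.hyps(1) N(2)[OF f(1), of j] that by (simp add: sum.delta)
        finally show ?thesis .
      qed
      then show "(f(k := 0)) j = (?g(k := 0)) j" by simp
    qed
    then have "f k = ?g k" by (rule uniq[OF f(1) gN])
    then have "(\<Sum>i\<in>I. l i (f i) k) \<noteq> 0" using f(2) by (simp add: sum_fun_apply)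
    then obtain i where i: "i \<in> I" "l i (f i) k \<noteq> 0" by (meson sum.not_neutral_contains_not_neutral)
    have ik: "i \<noteq> k" using i insert.hyps(2) by blast
    interpret i: weak_mod V s "W i" by (rule wm) (use i in simp)
    have lin: "linear_on s s (space (W i)) (\<lambda>x. l i x k)"
      unfolding linear_on_def
    proof (intro conjI allI ballI)
        fix x y assume xy: "x \<in> space (W i)" "y \<in> space (W i)"
        have "x + y \<in> space (W i)" using xy s.subspace_add[OF i.subspace_S] by blast
        note lxy = l[OF i(1) this] l[OF i(1) xy(1)] l[OF i(1) xy(2)]
        have "l i (x + y) k = (l i x + l i y) k"
        proof (rule uniq)
          have "(l i x + l i y)(k := 0) = (l i x)(k := 0) + (l i y)(k := 0)" by (auto simp: fun_eq_iff)
          then show "(l i (x + y))(k := 0) = (l i x + l i y)(k := 0)"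
            unfolding lxy(2,4,6) by (auto simp: single_def fun_eq_iff)
        qed (fact lxy(1), rule N(3)[OF lxy(3,5)])
        then show "l i (x + y) k = l i x k + l i y k" by simp
      next
        fix c x assume x: "x \<in> space (W i)"
        have "s c x \<in> space (W i)" using x s.subspace_scale[OF i.subspace_S] by blast
        note lx = l[OF i(1) this] l[OF i(1) x]
        show "l i (s c x) k = s c (l i x k)"
        proof (rule uniq)
          have "(\<lambda>j. s c (l i x j))(k := 0) = (\<lambda>j. s c (((l i x)(k := 0)) j))" by (auto simp: fun_eq_iff)
          then show "(l i (s c x))(k := 0) = (\<lambda>j. s c (l i x j))(k := 0)"
            unfolding lx(2,4) by (auto simp: single_def fun_eq_iff)
        qed (fact lx(1), rule N(4)[OF lx(3)])
    qed
    have comm: "l i (act (W i) v n x) k = act (W k) v n (l i x k)" if x: "x \<in> space (W i)" for v n x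
    proof -
      note lx = l[OF i(1) i.Y_closed[OF x, of v n]] l[OF i(1) x]
      have "l i (act (W i) v n x) k = product_act W (insert k I) v n (l i x) k"
      proof (rule uniq[of "l i (act (W i) v n x)" "product_act W (insert k I) v n (l i x)"])
        have "(product_act W (insert k I) v n (l i x))(k := 0) = product_act W I v n (single i x)"
          unfolding lx(4)[symmetric] cut ..
        also have "\<dots> = single i (act (W i) v n x)"
          using act0 i by (auto simp: product_act_def single_def fun_eq_iff)
        finally show "(l i (act (W i) v n x))(k := 0) = (product_act W (insert k I) v n (l i x))(k := 0)"
          unfolding lx(2) by simp
      qed (fact lx(1), rule N(6)[OF lx(3)])
      then show "l i (act (W i) v n x) k = act (W k) v n (l i x k)" by (simp add: product_act_def)
    qed
    have ki: "k \<in> insert k I" "i \<in> insert k I" using i by auto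
    have mem: "l i x k \<in> space (W k)" if "x \<in> space (W i)" for x
      by (rule N(1)[OF l(1)[OF i(1) that] ki(1)])
    have "equivalent_modules s (W i) (W k)"
      by (rule irreducible_homomorphism[OF s wm[OF ki(2)] wm[OF ki(1)] insert.prems(2)[OF ki(2)]
            insert.prems(2)[OF ki(1)] lin mem comm fI[OF i(1)] i(2)])
    then show ?thesis using insert.prems(3)[of i k] i ik by blast
  qed
qed

section \<open>Irreducible \<open>\<nat>\<close>-gradable weak modules\<close>

definition lowest_grading ::
  "'v::ab_group_add voa \<Rightarrow> (complex \<Rightarrow> 'u::ab_group_add \<Rightarrow> 'u) \<Rightarrow> ('v, 'u) vmod
    \<Rightarrow> (nat \<Rightarrow> 'u set) \<Rightarrow> nat \<Rightarrow> 'u \<Rightarrow> bool" where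
  "lowest_grading V s W G d w \<longleftrightarrow>
    is_direct_sum s (space W) UNIV G \<and> w \<in> G d \<and> w \<noteq> 0 \<and> (\<forall>e<d. G e = {0}) \<and>
    (\<forall>k. \<forall>v\<in>weight_space V k. \<forall>m n. \<forall>w\<in>G n.
       act W v m w \<in> (let d = k + int n - m - 1 in if d < 0 then {0} else G (nat d)))"

lemma lowest_grading_exists:
  assumes s: "vector_space s" and W: "N_gradable_weak_module V s W" "irreducible s W"
  shows "\<exists>G d w. lowest_grading V s W G d w"
proof -
  obtain G :: "nat \<Rightarrow> _" where G: "is_direct_sum s (space W) UNIV G"
    "\<forall>k. \<forall>v\<in>weight_space V k. \<forall>m n. \<forall>w\<in>G n.
           act W v m w \<in> (let d = k + int n - m - 1 in if d < 0 then {0} else G (nat d))"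
    using W(1) unfolding N_gradable_weak_module_def by blast
  interpret G: direct_sum s "space W" G
    using s G(1) by (simp add: direct_sum_def direct_sum_axioms_def)
  have "\<exists>d. G d \<noteq> {0}"
  proof (rule ccontr)
    assume "\<not> (\<exists>d. G d \<noteq> {0})"
    then have "(\<Union>d. G d) = {0}" by auto
    then have "space W = {0}" using G.M_span G.span_insert_0[of "{}"] by simp
    then show False using W(2) unfolding irreducible_def by blast
  qed
  then obtain d where d: "G d \<noteq> {0}" "\<And>e. e < d \<Longrightarrow> G e = {0}"
    using exists_least_iff[of "\<lambda>d. G d \<noteq> {0}"] by blast
  moreover obtain w where "w \<in> G d" "w \<noteq> 0" using d(1) G.zero_mem[of d] by blast
  ultimately show ?thesis using G unfolding lowest_grading_def by blast
qed

section \<open>Counting inequivalent irreducible modules by zero modes\<close>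

context voa_alg
begin

text \<open>The vectors \<open>single i (w0 i)\<close> are independent and all arise from one vector
  \<open>w\<close> by zero modes. The zero modes on \<open>w\<close> factor through \<open>V\<close>
  modulo the relators, so their range is spanned by the images of \<open>X\<close>, and dimensions
  can be compared.\<close>

lemma card_irreducible_N_gradable:
  fixes s :: "complex \<Rightarrow> 'u::ab_group_add \<Rightarrow> 'u" and W :: "'i \<Rightarrow> ('v, 'u) vmod"
  assumes s: "vector_space s" and X: "finite X" "UNIV = V.span (X \<union> graded_mod.relators V (scale V) adjoint_module)"
    and I: "finite I" and irr: "\<And>i. i \<in> I \<Longrightarrow> W i \<in> irreducible_N_gradable V s"
    and ineq: "\<And>i j. i \<in> I \<Longrightarrow> j \<in> I \<Longrightarrow> i \<noteq> j \<Longrightarrow> \<not> equivalent_modules s (W i) (W j)"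
  shows "card I \<le> card X"
proof -
  interpret s: vector_space s by fact
  interpret A: graded_mod V "scale V" adjoint_module by (rule graded_adjoint)
  have wm: "weak_module V s (W i)" and ir: "irreducible s (W i)" and Ng: "N_gradable_weak_module V s (W i)" if "i \<in> I" for i
    using irr[OF that] by (auto simp: irreducible_N_gradable_def N_gradable_weak_module_def)
  interpret F: mod_family V s W I by unfold_locales (use I wm in auto)
  interpret P: weak_mod V F.pscale "product_module W I"
    by (intro weak_mod.intro weak_mod_axioms.intro voa_alg_axioms
        vector_space_pointwise F.product_module_weak_module s.vector_space_axioms)
  have "\<forall>i\<in>I. \<exists>G d w. lowest_grading V s (W i) G d w"
    using lowest_grading_exists[OF s Ng ir] by blast
  then obtain G d w0 where lg: "\<And>i. i \<in> I \<Longrightarrow> lowest_grading V s (W i) (G i) (d i) (w0 i)"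
    by metis
  have ds: "is_direct_sum s (space (W i)) UNIV (G i)"
    and w0: "w0 i \<in> G i (d i)" "w0 i \<noteq> 0" if "i \<in> I" for i
    using lg[OF that] unfolding lowest_grading_def by auto
  have low: "G i e = {0}" if "i \<in> I" "e < d i" for i e
    using lg[OF that(1)] that(2) unfolding lowest_grading_def by blast
  have shift: "act (W i) v m w \<in> (let d = k + int n - m - 1 in if d < 0 then {0} else G i (nat d))"
    if "i \<in> I" "v \<in> weight_space V k" "w \<in> G i n" for i k v m n w
    using lg[OF that(1)] that(2,3) unfolding lowest_grading_def by blast
  have dsi: "direct_sum s (space (W i)) (G i)" if "i \<in> I" for i
    using s ds[OF that] by (simp add: direct_sum_def direct_sum_axioms_def)
  have wmi: "weak_mod V s (W i)" if "i \<in> I" for i by (rule F.weak_mod_I[OF that])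
  have w0S: "w0 i \<in> space (W i)" if "i \<in> I" for i
    using direct_sum.A_sub[OF dsi[OF that]] w0(1)[OF that] by blast
  define w where "w = (\<lambda>i. if i \<in> I then w0 i else 0)"
  have wS: "w \<in> space (product_module W I)" using w0S by (auto simp: product_module_def w_def)
  have cs: "componentwise_submodule s W I (P.cyclic w)"
    unfolding componentwise_submodule_def by (rule P.cyclic_submodule[OF wS])
  have full: "single i (w0 i) \<in> P.cyclic w" if "i \<in> I" for i
  proof (rule subdirect_product_full[OF s I wm ir ineq cs])
    fix j assume "j \<in> I"
    then show "\<exists>f\<in>P.cyclic w. f j \<noteq> 0" using P.cyclic_base[OF wS] w0(2) by (intro bexI[of _ w]) (auto simp: w_def)
  qed (use that w0S in auto)
  have act_lin: "act (product_module W I) = product_act W I" by (simp add: product_module_def)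
  \<comment> \<open>For \<open>v\<close> of weight \<open>p\<close> the mode \<open>p - 1\<close> is
    the one that preserves the degree in every factor.\<close>
  define z where "z p v = product_act W I v (p - 1) w" for p :: int and v
  have zlin: "linear_on (scale V) F.pscale (weight_space V p) (z p)" for p
    using P.Y_linear_left[OF wS, of "p - 1"] unfolding z_def act_lin linear_on_def by blast
  define zm where "zm = Vg.ext z"
  have zm_lin: "linear_on (scale V) F.pscale UNIV zm"
    unfolding zm_def by (rule Vg.ext_linear[OF P.s.vector_space_axioms zlin])
  have zm_hom: "zm v = product_act W I v (p - 1) w" if "v \<in> weight_space V p" for v p
    unfolding zm_def using Vg.ext_hom[OF P.s.vector_space_axioms zlin that] by (simp add: z_def)
  interpret zm: Vector_Spaces.linear "scale V" F.pscale zm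
    using zm_lin by unfold_locales (auto simp: linear_on_def)
  \<comment> \<open>Projection onto degree \<open>d i\<close> in each factor; the lowest degrees of
    the factors may differ.\<close>
  define pr where "pr f = (\<lambda>i. if i \<in> I then direct_sum.comp (G i) (f i) (d i) else 0)" for f
  have pr_in: "pr f \<in> range zm" if "f \<in> P.cyclic w" for f
  proof -
    have "f \<in> space (product_module W I) \<and> pr f \<in> range zm"
      using that unfolding P.cyclic_def
    proof (induction rule: P.s.span_induct_alt)
      case base
      have "pr 0 = 0"
        using direct_sum.comp_hom[OF dsi direct_sum.zero_mem[OF dsi]] by (auto simp: pr_def fun_eq_iff)
      then show ?case using P.S0 zm.zero by (metis rangeI)
    next
      case (step c f g)
      then obtain v n where f: "f = product_act W I v n w" unfolding act_lin by blast
      have padd: "pr (x + y) = pr x + pr y" and pscl: "pr (\<lambda>i. s c (x i)) = (\<lambda>i. s c (pr x i))"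
        if "x \<in> space (product_module W I)" "y \<in> space (product_module W I)" for x y c
        using that direct_sum.comp_add[OF dsi] direct_sum.comp_scale[OF dsi] by (auto simp: pr_def product_module_def fun_eq_iff)
      have Radd: "x + y \<in> range zm" "(\<lambda>i. s c (x i)) \<in> range zm" if "x \<in> range zm" "y \<in> range zm" for x y c
        using that by (auto simp flip: zm.add zm.scale)
      have "pr (product_act W I v n w) \<in> range zm"
      proof (induction v rule: homogeneous_induct)
        case (1 p v)
        \<comment> \<open>Mode \<open>n\<close> of a vector of weight \<open>p\<close> shifts all
          degrees by \<open>p - n - 1\<close>, so the projection keeps exactly the zero
          mode.\<close>
        have "pr (product_act W I v n w) i = (if p = n + 1 then zm v else 0) i" for i
        proof (cases "i \<in> I")
          case True
          have m: "act (W i) v n (w0 i) \<in> (let e = p + int (d i) - n - 1 in if e < 0 then {0} else G i (nat e))"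
            by (rule shift[OF True 1 w0(1)[OF True]])
          let ?e = "p + int (d i) - n - 1"
          have c: "pr (product_act W I v n w) i = direct_sum.comp (G i) (act (W i) v n (w0 i)) (d i)"
            using True by (simp add: pr_def product_act_def w_def)
          show ?thesis
          proof (cases "?e < 0")
            case True': True
            then have "act (W i) v n (w0 i) = 0" using m by simp
            then have "pr (product_act W I v n w) i = 0"
              unfolding c using direct_sum.comp_hom[OF dsi[OF True] direct_sum.zero_mem[OF dsi[OF True]]] by (simp add: fun_eq_iff)
            moreover have "p \<noteq> n + 1" using True' by auto
            ultimately show ?thesis by simp
          next
            case False
            then have "act (W i) v n (w0 i) \<in> G i (nat ?e)" using m by (simp add: Let_def)
            from direct_sum.comp_hom[OF dsi[OF True] this] have "pr (product_act W I v n w) i = (if d i = nat ?e then act (W i) v n (w0 i) else 0)"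
              unfolding c by simp
            moreover have "d i = nat ?e \<longleftrightarrow> p = n + 1" using False by auto
            moreover have "zm v i = act (W i) v n (w0 i)" if "p = n + 1"
              using zm_hom[OF 1] that True by (simp add: product_act_def w_def)
            ultimately show ?thesis by simp
          qed
        next
          case False
          then show ?thesis using zm_hom[OF 1] by (simp add: pr_def product_act_def)
        qed
        then have "pr (product_act W I v n w) = (if p = n + 1 then zm v else 0)" by (rule ext)
        then show ?case using zm.zero by (metis rangeI)
      next
        case (2 u v)
        have "product_act W I (u + v) n w = product_act W I u n w + product_act W I v n w"
          using P.Y_add_left[OF wS, of u v n] unfolding act_lin .
        moreover have "product_act W I x n w \<in> space (product_module W I)" for x
          using P.Y_closed[OF wS] unfolding act_lin .
        ultimately have "pr (product_act W I (u + v) n w) = pr (product_act W I u n w) + pr (product_act W I v n w)"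
          by (simp only: padd)
        then show ?case using Radd(1)[OF 2] by (simp only:)
      qed
      moreover have fS: "f \<in> space (product_module W I)" using P.Y_closed[OF wS] unfolding f act_lin by blast
      ultimately have "pr (\<lambda>i. s c (f i)) \<in> range zm" using pscl[OF fS fS] Radd(2) unfolding f by simp
      moreover have sS: "(\<lambda>i. s c (f i)) \<in> space (product_module W I)" using P.s.subspace_scale[OF P.subspace_S fS] .
      moreover have "pr ((\<lambda>i. s c (f i)) + g) = pr (\<lambda>i. s c (f i)) + pr g"
        by (rule padd[OF sS]) (use step(2) in blast)
      ultimately show ?case
        using step(2) Radd(1)[of "pr (\<lambda>i. s c (f i))" "pr g"] P.s.subspace_add[OF P.subspace_S sS, of g]
        by (simp only:)
    qed
    then show ?thesis by simp
  qed
  have zm_rel: "zm x = 0" if rel: "x \<in> A.relators" for x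
  proof -
    obtain K p v l a h where x: "x = (\<Sum>i<K. scale V (of_int p gchoose i) (vertex V v (l + int i) a))"
      "v \<in> weight_space V p" "l \<le> -2" "a \<in> A.E h" "\<forall>i\<ge>K. vertex V v (l + int i) a = 0"
      using rel unfolding A.relators_def adjoint_simps by blast
    show ?thesis
    proof (cases "h \<in> \<int>")
      case False
      then have "a = 0" using x(4) L0_eigenspace_adjoint_nonint by blast
      then show ?thesis using x(1) by (simp add: zm.zero)
    next
      case True
      then obtain q where q: "a \<in> weight_space V q" using x(4) by (auto elim!: Ints_cases simp: L0_eigenspace_adjoint)
      have "zm x = (\<Sum>i<K. F.pscale (of_int p gchoose i) (product_act W I (vertex V v (l + int i) a) (p + q - l - int i - 2) w))"
        unfolding x(1) zm.sum zm.scale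
        using zm_hom[OF weight_shift[OF x(2) q]] by (simp add: algebra_simps)
      also have "\<dots> = 0"
      proof
        fix j
        show "(\<Sum>i<K. F.pscale (of_int p gchoose i) (product_act W I (vertex V v (l + int i) a) (p + q - l - int i - 2) w)) j = 0 j"
        proof (cases "j \<in> I")
          case False
          then show ?thesis by (simp add: sum_fun_apply product_act_def)
        next
          case True
          interpret j: weak_mod V s "W j" by (rule wmi[OF True])
          \<comment> \<open>With \<open>m = p\<close> and third index \<open>q - l - 2\<close>, the
            right side carries the index \<open>p + q - l - 2 - i\<close>. This is the zero mode of
            \<open>vertex V v (l + i) a\<close>, whose weight is
            \<open>p + q - l - i - 1\<close>.\<close>
          obtain K' where K': "K' \<ge> K" "jac_eq s (vertex V) j.Y j.Y j.Y v a (w0 j) l p (q - l - 2) K'"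
            using eventually_obtain_ge[OF j.jac_eventually[OF w0S[OF True], of v a l p "q - l - 2"], of K] by blast
          \<comment> \<open>The inner mode of \<open>a\<close> changes the degree by
            \<open>l + 1 - i\<close>, which is negative because \<open>l\<close> is at most -2. In
            the next fact \<open>v\<close> lowers the degree by \<open>i + 1\<close>.\<close>
          have z1: "j.Y v (p + l - int i) (j.Y a (q - l - 2 + of_nat i) (w0 j)) = 0" for i
          proof -
            let ?e = "q + int (d j) - (q - l - 2 + int i) - 1"
            have "j.Y a (q - l - 2 + int i) (w0 j) \<in> (let e = ?e in if e < 0 then {0} else G j (nat e))"
              by (rule shift[OF True q w0(1)[OF True]])
            moreover have "nat ?e < d j" if "\<not> ?e < 0" using x(3) that by linarith
            ultimately have "j.Y a (q - l - 2 + int i) (w0 j) = 0"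
              using low[OF True, of "nat ?e"] by (auto simp: Let_def split: if_splits)
            then show ?thesis by simp
          qed
          have z2: "j.Y v (p + int i) (w0 j) = 0" for i
          proof -
            let ?e = "p + int (d j) - (p + int i) - 1"
            have "j.Y v (p + int i) (w0 j) \<in> (let e = ?e in if e < 0 then {0} else G j (nat e))"
              by (rule shift[OF True x(2) w0(1)[OF True]])
            moreover have "nat ?e < d j" if "\<not> ?e < 0" using that by linarith
            ultimately show ?thesis
              using low[OF True, of "nat ?e"] by (auto simp: Let_def split: if_splits)
          qed
          let ?r = "\<lambda>i. s (of_int p gchoose i) (j.Y (vertex V v (l + int i) a) (p + q - l - int i - 2) (w0 j))"
          have "(\<Sum>i<K'. ?r i) = 0"
          proof -
            have e: "p + (q - l - 2) - int i = p + q - l - int i - 2" for i by simp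
            have "(\<Sum>i<K'. s (of_int p gchoose i) (j.Y (vertex V v (l + int i) a) (p + (q - l - 2) - int i) (w0 j))) = 0"
              using K'(2) unfolding jac_eq_def z1 z2 j.Y_zero s.scale_zero_right sum.neutral_const by simp
            then show ?thesis by (simp only: e)
          qed
          moreover have "(\<Sum>i<K. ?r i) = (\<Sum>i<K'. ?r i)"
            by (rule sum.mono_neutral_left) (use K'(1) x(5) in \<open>auto simp: j.Y_zero_left[OF w0S[OF True]]\<close>)
          ultimately show ?thesis using True by (simp add: sum_fun_apply product_act_def w_def)
        qed
      qed
      finally show ?thesis .
    qed
  qed
  have range: "range zm \<subseteq> P.s.span (zm ` X)"
  proof -
    have "zm x \<in> P.s.span (zm ` X)" for x
    proof -
      have "x \<in> V.span (X \<union> A.relators)" using X(2) by blast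
      then show ?thesis
      proof (induction rule: V.span_induct_alt)
        case base
        show ?case unfolding zm.zero by (rule P.s.span_zero)
      next
        case (step c x y)
        have "zm x \<in> P.s.span (zm ` X)" using step(1) zm_rel P.s.span_zero by (auto intro: P.s.span_base)
        then show ?case using step(2) unfolding zm.add zm.scale by (intro P.s.span_add P.s.span_scale)
      qed
    qed
    then show ?thesis by blast
  qed
  let ?B = "(\<lambda>i. single i (w0 i)) ` I"
  have "single i (w0 i) \<in> P.s.span (zm ` X)" if "i \<in> I" for i
  proof -
    have "pr (single i (w0 i)) j = single i (w0 i) j" for j
    proof (cases "j \<in> I")
      case j: True
      show ?thesis
      proof (cases "j = i")
        case True
        then show ?thesis using direct_sum.comp_hom[OF dsi[OF that] w0(1)[OF that]] that by (simp add: pr_def)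
      next
        case False
        then show ?thesis using direct_sum.comp_hom[OF dsi[OF j] direct_sum.zero_mem[OF dsi[OF j]]] j by (simp add: pr_def)
      qed
    next
      case False
      then have "j \<noteq> i" using that by blast
      then show ?thesis using False by (simp add: pr_def)
    qed
    then have "pr (single i (w0 i)) = single i (w0 i)" by (rule ext)
    then show ?thesis using pr_in[OF full[OF that]] range by auto
  qed
  then have sub: "?B \<subseteq> P.s.span (zm ` X)" by blast
  have inj: "inj_on (\<lambda>i. single i (w0 i)) I"
  proof (rule inj_onI)
    fix i j assume "i \<in> I" "j \<in> I" "single i (w0 i) = single j (w0 j)"
    then have "single j (w0 j) i \<noteq> 0" using w0(2)[of i] by (metis single_apply(1))
    then show "i = j" by (metis single_apply(2))
  qed
  have "P.s.independent ?B"
    unfolding P.s.independent_explicit_finite_subsets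
  proof (intro allI impI ballI)
    fix B u b assume B: "B \<subseteq> ?B" "finite B" "(\<Sum>v\<in>B. F.pscale (u v) v) = 0" "b \<in> B"
    then obtain i where i: "i \<in> I" "b = single i (w0 i)" by blast
    have "0 = (\<Sum>v\<in>B. F.pscale (u v) v) i" using B(3) by simp
    also have "\<dots> = (\<Sum>v\<in>B. s (u v) (v i))" by (simp add: sum_fun_apply)
    also have "\<dots> = (\<Sum>v\<in>{b}. s (u v) (v i))"
    proof (rule sum.mono_neutral_right)
      show "\<forall>v\<in>B - {b}. s (u v) (v i) = 0"
      proof
        fix v assume v: "v \<in> B - {b}"
        then obtain k where "k \<in> I" "v = single k (w0 k)" using B(1) by blast
        moreover then have "k \<noteq> i" using v i by blast
        ultimately show "s (u v) (v i) = 0" by simp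
      qed
    qed (use B in auto)
    finally have "s (u b) (w0 i) = 0" using i by simp
    then show "u b = 0" using w0(2)[OF i(1)] by simp
  qed
  then have "card ?B \<le> card (zm ` X)"
    using P.s.independent_span_bound[OF _ _ sub] X(1) by blast
  then show ?thesis using card_image[OF inj] card_image_le[OF X(1), of zm] by simp
qed

text \<open>Infinitely many classes would include \<open>card X + 1\<close> distinct ones, and their
  representatives violate the bound just proved.\<close>

lemma finite_irreducible_N_gradable:
  fixes s :: "complex \<Rightarrow> 'u::ab_group_add \<Rightarrow> 'u"
  assumes s: "vector_space s" and X: "finite X" "UNIV = V.span (X \<union> graded_mod.relators V (scale V) adjoint_module)"
  shows "finite (irreducible_N_gradable V s // equivalence_on s (irreducible_N_gradable V s))"
proof (rule ccontr)
  let ?C = "irreducible_N_gradable V s" and ?R = "equivalence_on s (irreducible_N_gradable V s)"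
  assume "infinite (?C // ?R)"
  then obtain Q where Q: "Q \<subseteq> ?C // ?R" "finite Q" "card Q = Suc (card X)"
    by (meson infinite_arbitrarily_large)
  have eq: "equiv ?C ?R" by (rule equiv_equivalence_on[OF s])
  define r where "r q = (SOME W. W \<in> q)" for q :: "('v, 'u) vmod set"
  have r: "r q \<in> q" "r q \<in> ?C" if "q \<in> Q" for q
  proof -
    have q: "q \<in> ?C // ?R" using that Q by blast
    then have "q \<noteq> {}" using in_quotient_imp_non_empty[OF eq] by blast
    then show "r q \<in> q" unfolding r_def by (simp add: some_in_eq)
    then show "r q \<in> ?C" using in_quotient_imp_subset[OF eq q] by blast
  qed
  have "card Q \<le> card X"
  proof (rule card_irreducible_N_gradable[OF s X Q(2), where W = r])
    fix q q' assume q: "q \<in> Q" "q' \<in> Q" "q \<noteq> q'"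
    show "\<not> equivalent_modules s (r q) (r q')"
    proof
      assume "equivalent_modules s (r q) (r q')"
      then have "(r q, r q') \<in> ?R" using r q by (simp add: equivalence_on_def)
      then have "q = q'"
        using quotient_eq_iff[OF eq] r q Q(1) by blast
      then show False using q by blast
    qed
  qed (rule r)
  then show False using Q by simp
qed

end

section \<open>Fusion rules\<close>

text \<open>A nonzero weight exists, and along its coset of the integers the weights are bounded
  below. Minimality inside this one coset suffices, as modes shift weights by integers.\<close>

lemma (in weak_mod) lowest_weight:
  assumes o: "ordinary_module V s W" and nz: "S \<noteq> {0}"
  shows "\<exists>h. L0_eigenspace V s W h \<noteq> {0} \<and> (\<forall>k::nat. L0_eigenspace V s W (h - of_nat (Suc k)) = {0})"
proof -
  interpret G: graded_mod V s W
    by unfold_locales (use o in \<open>simp add: ordinary_module_def\<close>)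
  have "\<exists>h. G.E h \<noteq> {0}"
  proof (rule ccontr)
    assume "\<not> (\<exists>h. G.E h \<noteq> {0})"
    then have "(\<Union>h. G.E h) = {0}" by auto
    then show False using G.G.M_span s.span_insert_0[of "{}"] nz by simp
  qed
  then obtain g where g: "G.E g \<noteq> {0}" by blast
  obtain N :: int where N: "\<forall>n<N. G.E (g + of_int n) = {0}" using o unfolding ordinary_module_def by blast
  let ?P = "\<lambda>m::nat. G.E (g + of_int (N + int m)) \<noteq> {0}"
  have "\<not> 0 < N" using N[rule_format, of 0] g by auto
  then have "?P (nat (- N))" using g by simp
  then obtain m where m: "?P m" "\<And>k. k < m \<Longrightarrow> \<not> ?P k" using exists_least_iff[of ?P] by blast
  have "G.E (g + of_int (N + int m) - of_nat (Suc k)) = {0}" for k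
  proof (cases "Suc k \<le> m")
    case True
    then have eq: "g + of_int (N + int m) - of_nat (Suc k) = g + of_int (N + int (m - Suc k))"
      by (simp add: of_nat_diff)
    have "m - Suc k < m" using True by simp
    from m(2)[OF this] show ?thesis unfolding eq by blast
  next
    case False
    have eq: "g + of_int (N + int m) - of_nat (Suc k) = g + of_int (N + int m - int (Suc k))" by simp
    have "N + int m - int (Suc k) < N" using False by linarith
    then show ?thesis unfolding eq by (rule N[rule_format])
  qed
  with m(1) show ?thesis by blast
qed

section \<open>Modes of one intertwining operator\<close>

locale intertwiner = M1: weak_mod V s W1 + M2: weak_mod V s W2 + M3: weak_mod V s W3
  for V :: "'v::ab_group_add voa" and s :: "complex \<Rightarrow> 'u::ab_group_add \<Rightarrow> 'u"
    and W1 W2 W3 :: "('v, 'u) vmod" +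
  fixes J :: "'u \<Rightarrow> complex \<Rightarrow> 'u \<Rightarrow> 'u"
  assumes J: "J \<in> intertwining_operators V s W1 W2 W3"
begin

lemma J_outside: "a \<notin> space W1 \<or> b \<notin> space W2 \<Longrightarrow> J a n b = 0"
  and J_closed: "a \<in> space W1 \<Longrightarrow> b \<in> space W2 \<Longrightarrow> J a n b \<in> space W3"
  and J_linear: "a \<in> space W1 \<Longrightarrow> linear_on s s (space W2) (J a n)"
  and J_linear_left: "b \<in> space W2 \<Longrightarrow> linear_on s s (space W1) (\<lambda>a. J a n b)"
  and J_trunc: "a \<in> space W1 \<Longrightarrow> b \<in> space W2 \<Longrightarrow> \<exists>N::real. \<forall>n. Re n \<ge> N \<longrightarrow> J a n b = 0"
  and J_derivative: "a \<in> space W1 \<Longrightarrow> b \<in> space W2 \<Longrightarrow>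
    J (virasoro V (act W1) (-1) a) n b = s (- n) (J a (n - 1) b)"
  and J_jacobi: "a \<in> space W1 \<Longrightarrow> b \<in> space W2 \<Longrightarrow> jacobi_identity s (act W1) (act W2) (act W3) J v a b"
  using J[unfolded intertwining_operators_def mem_Collect_eq] by (elim conjE; simp)+

lemma J_add: "a \<in> space W1 \<Longrightarrow> b \<in> space W2 \<Longrightarrow> b' \<in> space W2 \<Longrightarrow> J a n (b + b') = J a n b + J a n b'"
  and J_scale: "a \<in> space W1 \<Longrightarrow> b \<in> space W2 \<Longrightarrow> J a n (s c b) = s c (J a n b)"
  using J_linear[of a n] by (auto simp: linear_on_def)

lemma J_add_left: "b \<in> space W2 \<Longrightarrow> a \<in> space W1 \<Longrightarrow> a' \<in> space W1 \<Longrightarrow> J (a + a') n b = J a n b + J a' n b"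
  and J_scale_left: "b \<in> space W2 \<Longrightarrow> a \<in> space W1 \<Longrightarrow> J (s c a) n b = s c (J a n b)"
  using J_linear_left[of b n] by (auto simp: linear_on_def)

lemma J_zero: "J a n 0 = 0"
  using J_scale[OF _ M2.S0, of a n 0] J_outside[of a 0 n] by (cases "a \<in> space W1") auto

lemma J_zero_left: "J 0 n b = 0"
  using J_scale_left[OF _ M1.S0, of b 0 n] J_outside[of 0 b n] by (cases "b \<in> space W2") auto

lemma J_trunc_from:
  assumes "a \<in> space W1" "b \<in> space W2"
  shows "\<exists>K::nat. \<forall>i\<ge>K. J a (n + of_nat i) b = 0"
proof -
  obtain N where N: "\<forall>n. Re n \<ge> N \<longrightarrow> J a n b = 0" using J_trunc[OF assms] by blast
  have "J a (n + of_nat i) b = 0" if "i \<ge> nat \<lceil>N - Re n\<rceil>" for i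
  proof -
    have "N - Re n \<le> real i" using that by linarith
    then have "Re (n + of_nat i) \<ge> N" by simp
    then show ?thesis using N by blast
  qed
  then show ?thesis by blast
qed

lemma J_jac_eventually:
  assumes "a \<in> space W1" "b \<in> space W2"
  shows "\<forall>\<^sub>F K in sequentially. jac_eq s (act W1) (act W2) (act W3) J v a b l m n K"
proof -
  have "jacobi_identity s (act W1) (act W2) (act W3) J v a b \<longleftrightarrow>
     (\<forall>l m n. \<forall>\<^sub>F K in sequentially. jac_eq s (act W1) (act W2) (act W3) J v a b l m n K)"
    by (rule jacobi_identity_iff_eventually[OF M1.s.vector_space_axioms])
      (use assms M1.trunc M2.trunc J_trunc_from J_zero J_zero_left in auto)
  then show ?thesis using J_jacobi[OF assms] by blast
qed

lemma J_commutator: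
  assumes ab: "a \<in> space W1" "b \<in> space W2" and K: "\<And>i. i \<ge> K \<Longrightarrow> act W1 v (int i) a = 0"
  shows "act W3 v m (J a n b) - J a n (act W2 v m b) =
    (\<Sum>i<K. s (of_int m gchoose i) (J (act W1 v (int i) a) (of_int m + n - of_nat i) b))"
proof -
  obtain K' where K': "K' \<ge> Suc K" "jac_eq s (act W1) (act W2) (act W3) J v a b 0 m n K'"
    using eventually_obtain_ge[OF J_jac_eventually[OF ab, of v 0 m n], of "Suc K"] by blast
  have z: "(\<Sum>i<K'. s (c i * (0 gchoose i)) (f i)) = s (c 0) (f 0)" for c f
    using K'(1) by (intro sum_scale_gbinomial_0 M1.s.vector_space_axioms) simp
  have "(\<Sum>i<K'. s (of_int m gchoose i) (J (act W1 v (int i) a) (of_int m + n - of_nat i) b)) =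
      (\<Sum>i<K. s (of_int m gchoose i) (J (act W1 v (int i) a) (of_int m + n - of_nat i) b))"
    by (rule sum.mono_neutral_right) (use K'(1) K in \<open>auto simp: J_zero_left\<close>)
  then show ?thesis
    using K'(2) z[of "\<lambda>i. (-1) ^ i"] z[of "\<lambda>i. 1 * (-1) ^ i"] unfolding jac_eq_def by simp
qed

text \<open>The commutator with \<open>L(0)\<close> involves only \<open>L(-1) a\<close> and
  \<open>L(0) a\<close>; the derivative property turns the former into the scalar
  \<open>-(n + 1)\<close>.\<close>

lemma J_shift:
  assumes a: "a \<in> L0_eigenspace V s W1 h" and b: "b \<in> L0_eigenspace V s W2 g"
  shows "J a n b \<in> L0_eigenspace V s W3 (h + g - n - 1)"
proof -
  have aS: "a \<in> space W1" and bS: "b \<in> space W2"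
    and ea: "virasoro V (act W1) 0 a = s h a" and eb: "virasoro V (act W2) 0 b = s g b"
    using a b by (auto simp: L0_eigenspace_def)
  obtain K where K: "\<And>i. i \<ge> K \<Longrightarrow> act W1 (conformal V) (int i) a = 0"
    using M1.trunc_from[OF aS, of "conformal V" 0] by auto
  have "act W3 (conformal V) 1 (J a n b) - J a n (act W2 (conformal V) 1 b) =
    (\<Sum>i<K+2. s (of_int 1 gchoose i) (J (act W1 (conformal V) (int i) a) (of_int 1 + n - of_nat i) b))"
    by (rule J_commutator[OF aS bS]) (use K in auto)
  also have "\<dots> = (\<Sum>i\<le>1. s (of_nat (1 choose i)) (J (act W1 (conformal V) (int i) a) (of_int 1 + n - of_nat i) b))"
  proof -
    have "1 < K + 2" by simp
    from sum_scale_gbinomial_of_nat[OF M1.s.vector_space_axioms this] show ?thesis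
      by (simp only: of_nat_1 of_int_1)
  qed
  also have "\<dots> = J (virasoro V (act W1) (-1) a) (n + 1) b + J (virasoro V (act W1) 0 a) n b"
    by (simp add: virasoro_def add.commute)
  also have "\<dots> = s (- (n + 1)) (J a n b) + s h (J a n b)"
    using J_derivative[OF aS bS, of "n + 1"] by (simp only: ea J_scale_left[OF bS aS] add_diff_cancel_right')
  also have "act W2 (conformal V) 1 b = s g b" using eb by (simp add: virasoro_def)
  finally have "act W3 (conformal V) 1 (J a n b) - s g (J a n b) = s (- (n + 1)) (J a n b) + s h (J a n b)"
    by (simp only: J_scale[OF aS bS])
  also have "\<dots> = s (h + g - n - 1) (J a n b) - s g (J a n b)"
    by (simp add: algebra_simps flip: M1.s.scale_left_distrib M1.s.scale_left_diff_distrib)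
  finally show ?thesis
    using J_closed[OF aS bS] by (simp add: L0_eigenspace_def virasoro_def)
qed

end

lemma intertwining_vector_space:
  assumes "vector_space s"
  shows "vector_space (pointwise s)"
  unfolding pointwise_def
  by (intro vector_space_pointwise assms)

lemma intertwining_subspace:
  assumes wm: "weak_mod V s W1" "weak_mod V s W2" "weak_mod V s W3"
  shows "module.subspace (pointwise s) (intertwining_operators V s W1 W2 W3)"
proof -
  interpret s: vector_space s using wm(1) by (simp add: weak_mod_def)
  interpret M1: weak_mod V s W1 by fact
  interpret M2: weak_mod V s W2 by fact
  interpret M3: weak_mod V s W3 by fact
  interpret P: vector_space "pointwise s" by (rule intertwining_vector_space[OF s.vector_space_axioms])
  let ?I = "intertwining_operators V s W1 W2 W3"
  have it: "intertwiner V s W1 W2 W3 J" if "J \<in> ?I" for J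
    using that wm by (simp add: intertwiner_def intertwiner_axioms_def)
  \<comment> \<open>Coefficients \<open>(1, 1)\<close> give sums and \<open>(c, 0)\<close> gives
    multiples, so the Jacobi identity is checked only once.\<close>
  have mem: "(\<lambda>a n b. s c (J a n b) + s d (J' a n b)) \<in> ?I" if J: "J \<in> ?I" and J': "J' \<in> ?I" for J J' c d
  proof -
    interpret J: intertwiner V s W1 W2 W3 J by (rule it[OF J])
    interpret J': intertwiner V s W1 W2 W3 J' by (rule it[OF J'])
    define L where "L = (\<lambda>a n b. s c (J a n b) + s d (J' a n b))"
    have tr: "\<exists>N::real. \<forall>n. Re n \<ge> N \<longrightarrow> L a n b = 0" if ab: "a \<in> space W1" "b \<in> space W2" for a b
    proof -
      obtain N N' where "\<forall>n. Re n \<ge> N \<longrightarrow> J a n b = 0" "\<forall>n. Re n \<ge> N' \<longrightarrow> J' a n b = 0"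
        using J.J_trunc[OF ab] J'.J_trunc[OF ab] by blast
      then show ?thesis by (intro exI[of _ "max N N'"]) (simp add: L_def)
    qed
    have trn: "\<exists>N::nat. \<forall>i\<ge>N. L a (n + of_nat i) b = 0" if ab: "a \<in> space W1" "b \<in> space W2" for a b n
    proof -
      obtain N N' where "\<forall>i\<ge>N. J a (n + of_nat i) b = 0" "\<forall>i\<ge>N'. J' a (n + of_nat i) b = 0"
        using J.J_trunc_from[OF ab, of n] J'.J_trunc_from[OF ab, of n] by blast
      then show ?thesis by (intro exI[of _ "max N N'"]) (simp add: L_def)
    qed
    have L0: "L a n 0 = 0" "L 0 n b = 0" for a n b
      by (simp_all add: L_def J.J_zero J'.J_zero J.J_zero_left J'.J_zero_left)
    have jac: "jacobi_identity s (act W1) (act W2) (act W3) L v a b" if ab: "a \<in> space W1" "b \<in> space W2" for v a b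
    proof (subst jacobi_identity_iff_eventually[where J = L and ?Y1.0 = "act W1" and ?Y2.0 = "act W2" and ?Y3.0 = "act W3" and v = v and a = a and b = b,
        OF s.vector_space_axioms M3.Y_zero L0 M2.trunc[OF ab(2)] M1.trunc[OF ab(1)] trn[OF ab]], intro allI)
      fix l m n
      show "\<forall>\<^sub>F K in sequentially. jac_eq s (act W1) (act W2) (act W3) L v a b l m n K"
        using J.J_jac_eventually[OF ab, of v l m n] J'.J_jac_eventually[OF ab, of v l m n]
      proof eventually_elim
        case (elim K)
        have S3: "s e (J a k b) \<in> space W3" "s e (J' a k b) \<in> space W3" for e k
          by (rule s.subspace_scale[OF M3.subspace_S J.J_closed[OF ab]], rule s.subspace_scale[OF M3.subspace_S J'.J_closed[OF ab]])
        have e: "act W3 v k (L a k' b) = s c (act W3 v k (J a k' b)) + s d (act W3 v k (J' a k' b))" for k k'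
          unfolding L_def using J.J_closed[OF ab] J'.J_closed[OF ab] by (simp add: M3.Y_add M3.Y_scale S3)
        have c1: "s x (s c y + s d z) = s c (s x y) + s d (s x z)" for x y z
          by (simp add: s.scale_right_distrib mult.commute)
        let ?A = "\<lambda>J. (\<Sum>i<K. s ((-1) ^ i * (of_int l gchoose i)) (act W3 v (m + l - int i) (J a (n + of_nat i) b)))"
        let ?B = "\<lambda>J. (\<Sum>i<K. s ((-1) powi l * (-1) ^ i * (of_int l gchoose i)) (J a (n + of_int l - of_nat i) (act W2 v (m + int i) b)))"
        let ?C = "\<lambda>J. (\<Sum>i<K. s (of_int m gchoose i) (J (act W1 v (l + int i) a) (of_int m + n - of_nat i) b))"
        have "?A L = s c (?A J) + s d (?A J')" "?B L = s c (?B J) + s d (?B J')" "?C L = s c (?C J) + s d (?C J')"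
          unfolding e unfolding L_def c1 by (simp_all only: sum.distrib s.scale_sum_right)
        moreover have "?A J - ?B J = ?C J" "?A J' - ?B J' = ?C J'" using elim unfolding jac_eq_def by auto
        moreover have "x - y = z" if "x = s c x1 + s d x2" "y = s c y1 + s d y2" "z = s c z1 + s d z2"
          "x1 - y1 = z1" "x2 - y2 = z2" for x x1 x2 y y1 y2 z z1 z2
          unfolding that(1-3) that(4,5)[symmetric] by (simp add: s.scale_right_diff_distrib)
        ultimately show ?case unfolding jac_eq_def by blast
      qed
    qed
    have "L \<in> ?I"
      unfolding intertwining_operators_def
    proof (intro CollectI conjI allI ballI impI)
      fix a n assume a: "a \<in> space W1"
      show "linear_on s s (space W2) (L a n)"
        unfolding linear_on_def L_def
        using a by (auto simp: J.J_add J'.J_add J.J_scale J'.J_scale s.scale_right_distrib mult.commute)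
    next
      fix n b assume b: "b \<in> space W2"
      show "linear_on s s (space W1) (\<lambda>a. L a n b)"
        unfolding linear_on_def L_def
        using b by (auto simp: J.J_add_left J'.J_add_left J.J_scale_left J'.J_scale_left s.scale_right_distrib mult.commute)
    next
      fix a n b assume ab: "a \<in> space W1" "b \<in> space W2"
      show "L a n b \<in> space W3"
        unfolding L_def using J.J_closed[OF ab] J'.J_closed[OF ab]
        by (intro s.subspace_add s.subspace_scale M3.subspace_S)
      show "L (virasoro V (act W1) (-1) a) n b = s (- n) (L a (n - 1) b)"
        unfolding L_def J.J_derivative[OF ab] J'.J_derivative[OF ab]
        by (simp add: s.scale_right_distrib mult.commute)
    next
      fix a n b assume "a \<notin> space W1 \<or> b \<notin> space W2"
      then show "L a n b = 0" by (simp add: L_def J.J_outside J'.J_outside)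
    qed (use tr jac in auto)
    then show ?thesis by (simp add: L_def)
  qed
  have z: "0 \<in> ?I"
    unfolding intertwining_operators_def jacobi_identity_def
    using M3.S0 by (auto simp: linear_on_def)
  show ?thesis
    unfolding P.subspace_def
  proof (intro conjI allI ballI z)
    fix J J' assume "J \<in> ?I" "J' \<in> ?I"
    from mem[OF this, of 1 1] show "J + J' \<in> ?I" by (simp add: plus_fun_def)
  next
    fix c J assume "J \<in> ?I"
    from mem[OF this this, of c 0] show "pointwise s c J \<in> ?I" by (simp add: pointwise_def)
  qed
qed

text \<open>
  For a lowest weight vector \<open>w2\<close>, an intertwining operator \<open>J\<close> is determined by the components of
  \<open>J(a, x) w2\<close> of lowest weight in \<open>W3\<close>, and these vanish for \<open>a\<close> in the span of the relators.
\<close>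

lemma (in voa_alg) fusion_rule_finite:
  fixes s :: "complex \<Rightarrow> 'u::ab_group_add \<Rightarrow> 'u" and W1 W2 W3 :: "('v, 'u) vmod"
  assumes s: "vector_space s" and o: "ordinary_module V s W1" "ordinary_module V s W2" "ordinary_module V s W3"
    and irr: "irreducible s W2" "irreducible s W3"
    and X: "finite X" "X \<subseteq> space W1" "space W1 = module.span s (X \<union> graded_mod.relators V s W1)"
  shows "finite_dimensional (pointwise s) (intertwining_operators V s W1 W2 W3)"
proof -
  interpret s: vector_space s by fact
  have gm: "graded_mod V s W" if "ordinary_module V s W" for W
    using that by unfold_locales (simp_all add: ordinary_module_def)
  interpret M1: graded_mod V s W1 by (rule gm[OF o(1)])
  interpret M2: graded_mod V s W2 by (rule gm[OF o(2)])
  interpret M3: graded_mod V s W3 by (rule gm[OF o(3)])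
  let ?I = "intertwining_operators V s W1 W2 W3"
  have it: "intertwiner V s W1 W2 W3 J" if "J \<in> ?I" for J
    by (intro intertwiner.intro intertwiner_axioms.intro M1.weak_mod_axioms M2.weak_mod_axioms M3.weak_mod_axioms that)
  have nz: "space W2 \<noteq> {0}" "space W3 \<noteq> {0}" using irr by (simp_all add: irreducible_def)
  obtain h2 where h2: "M2.E h2 \<noteq> {0}" "\<And>k::nat. M2.E (h2 - of_nat (Suc k)) = {0}"
    using M2.lowest_weight[OF o(2) nz(1)] by blast
  obtain h3 where h3: "M3.E h3 \<noteq> {0}" "\<And>k::nat. M3.E (h3 - of_nat (Suc k)) = {0}"
    using M3.lowest_weight[OF o(3) nz(2)] by blast
  obtain w2 where w2: "w2 \<in> M2.E h2" "w2 \<noteq> 0" using h2(1) M2.G.zero_mem by blast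
  have w2S: "w2 \<in> space W2" using w2(1) M2.L0_eigenspace_subset by blast
  \<comment> \<open>For \<open>a\<close> of weight \<open>h\<close>, the mode \<open>h + c\<close>
    sends \<open>w2\<close> to weight \<open>h + h2 - (h + c) - 1 = h3\<close>.\<close>
  define c where "c = h2 - h3 - 1"
  define \<phi> where "\<phi> J = M1.G.ext (\<lambda>h x. J x (h + c) w2)" for J :: "'u \<Rightarrow> complex \<Rightarrow> 'u \<Rightarrow> 'u"
  have lin: "linear_on s s (M1.E h) (\<lambda>x. J x (h + c) w2)" if "J \<in> ?I" for J h
  proof -
    interpret J: intertwiner V s W1 W2 W3 J by (rule it[OF that])
    show ?thesis using J.J_linear_left[OF w2S] M1.L0_eigenspace_subset unfolding linear_on_def by blast
  qed
  have \<phi>_lin: "linear_on s s (space W1) (\<phi> J)" if "J \<in> ?I" for J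
    unfolding \<phi>_def by (rule M1.G.ext_linear[OF s.vector_space_axioms lin[OF that]])
  have \<phi>_hom: "\<phi> J x = J x (h + c) w2" if "J \<in> ?I" "x \<in> M1.E h" for J x h
    unfolding \<phi>_def by (rule M1.G.ext_hom[OF s.vector_space_axioms lin[OF that(1)] that(2)])
  have \<phi>_fin: "finite {h. J (M1.G.comp x h) (h + c) w2 \<noteq> 0}" if "J \<in> ?I" "x \<in> space W1" for J x
    using M1.G.ext_finite[OF s.vector_space_axioms lin[OF that(1)] that(2)] .
  have \<phi>_add: "\<phi> J (x + y) = \<phi> J x + \<phi> J y" and \<phi>_scale: "\<phi> J (s e x) = s e (\<phi> J x)"
    if "J \<in> ?I" "x \<in> space W1" "y \<in> space W1" for J x y e
    using \<phi>_lin[OF that(1)] that(2,3) unfolding linear_on_def by auto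
  have \<phi>_zero: "\<phi> J 0 = 0" if "J \<in> ?I" for J using \<phi>_scale[OF that M1.S0 M1.S0, of 0] by simp
  have \<phi>_sum: "\<phi> J (sum f A) = (\<Sum>i\<in>A. \<phi> J (f i))" if "J \<in> ?I" "\<And>i. f i \<in> space W1" for J A and f :: "nat \<Rightarrow> 'u"
    by (induction A rule: infinite_finite_induct)
      (simp_all add: \<phi>_zero that \<phi>_add s.subspace_sum[OF M1.subspace_S])
  have \<phi>_mem: "\<phi> J x \<in> M3.E h3" if JI: "J \<in> ?I" and "x \<in> space W1" for J x
    using that(2)
  proof (induction x rule: M1.G.hom_induct)
    case (hom h x)
    interpret J: intertwiner V s W1 W2 W3 J by (rule it[OF JI])
    have "J x (h + c) w2 \<in> M3.E (h + h2 - (h + c) - 1)" by (rule J.J_shift[OF hom w2(1)])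
    then show ?case using \<phi>_hom[OF JI hom] by (simp add: c_def)
  next
    case (add x y)
    then show ?case using \<phi>_add[OF JI] M3.subspace_L0_eigenspace s.subspace_add by metis
  qed
  have \<phi>_rel: "\<phi> J x = 0" if JI: "J \<in> ?I" and "x \<in> M1.relators" for J x
  proof -
    interpret J: intertwiner V s W1 W2 W3 J by (rule it[OF JI])
    obtain K p v l a h where x: "x = (\<Sum>i<K. s (of_int p gchoose i) (act W1 v (l + int i) a))"
      "v \<in> weight_space V p" "l \<le> -2" "a \<in> M1.E h" "\<forall>i\<ge>K. act W1 v (l + int i) a = 0"
      using \<open>x \<in> M1.relators\<close> unfolding M1.relators_def by blast
    have aS: "a \<in> space W1" using x(4) M1.L0_eigenspace_subset by blast
    \<comment> \<open>Chosen so that \<open>p + n - i\<close> equals \<open>c\<close> plus the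
      weight \<open>p + h - l - i - 1\<close> of \<open>act W1 v (l + i) a\<close>; the right side
      of the Jacobi identity is then \<phi> of the relator.\<close>
    define n where "n = h + c - of_int l - 1"
    have "\<phi> J x = (\<Sum>i<K. s (of_int p gchoose i) (\<phi> J (act W1 v (l + int i) a)))"
      unfolding x(1) using JI aS
      by (simp add: \<phi>_sum \<phi>_scale[OF JI _ M1.S0] M1.Y_closed s.subspace_scale[OF M1.subspace_S])
    also have "\<dots> = (\<Sum>i<K. s (of_int p gchoose i) (J (act W1 v (l + int i) a) (of_int p + n - of_nat i) w2))"
    proof (rule sum.cong, simp)
      fix i
      have "act W1 v (l + int i) a \<in> M1.E (of_int p + h - of_int (l + int i) - 1)"
        by (rule M1.L0_eigenspace_shift[OF x(2,4)])
      from \<phi>_hom[OF JI this]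
      show "s (of_int p gchoose i) (\<phi> J (act W1 v (l + int i) a)) = s (of_int p gchoose i) (J (act W1 v (l + int i) a) (of_int p + n - of_nat i) w2)"
        by (simp add: n_def algebra_simps)
    qed
    also have "\<dots> = 0"
    proof -
      obtain K' where K': "K' \<ge> K" "jac_eq s (act W1) (act W2) (act W3) J v a w2 l p n K'"
        using eventually_obtain_ge[OF J.J_jac_eventually[OF aS w2S, of v l p n], of K] by blast
      have z1: "J a (n + of_nat i) w2 = 0" for i
      proof -
        have "J a (n + of_nat i) w2 \<in> M3.E (h + h2 - (n + of_nat i) - 1)"
          by (rule J.J_shift[OF x(4) w2(1)])
        \<comment> \<open>The difference to \<open>h3\<close> is \<open>i - l - 1\<close>, a
          positive integer since \<open>l\<close> is at most -2.\<close>
        also have "h + h2 - (n + of_nat i) - 1 = h3 - of_nat (Suc (i + nat (- l - 2)))"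
          using x(3) by (simp add: n_def c_def of_nat_nat)
        finally show ?thesis using h3(2) by blast
      qed
      have z2: "act W2 v (p + int i) w2 = 0" for i
      proof -
        have "act W2 v (p + int i) w2 \<in> M2.E (of_int p + h2 - of_int (p + int i) - 1)"
          by (rule M2.L0_eigenspace_shift[OF x(2) w2(1)])
        also have "of_int p + h2 - of_int (p + int i) - 1 = h2 - of_nat (Suc i)" by simp
        finally show ?thesis using h2(2) by blast
      qed
      let ?r = "\<lambda>i. s (of_int p gchoose i) (J (act W1 v (l + int i) a) (of_int p + n - of_nat i) w2)"
      have "(\<Sum>i<K'. ?r i) = 0"
        using K'(2) unfolding jac_eq_def by (simp add: z1 z2 J.J_zero)
      moreover have "(\<Sum>i<K. ?r i) = (\<Sum>i<K'. ?r i)"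
        by (rule sum.mono_neutral_left) (use K'(1) x(5) in \<open>auto simp: J.J_zero_left\<close>)
      ultimately show ?thesis by simp
    qed
    finally show ?thesis .
  qed
  have inj: "J = 0" if JI: "J \<in> ?I" and J0: "\<And>x. x \<in> X \<Longrightarrow> \<phi> J x = 0" for J
  proof -
    interpret J: intertwiner V s W1 W2 W3 J by (rule it[OF JI])
    have rS: "M1.relators \<subseteq> space W1" using X(3) s.span_superset[of "X \<union> M1.relators"] by blast
    have all: "\<phi> J x = 0" if "x \<in> space W1" for x
    proof -
      have "x \<in> s.span (X \<union> M1.relators)" using that X(3) by simp
      then have "x \<in> space W1 \<and> \<phi> J x = 0"
      proof (induction rule: s.span_induct_alt)
        case base show ?case using \<phi>_zero[OF JI] M1.S0 by simp
      next
        case (step e x y)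
        have x: "x \<in> space W1" "\<phi> J x = 0" using step(1) X(2) rS J0 \<phi>_rel[OF JI] by blast+
        have "s e x \<in> space W1" using x s.subspace_scale[OF M1.subspace_S] by blast
        then show ?case using step(2) x \<phi>_add[OF JI] \<phi>_scale[OF JI x(1) x(1)] s.subspace_add[OF M1.subspace_S] by simp
      qed
      then show ?thesis by simp
    qed
    \<comment> \<open>\<open>T\<close> is a submodule of \<open>W3\<close> without vectors of weight
      \<open>h3\<close>: the only modes that could reach this weight are recorded by \<phi>, which
      is zero. So \<open>T\<close> is proper and vanishes by irreducibility.\<close>
    define T where "T = s.span {J a n w2 | a n. a \<in> space W1}"
    have T_hom: "T \<subseteq> s.span (\<Union>g. if g = h3 then {} else M3.E g)" (is "_ \<subseteq> s.span (\<Union>g. ?T g)")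
      unfolding T_def
    proof (rule s.span_minimal, clarify)
      fix a n assume "a \<in> space W1"
      then show "J a n w2 \<in> s.span (\<Union>g. ?T g)"
      proof (induction a rule: M1.G.hom_induct)
        case (hom h a)
        show ?case
        proof (cases "h + h2 - n - 1 = h3")
          case True
          then have "n = h + c" by (simp add: c_def algebra_simps)
          moreover have "a \<in> space W1" using M1.L0_eigenspace_subset hom by blast
          ultimately have "J a n w2 = 0" using \<phi>_hom[OF JI hom] all by simp
          then show ?thesis by (simp add: s.span_zero)
        next
          case False
          have "J a n w2 \<in> M3.E (h + h2 - n - 1)" by (rule J.J_shift[OF hom w2(1)])
          then have "J a n w2 \<in> ?T (h + h2 - n - 1)" using False by simp
          then show ?thesis by (intro s.span_base UN_I[of "h + h2 - n - 1"]) auto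
        qed
      next
        case (add x y)
        then show ?case by (simp add: J.J_add_left[OF w2S] s.span_add)
      qed
    qed simp
    have "submodule s W3 T"
      unfolding submodule_def
    proof (intro conjI allI ballI)
      show TS: "T \<subseteq> space W3"
        unfolding T_def by (rule s.span_minimal) (auto intro: J.J_closed w2S M3.subspace_S)
      show subT: "s.subspace T" by (simp add: T_def)
      fix v m y assume "y \<in> T"
      then have "y \<in> space W3 \<and> act W3 v m y \<in> T"
        unfolding T_def
      proof (induction rule: s.span_induct_alt)
        case base show ?case by (simp add: M3.S0 s.span_zero)
      next
        case (step e x y)
        then obtain a n where a: "a \<in> space W1" "x = J a n w2" by blast
        have "act W3 v m (J a n w2) \<in> T"
        proof (rule mode_product_in_span[OF s.vector_space_axioms M3.Y_zero J.J_zero J.J_zero_left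
              J.J_jacobi[OF a(1) w2S] M2.trunc[OF w2S] M1.trunc[OF a(1)] J.J_trunc_from[OF a(1) w2S] subT])
          fix k n' show "J (act W1 v k a) n' w2 \<in> T"
            unfolding T_def using M1.Y_closed[OF a(1)] by (intro s.span_base) blast
        qed
        moreover have "x \<in> space W3" using a J.J_closed w2S by blast
        ultimately show ?case using step(2) a s.subspace_scale[OF M3.subspace_S] s.subspace_add[OF M3.subspace_S]
          unfolding T_def by (simp add: M3.Y_add M3.Y_scale s.span_add s.span_scale)
      qed
      then show "act W3 v m y \<in> T" by simp
    qed
    moreover have "T \<noteq> space W3"
    proof
      assume "T = space W3"
      obtain y where y: "y \<in> M3.E h3" "y \<noteq> 0" using h3(1) M3.G.zero_mem by blast
      then have "y \<in> s.span (\<Union>g. ?T g)" using T_hom \<open>T = space W3\<close> M3.L0_eigenspace_subset by blast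
      moreover have "?T g \<subseteq> M3.E g" for g by simp
      ultimately have "y \<in> s.span (?T h3)" by (intro M3.G.hom_span[where S = ?T] y(1))
      then show False using y(2) by simp
    qed
    ultimately have "T = {0}" using irr(2) unfolding irreducible_def by blast
    then have Jw2: "J a n w2 = 0" if "a \<in> space W1" for a n
      using that s.span_base[of "J a n w2" "{J a n w2 | a n. a \<in> space W1}"] unfolding T_def by blast
    \<comment> \<open>The vectors annihilated by all modes of \<open>J\<close> form a submodule by
      the commutator formula. It contains \<open>w2\<close>, so irreducibility of \<open>W2\<close>
      gives \<open>J = 0\<close>.\<close>
    define U where "U = {b \<in> space W2. \<forall>a\<in>space W1. \<forall>n. J a n b = 0}"
    have "submodule s W2 U"
      unfolding submodule_def
    proof (intro conjI allI ballI)
      show "U \<subseteq> space W2" by (auto simp: U_def)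
      show "s.subspace U"
        using M2.subspace_S unfolding s.subspace_def U_def by (auto simp: J.J_zero J.J_add J.J_scale)
    next
      fix v m b assume b: "b \<in> U"
      then have bS: "b \<in> space W2" and bJ: "\<And>a n. a \<in> space W1 \<Longrightarrow> J a n b = 0" by (auto simp: U_def)
      have "J a n (act W2 v m b) = 0" if a: "a \<in> space W1" for a n
      proof -
        obtain K where "\<And>i. i \<ge> K \<Longrightarrow> act W1 v (int i) a = 0"
          using M1.trunc_from[OF a, of v 0] by auto
        from J.J_commutator[OF a bS this, where m = m and n = n] show ?thesis
          using bJ M1.Y_closed[OF a] by (simp add: bJ[OF a])
      qed
      then show "act W2 v m b \<in> U" using M2.Y_closed[OF bS] by (simp add: U_def)
    qed
    moreover have "w2 \<in> U" using w2S Jw2 by (simp add: U_def)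
    ultimately have "U = space W2" using irr(1) w2(2) unfolding irreducible_def by blast
    then have "J a n b = 0" for a n b
      using J.J_outside[of a b n] by (cases "a \<in> space W1 \<and> b \<in> space W2") (auto simp: U_def)
    then show ?thesis by (simp add: fun_eq_iff)
  qed
  obtain B0 where B0: "finite B0" "s.span B0 = M3.E h3"
  proof -
    have "finite_dimensional s (M3.E h3)" using o(3) by (simp add: ordinary_module_def)
    then show ?thesis using that unfolding finite_dimensional_def by blast
  qed
  obtain B where B: "B \<subseteq> B0" "s.independent B" "B0 \<subseteq> s.span B"
    using s.maximal_independent_subset[of B0] by blast
  have finB: "finite B" using B(1) B0(1) finite_subset by blast
  have spB: "s.span B = M3.E h3"
    using B s.span_mono[OF B(1)] s.span_minimal[OF B(3)] B0(2) by auto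
  \<comment> \<open>The coordinates of \<open>\<phi> J x\<close>, for \<open>x\<close> in
    \<open>X\<close>, in a basis of the lowest weight space of \<open>W3\<close>: finitely many
    functionals, which separate intertwining operators by \<open>inj\<close>.\<close>
  let ?F = "(\<lambda>(x, b) J. s.representation B (\<phi> J x) b) ` (X \<times> B)"
  show ?thesis
  proof (rule finite_dim_by_functionals[OF intertwining_vector_space[OF s], of ?F])
    show "finite ?F" using X(1) finB by simp
    show "module.subspace (pointwise s) ?I"
      by (rule intertwining_subspace) (rule M1.weak_mod_axioms M2.weak_mod_axioms M3.weak_mod_axioms)+
  next
    fix f assume "f \<in> ?F"
    then obtain x b where xb: "x \<in> X" "b \<in> B" "f = (\<lambda>J. s.representation B (\<phi> J x) b)" by auto
    have x: "x \<in> space W1" using xb(1) X(2) by blast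
    have add: "\<phi> (J + J') x = \<phi> J x + \<phi> J' x" if "J \<in> ?I" "J' \<in> ?I" for J J'
      unfolding \<phi>_def M1.G.ext_def plus_fun_apply
      by (rule Sum_any.distrib) (rule \<phi>_fin[OF _ x] that)+
    have scl: "\<phi> (pointwise s e J) x = s e (\<phi> J x)" if "J \<in> ?I" for J e
      unfolding \<phi>_def M1.G.ext_def pointwise_def
      by (rule Sum_any_additive[symmetric, where P = "\<lambda>_. True"]) (use \<phi>_fin[OF that x] in \<open>auto simp: s.scale_right_distrib\<close>)
    have mem: "\<phi> J x \<in> s.span B" if "J \<in> ?I" for J using \<phi>_mem[OF that x] spB by simp
    show "linear_on (pointwise s) (*) ?I f"
      unfolding linear_on_def xb(3)
      by (simp add: add scl mem s.representation_add[OF B(2)] s.representation_scale[OF B(2)])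
  next
    fix J assume JI: "J \<in> ?I" and z: "\<forall>f\<in>?F. f J = 0"
    show "J = 0"
    proof (rule inj[OF JI])
      fix x assume xX: "x \<in> X"
      then have x: "x \<in> space W1" using X(2) by blast
      have r: "s.representation B (\<phi> J x) b = 0" for b
      proof (cases "b \<in> B")
        case True
        then have "(\<lambda>J. s.representation B (\<phi> J x) b) \<in> ?F" using xX by (intro image_eqI[of _ _ "(x, b)"]) auto
        from bspec[OF z this] show ?thesis .
      qed (use s.representation_ne_zero in blast)
      have "\<phi> J x \<in> s.span B" using \<phi>_mem[OF JI x] spB by simp
      from s.sum_nonzero_representation_eq[OF B(2) this] show "\<phi> J x = 0" by (simp add: r)
    qed
  qed
qed

section \<open>Class \<open>\<A>\<close> and regularity\<close>

text \<open>Each ordinary summand is spanned by its eigenvectors, which are eigenvectors of the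
  whole module; \<open>L0_semisimpleI\<close> asks for nothing more.\<close>

lemma (in voa_alg) regular_imp_class_A:
  fixes s :: "complex \<Rightarrow> 'u::ab_group_add \<Rightarrow> 'u"
  assumes s: "vector_space s" and "regular V s"
  shows "class_A V s"
  unfolding class_A_def
proof (intro allI impI)
  fix W :: "('v, 'u) vmod" assume W: "weak_module V s W"
  interpret s: vector_space s by fact
  interpret W: weak_mod V s W using W by unfold_locales
  obtain Q where Q: "\<And>N. N \<in> Q \<Longrightarrow> ordinary_module V s (W\<lparr>space := N\<rparr>) \<and> submodule s W N"
    "is_direct_sum s (space W) Q (\<lambda>N. N)"
    using assms(2)[unfolded regular_def, rule_format, OF W] by blast
  show "L0_semisimple V s W"
  proof (rule W.L0_semisimpleI)
    have "N \<subseteq> s.span (\<Union>h. L0_eigenspace V s W h)" if "N \<in> Q" for N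
    proof -
      have "N = s.span (\<Union>h. L0_eigenspace V s (W\<lparr>space := N\<rparr>) h)"
        using Q(1)[OF that] unfolding ordinary_module_def is_direct_sum_def by simp
      moreover have "L0_eigenspace V s (W\<lparr>space := N\<rparr>) h \<subseteq> L0_eigenspace V s W h" for h
        using Q(1)[OF that] by (auto simp: L0_eigenspace_def submodule_def)
      ultimately show ?thesis
        using s.span_mono[of "\<Union>h. L0_eigenspace V s (W\<lparr>space := N\<rparr>) h" "\<Union>h. L0_eigenspace V s W h"] by blast
    qed
    then have "s.span (\<Union>N\<in>Q. N) \<subseteq> s.span (\<Union>h. L0_eigenspace V s W h)"
      by (intro s.span_minimal) auto
    moreover have "space W = s.span (\<Union>N\<in>Q. N)" using Q(2) unfolding is_direct_sum_def by blast
    ultimately show "space W \<subseteq> s.span (\<Union>h. L0_eigenspace V s W h)" by blast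
  qed
qed

theorem theorem3p13:
  fixes V :: "'v::ab_group_add voa"
    and s :: "complex \<Rightarrow> 'u::ab_group_add \<Rightarrow> 'u"
  assumes voa: "vertex_operator_algebra V"
    and universe: "vector_space s" "\<not> finite_dimensional s (UNIV :: 'u set)"
  shows "(class_A V s \<longrightarrow>
            finite (irreducible_N_gradable V s // equivalence_on s (irreducible_N_gradable V s)) \<and>
            (\<forall>W1 W2 W3.
               ordinary_module V s W1 \<and> irreducible s W1 \<and>
               ordinary_module V s W2 \<and> irreducible s W2 \<and>
               ordinary_module V s W3 \<and> irreducible s W3 \<longrightarrow>
               finite_dimensional (pointwise s) (intertwining_operators V s W1 W2 W3))) \<and>
         (regular V s \<longrightarrow>
            finite (irreducible_N_gradable V s // equivalence_on s (irreducible_N_gradable V s)) \<and>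
            (\<forall>W1 W2 W3.
               ordinary_module V s W1 \<and> irreducible s W1 \<and>
               ordinary_module V s W2 \<and> irreducible s W2 \<and>
               ordinary_module V s W3 \<and> irreducible s W3 \<longrightarrow>
               finite_dimensional (pointwise s) (intertwining_operators V s W1 W2 W3)))"
proof -
  interpret voa_alg V by unfold_locales fact
  have fin: "finite (irreducible_N_gradable V s // equivalence_on s (irreducible_N_gradable V s))"
    if A: "class_A V s"
  proof -
    obtain X where "finite X" "space adjoint_module = V.span (X \<union> graded_mod.relators V (scale V) adjoint_module)"
      using weak_mod.ordinary_spanning[OF weak_mod_adjoint universe A ordinary_adjoint] by blast
    then show ?thesis by (intro finite_irreducible_N_gradable[OF universe(1)]) auto
  qed
  have fus: "finite_dimensional (pointwise s) (intertwining_operators V s W1 W2 W3)"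
    if A: "class_A V s" and W: "ordinary_module V s W1" "ordinary_module V s W2" "irreducible s W2"
      "ordinary_module V s W3" "irreducible s W3" for W1 W2 W3
  proof -
    have "weak_mod V s W1"
      using universe(1) W(1) voa
      by (intro weak_mod.intro weak_mod_axioms.intro voa_alg.intro) (simp_all add: ordinary_module_def)
    then obtain X where "finite X" "X \<subseteq> space W1" "space W1 = module.span s (X \<union> graded_mod.relators V s W1)"
      using weak_mod.ordinary_spanning[OF _ universe A W(1)] by blast
    then show ?thesis by (intro fusion_rule_finite[OF universe(1) W(1,2,4,3,5)])
  qed
  show ?thesis using fin fus regular_imp_class_A[OF universe(1)] by blast
qed

end
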